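(* For every $\alpha\in(0,1/4)$ there is a number $C(\alpha)$, depending only on $\alpha$ (in particular not on the dimension), such that the following holds for every $d\ge 1$. Let $\gamma$ be the standard Gaussian measure on $\mathbb{R}^d$, let $\mu=f\cdot\gamma$ be a probability measure on $\mathbb{R}^d$ with density $f$ with respect to $\gamma$, let $v\colon\mathbb{R}^d\to\mathbb{R}^d$ be a Borel vector field with $|v|\in L^1(\mu)$, and suppose that $\mu$ satisfies the stationary Fokker--Planck--Kolmogorov equation $\Delta\mu-\operatorname{div}(b\mu)=0$ with drift $b(x)=-x+v(x)$, that is, $$\int_{\mathbb{R}^d}\bigl[\Delta\varphi(x)+\langle -x+v(x),\nabla\varphi(x)\rangle\bigr]\,\mu(dx)=0\quad\text{for all }\varphi\in C_0^\infty(\mathbb{R}^d).$$ Then $$\int_{\mathbb{R}^d} f\,\bigl(\log(f+1)\bigr)^{\alpha}\,d\gamma\le C(\alpha)\Bigl[1+\|v\|_{L^1(\mu)}\bigl(\log(1+\|v\|_{L^1(\mu)})\bigr)^{\alpha}\Bigr].$$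
   Context: The standard Gaussian measure $\gamma$ on $\mathbb{R}^d$ has density $(2\pi)^{-d/2}\exp(-|x|^2/2)$ with respect to Lebesgue measure. $f\cdot\gamma$ denotes the measure with density $f$ with respect to $\gamma$. Notation: $\|v\|_{L^1(\mu)}:=\int_{\mathbb{R}^d}|v|\,d\mu$, where $|\cdot|$ is the Euclidean norm. $C_0^\infty(\mathbb{R}^d)$ is the class of smooth compactly supported functions. *)

theory Defs
  imports "HOL-Probability.Probability"
begin

text \<open>
  The constant in the theorem must not depend on the dimension \<open>d\<close>, so \<open>d\<close> is quantified
  inside the formula and cannot be a type. The space of dimension \<open>d\<close> is therefore represented
  by the functions on \<open>{..<d}\<close>, taken to be \<open>undefined\<close> outside \<open>{..<d}\<close>, with the subspace
  topology of the product topology on \<^typ>\<open>nat \<Rightarrow> real\<close>. Its Borel sigma-algebra is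
  that of \<open>Pi\<^sub>M {..<d} (\<lambda>_. borel)\<close> and its Euclidean norm is \<open>L2_set x {..<d}\<close>.
\<close>

definition Rd :: "nat \<Rightarrow> (nat \<Rightarrow> real) set" where
  "Rd d = PiE {..<d} (\<lambda>_. UNIV)"

definition inner_Rd :: "nat \<Rightarrow> (nat \<Rightarrow> real) \<Rightarrow> (nat \<Rightarrow> real) \<Rightarrow> real" where
  "inner_Rd d x y = (\<Sum>i<d. x i * y i)"

definition std_gaussian :: "nat \<Rightarrow> (nat \<Rightarrow> real) measure" where
  "std_gaussian d = density (Pi\<^sub>M {..<d} (\<lambda>_. lborel))
     (\<lambda>x. ennreal ((2 * pi) powr (- real d / 2) * exp (- (L2_set x {..<d})\<^sup>2 / 2)))"

definition partial_deriv :: "nat \<Rightarrow> ((nat \<Rightarrow> real) \<Rightarrow> real) \<Rightarrow> (nat \<Rightarrow> real) \<Rightarrow> real" where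
  "partial_deriv i \<phi> x = deriv (\<lambda>t. \<phi> (x(i := t))) (x i)"

definition grad :: "((nat \<Rightarrow> real) \<Rightarrow> real) \<Rightarrow> (nat \<Rightarrow> real) \<Rightarrow> (nat \<Rightarrow> real)" where
  "grad \<phi> x = (\<lambda>i. partial_deriv i \<phi> x)"

definition laplacian :: "nat \<Rightarrow> ((nat \<Rightarrow> real) \<Rightarrow> real) \<Rightarrow> (nat \<Rightarrow> real) \<Rightarrow> real" where
  "laplacian d \<phi> x = (\<Sum>i<d. partial_deriv i (partial_deriv i \<phi>) x)"

text \<open>
  Smoothness: partial derivatives of every order exist and are continuous. A list of indices
  \<open>[i\<^sub>1, \<dots>, i\<^sub>k]\<close> stands for the iterated derivative \<open>\<partial>\<^sub>i\<^sub>1 \<dots> \<partial>\<^sub>i\<^sub>k \<phi>\<close>.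
  The differentiability clause is needed because \<^const>\<open>deriv\<close> is total. Only the values
  of \<open>\<phi>\<close> on \<open>Rd d\<close> matter.
\<close>

definition smooth_Rd :: "nat \<Rightarrow> ((nat \<Rightarrow> real) \<Rightarrow> real) \<Rightarrow> bool" where
  "smooth_Rd d \<phi> \<longleftrightarrow>
     (\<forall>is. set is \<subseteq> {..<d} \<longrightarrow>
        continuous_on (Rd d) (foldr partial_deriv is \<phi>) \<and>
        (\<forall>i<d. \<forall>x\<in>Rd d. (\<lambda>t. foldr partial_deriv is \<phi> (x(i := t))) differentiable (at (x i))))"

definition test_functions :: "nat \<Rightarrow> ((nat \<Rightarrow> real) \<Rightarrow> real) set" where
  "test_functions d = {\<phi>. smooth_Rd d \<phi> \<and> compact (closure {x \<in> Rd d. \<phi> x \<noteq> 0})}"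

text \<open>
  The equation \<open>\<Delta>\<mu> - div (b \<mu>) = 0\<close> in the weak sense. The integrand is \<open>\<mu>\<close>-integrable for every
  test function as soon as \<open>\<mu>\<close> is a finite Borel measure and \<open>b\<close> is Borel and locally
  \<open>\<mu>\<close>-integrable, so the convention that non-integrable functions have integral 0 plays no role.
\<close>

definition stationary_FPK ::
  "nat \<Rightarrow> ((nat \<Rightarrow> real) \<Rightarrow> (nat \<Rightarrow> real)) \<Rightarrow> (nat \<Rightarrow> real) measure \<Rightarrow> bool" where
  "stationary_FPK d b \<mu> \<longleftrightarrow>
     (\<forall>\<phi>\<in>test_functions d.
        (\<integral>x. laplacian d \<phi> x + inner_Rd d (b x) (grad \<phi> x) \<partial>\<mu>) = 0)"

definition L1_norm ::
  "nat \<Rightarrow> (nat \<Rightarrow> real) measure \<Rightarrow> ((nat \<Rightarrow> real) \<Rightarrow> (nat \<Rightarrow> real)) \<Rightarrow> real" where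
  "L1_norm d \<mu> v = (\<integral>x. L2_set (v x) {..<d} \<partial>\<mu>)"

end

theory Submission
  imports Defs "HOL-Real_Asymp.Real_Asymp"
begin

text \<open>
  Let \<open>T\<^sub>t\<close> be the Ornstein-Uhlenbeck semigroup, \<open>L = \<Delta> - \<langle>x, \<nabla>\<rangle>\<close> its generator, \<open>0 < \<kappa> \<le> 1\<close> and \<open>h = T\<^sub>t g\<close> for a
  smooth \<open>g\<close> with \<open>0 < g \<le> 1\<close>. Concavity gives \<open>L (h\<^sup>\<kappa>) \<le> \<kappa> h\<^bsup>\<kappa>-1\<^esup> L h = \<partial>\<^sub>t (h\<^sup>\<kappa>)\<close>, and the equation tested
  with \<open>h\<^sup>\<kappa>\<close> turns the \<open>\<mu>\<close>-integral of the left-hand side into that of \<open>- \<langle>v, \<nabla>(h\<^sup>\<kappa>)\<rangle>\<close>. The dimension-free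
  estimate \<open>|\<nabla>h| \<le> c(t) \<kappa>\<^bsup>-1/2\<^esup> h\<^bsup>1-\<kappa>\<^esup>\<close>, with \<open>c\<close> of integral \<open>\<pi>/2\<close>, bounds the latter below by
  \<open>- c(t) \<kappa>\<^bsup>1/2\<^esup> |v|\<close>. Integrating over \<open>t\<close> yields \<open>\<integral> g\<^sup>\<kappa> d\<mu> \<le> (\<integral> g d\<gamma>)\<^sup>\<kappa> + (\<pi>/2) \<kappa>\<^bsup>1/2\<^esup> \<parallel>v\<parallel>\<close>, which by regularity
  holds for indicators as well. For the set where \<open>ln (f + 1) \<ge> s\<close>, of \<open>\<gamma>\<close>-measure at most \<open>2 e\<^bsup>-s\<^esup>\<close>, the
  choice \<open>\<kappa> = s\<^bsup>-1/2\<^esup>\<close> bounds the \<open>\<mu>\<close>-measure by \<open>2 (1 + \<parallel>v\<parallel>) s\<^bsup>-1/4\<^esup>\<close>, and the tail is summed dyadically.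
\<close>

section \<open>Smooth functions on the coordinate space\<close>

text \<open>No smoothness of \<open>f\<close> is available, so the semigroup acts on the test
  function; the density enters only at the end, through Markov's inequality. As \<open>v\<close> is
  merely integrable, the gradient of the test function has to be bounded in supremum norm, with a
  constant independent of \<open>d\<close>. Testing with \<open>h\<close> itself achieves this but
  yields only \<open>\<mu>(A) \<le> \<gamma>(A) + (\<pi>/2) V\<close>, which does not decay with
  \<open>\<gamma>(A)\<close>. The power is the device that creates a small factor: differentiation
  produces \<open>\<kappa> h powr (\<kappa> - 1)\<close>, of which the gradient estimate takes back
  only \<open>h powr (1 - \<kappa>) / sqrt \<kappa>\<close>. The price is
  \<open>\<gamma>(A) powr \<kappa>\<close> in place of \<open>\<gamma>(A)\<close>. With
  \<open>\<kappa> = s powr (-1/2)\<close> this is of order \<open>exp (- sqrt s)\<close>, so the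
  rate \<open>s powr (-1/4)\<close> of the other term decides, and it sets the range
  \<open>\<alpha> < 1/4\<close>. The moment bound obtained is a multiple of
  \<open>(1 + V) powr (4 * \<alpha>)\<close>; the logarithmic factor of the statement comes in by
  comparison.\<close>

lemma Rd_update: "x \<in> Rd d \<Longrightarrow> i < d \<Longrightarrow> x(i := t) \<in> Rd d"
  by (auto simp: Rd_def PiE_def extensional_def)

lemma continuous_on_update:
  "continuous_on UNIV (\<lambda>t::real. (x::nat\<Rightarrow>real)(i := t))"
proof (rule continuous_on_coordinatewise_then_product)
  fix j show "continuous_on UNIV (\<lambda>t. (x(i := t)) j)"
    by (cases "j = i") auto
qed

text \<open>The derivative enters existentially, as any function agreeing with it on
  \<open>Rd d\<close>, so that closure properties can be proved without computing the total function
  \<open>deriv\<close>. The flag \<open>b\<close> asks in addition that all derivatives up to order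
  \<open>k\<close> be bounded: \<open>Ck True\<close> is the class that Mehler averages preserve,
  while \<open>Ck False\<close> also contains the coordinates and the squared norm.\<close>

primrec Ck :: "bool \<Rightarrow> nat \<Rightarrow> nat \<Rightarrow> ((nat \<Rightarrow> real) \<Rightarrow> real) \<Rightarrow> bool" where
  "Ck b d 0 \<phi> \<longleftrightarrow> continuous_on (Rd d) \<phi> \<and> (b \<longrightarrow> bounded (\<phi> ` Rd d))"
| "Ck b d (Suc k) \<phi> \<longleftrightarrow> continuous_on (Rd d) \<phi> \<and> (b \<longrightarrow> bounded (\<phi> ` Rd d)) \<and>
     (\<forall>i<d. \<exists>\<psi>. (\<forall>x\<in>Rd d. ((\<lambda>t. \<phi> (x(i := t))) has_real_derivative \<psi> x) (at (x i))) \<and> Ck b d k \<psi>)"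

lemma Ck_continuous: "Ck b d k \<phi> \<Longrightarrow> continuous_on (Rd d) \<phi>"
  by (cases k) auto

lemma Ck_bounded: "Ck True d k \<phi> \<Longrightarrow> bounded (\<phi> ` Rd d)"
  by (cases k) auto

lemma Ck_SucD: "Ck b d (Suc k) \<phi> \<Longrightarrow> Ck b d k \<phi>"
proof (induction k arbitrary: \<phi>)
  case (Suc k)
  then show ?case by (subst Ck.simps(2), subst (asm) (2) Ck.simps(2)) blast
qed simp

lemma Ck_Suc_cases:
  assumes "Ck b d (Suc k) \<phi>"
  obtains D where "\<And>i x. i < d \<Longrightarrow> x \<in> Rd d \<Longrightarrow> ((\<lambda>t. \<phi> (x(i := t))) has_real_derivative D i x) (at (x i))"
    "\<And>i. i < d \<Longrightarrow> Ck b d k (D i)"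
proof -
  have "\<forall>i. \<exists>\<psi>. i < d \<longrightarrow> (\<forall>x\<in>Rd d. ((\<lambda>t. \<phi> (x(i := t))) has_real_derivative \<psi> x) (at (x i))) \<and> Ck b d k \<psi>"
    using assms by auto
  from choice[OF this] that show ?thesis by blast
qed

lemma Ck_SucI:
  assumes "continuous_on (Rd d) \<phi>" "b \<Longrightarrow> bounded (\<phi> ` Rd d)"
    "\<And>i x. i < d \<Longrightarrow> x \<in> Rd d \<Longrightarrow> ((\<lambda>t. \<phi> (x(i := t))) has_real_derivative D i x) (at (x i))"
    "\<And>i. i < d \<Longrightarrow> Ck b d k (D i)"
  shows "Ck b d (Suc k) \<phi>"
  using assms by auto

lemma Ck_cong:
  assumes "Ck b d k \<phi>" "\<And>x. x \<in> Rd d \<Longrightarrow> \<phi> x = \<psi> x"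
  shows "Ck b d k \<psi>"
proof -
  have *: "continuous_on (Rd d) \<phi> \<longleftrightarrow> continuous_on (Rd d) \<psi>" "\<phi> ` Rd d = \<psi> ` Rd d"
    using assms(2) by (auto intro: continuous_on_cong)
  show ?thesis
  proof (cases k)
    case 0 then show ?thesis using assms(1) * by simp
  next
    case (Suc j)
    from Ck_Suc_cases[OF assms(1)[unfolded Suc]] obtain D where
      D: "\<And>i x. i < d \<Longrightarrow> x \<in> Rd d \<Longrightarrow> ((\<lambda>t. \<phi> (x(i := t))) has_real_derivative D i x) (at (x i))"
      "\<And>i. i < d \<Longrightarrow> Ck b d j (D i)" by blast
    have "((\<lambda>t. \<psi> (x(i := t))) has_real_derivative D i x) (at (x i))" if "i < d" "x \<in> Rd d" for i x
      using D(1)[OF that] assms(2)[OF Rd_update[OF that(2,1)]] by simp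
    from Ck_SucI[OF _ _ this D(2)] show ?thesis
      using assms(1) * unfolding Suc by simp
  qed
qed

text \<open>By uniqueness of derivatives, any explicit formula for a partial derivative inherits the
  class of the existential witness.\<close>

lemma Ck_partial:
  assumes "Ck b d (Suc k) \<phi>" "i < d"
    "\<And>x. x \<in> Rd d \<Longrightarrow> ((\<lambda>t. \<phi> (x(i := t))) has_real_derivative \<psi> x) (at (x i))"
  shows "Ck b d k \<psi>"
proof -
  from Ck_Suc_cases[OF assms(1)] obtain D where
    D: "\<And>i x. i < d \<Longrightarrow> x \<in> Rd d \<Longrightarrow> ((\<lambda>t. \<phi> (x(i := t))) has_real_derivative D i x) (at (x i))"
    "\<And>i. i < d \<Longrightarrow> Ck b d k (D i)" by blast
  show ?thesis
    using Ck_cong[OF D(2)[OF assms(2)]] DERIV_unique[OF D(1)[OF assms(2)] assms(3)] by blast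
qed

text \<open>Each differentiation costs one order, so the induction over the list of indices carries
  all orders \<open>k\<close> at once.\<close>

lemma smooth_RdI:
  assumes "\<And>k. Ck b d k \<phi>"
  shows "smooth_Rd d \<phi>"
proof -
  have *: "Ck b d k (foldr partial_deriv is \<phi>)" if "set is \<subseteq> {..<d}" for "is" k
    using that
  proof (induction "is" arbitrary: k)
    case Nil then show ?case using assms by simp
  next
    case (Cons i "is")
    let ?F = "foldr partial_deriv is \<phi>"
    have i: "i < d" using Cons by simp
    have "Ck b d (Suc k) ?F" by (rule Cons.IH) (use Cons.prems in simp)
    from Ck_Suc_cases[OF this] obtain D where
      D: "\<And>i x. i < d \<Longrightarrow> x \<in> Rd d \<Longrightarrow> ((\<lambda>t. ?F (x(i := t))) has_real_derivative D i x) (at (x i))"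
      "\<And>i. i < d \<Longrightarrow> Ck b d k (D i)" by blast
    have "D i x = partial_deriv i ?F x" if "x \<in> Rd d" for x
      using DERIV_imp_deriv[OF D(1)[OF i that]] by (simp add: partial_deriv_def)
    from Ck_cong[OF D(2)[OF i] this] show ?case by simp
  qed
  have "(\<lambda>t. foldr partial_deriv is \<phi> (x(i := t))) differentiable (at (x i))"
    if "set is \<subseteq> {..<d}" "i < d" "x \<in> Rd d" for "is" i x
    using *[OF that(1), of "Suc 0"] that(2,3) real_differentiable_def by fastforce
  then show ?thesis
    unfolding smooth_Rd_def using Ck_continuous *[of _ 0] by blast
qed

lemma Ck_const: "Ck b d k (\<lambda>_. c)"
proof (induction k arbitrary: c)
  case 0 show ?case by (auto simp: image_constant_conv)
next
  case (Suc k)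
  show ?case using Suc[of 0] by (auto simp: image_constant_conv intro!: exI[of _ "\<lambda>_. 0"])
qed

lemma bounded_mult_image:
  fixes f g :: "'a \<Rightarrow> real"
  assumes "bounded (f ` A)" "bounded (g ` A)"
  shows "bounded ((\<lambda>x. f x * g x) ` A)"
proof -
  from assms obtain a b where a: "\<And>x. x \<in> A \<Longrightarrow> \<bar>f x\<bar> \<le> a" and b: "\<And>x. x \<in> A \<Longrightarrow> \<bar>g x\<bar> \<le> b"
    unfolding bounded_iff by auto
  have "norm (f x * g x) \<le> a * b" if "x \<in> A" for x
    using a[OF that] b[OF that] by (auto simp: abs_mult intro!: mult_mono)
  then show ?thesis unfolding bounded_iff by auto
qed

lemma Ck_add: "Ck b d k \<phi> \<Longrightarrow> Ck b d k \<psi> \<Longrightarrow> Ck b d k (\<lambda>x. \<phi> x + \<psi> x)"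
proof (induction k arbitrary: \<phi> \<psi>)
  case 0 then show ?case by (auto intro!: continuous_intros bounded_plus_comp)
next
  case (Suc k)
  from Ck_Suc_cases[OF Suc.prems(1)] obtain D where
    D: "\<And>i x. i < d \<Longrightarrow> x \<in> Rd d \<Longrightarrow> ((\<lambda>t. \<phi> (x(i := t))) has_real_derivative D i x) (at (x i))"
      "\<And>i. i < d \<Longrightarrow> Ck b d k (D i)" by blast
  from Ck_Suc_cases[OF Suc.prems(2)] obtain E where
    E: "\<And>i x. i < d \<Longrightarrow> x \<in> Rd d \<Longrightarrow> ((\<lambda>t. \<psi> (x(i := t))) has_real_derivative E i x) (at (x i))"
      "\<And>i. i < d \<Longrightarrow> Ck b d k (E i)" by blast
  show ?case
    by (rule Ck_SucI[OF _ _ DERIV_add[OF D(1) E(1)] Suc.IH[OF D(2) E(2)]])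
      (use Suc.prems in \<open>auto intro!: continuous_intros bounded_plus_comp\<close>)
qed

lemma Ck_mult: "Ck b d k \<phi> \<Longrightarrow> Ck b d k \<psi> \<Longrightarrow> Ck b d k (\<lambda>x. \<phi> x * \<psi> x)"
proof (induction k arbitrary: \<phi> \<psi>)
  case 0 then show ?case by (auto intro!: continuous_intros bounded_mult_image)
next
  case (Suc k)
  from Ck_Suc_cases[OF Suc.prems(1)] obtain D where
    D: "\<And>i x. i < d \<Longrightarrow> x \<in> Rd d \<Longrightarrow> ((\<lambda>t. \<phi> (x(i := t))) has_real_derivative D i x) (at (x i))"
      "\<And>i. i < d \<Longrightarrow> Ck b d k (D i)" by blast
  from Ck_Suc_cases[OF Suc.prems(2)] obtain E where
    E: "\<And>i x. i < d \<Longrightarrow> x \<in> Rd d \<Longrightarrow> ((\<lambda>t. \<psi> (x(i := t))) has_real_derivative E i x) (at (x i))"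
      "\<And>i. i < d \<Longrightarrow> Ck b d k (E i)" by blast
  have der: "((\<lambda>t. \<phi> (x(i := t)) * \<psi> (x(i := t))) has_real_derivative D i x * \<psi> x + E i x * \<phi> x) (at (x i))"
    if "i < d" "x \<in> Rd d" for i x
    using DERIV_mult[OF D(1)[OF that] E(1)[OF that]] by simp
  have "Ck b d k (\<lambda>x. D i x * \<psi> x + E i x * \<phi> x)" if "i < d" for i
    by (intro Ck_add Suc.IH D(2)[OF that] E(2)[OF that] Ck_SucD[OF Suc.prems(1)] Ck_SucD[OF Suc.prems(2)])
  from Ck_SucI[OF _ _ der this] show ?case
    using Suc.prems by (auto intro!: continuous_intros bounded_mult_image)
qed

lemma Ck_sum: "finite J \<Longrightarrow> (\<And>j. j \<in> J \<Longrightarrow> Ck b d k (\<phi> j)) \<Longrightarrow> Ck b d k (\<lambda>x. \<Sum>j\<in>J. \<phi> j x)"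
  by (induction J rule: finite_induct) (auto simp: Ck_const Ck_add)

lemma Ck_prod: "finite J \<Longrightarrow> (\<And>j. j \<in> J \<Longrightarrow> Ck b d k (\<phi> j)) \<Longrightarrow> Ck b d k (\<lambda>x. \<Prod>j\<in>J. \<phi> j x)"
  by (induction J rule: finite_induct) (auto simp: Ck_const Ck_mult)

lemma Ck_coord: "j < d \<Longrightarrow> Ck False d k (\<lambda>x. x j)"
proof -
  assume j: "j < d"
  have c: "continuous_on (Rd d) (\<lambda>x. x j)"
    by (rule continuous_on_subset[OF continuous_on_product_coordinates]) simp
  show ?thesis
  proof (cases k)
    case (Suc m)
    have "((\<lambda>t. (x(i := t)) j) has_real_derivative (if i = j then 1 else 0)) (at (x i))" for x :: "nat \<Rightarrow> real" and i
      by (cases "i = j") auto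
    then show ?thesis unfolding Suc by (intro Ck_SucI[where D="\<lambda>i _. if i = j then 1 else 0"] c Ck_const) auto
  qed (simp add: c)
qed

section \<open>Composition with functions of one real variable\<close>

primrec C1 :: "nat \<Rightarrow> real set \<Rightarrow> (real \<Rightarrow> real) \<Rightarrow> bool" where
  "C1 0 S F \<longleftrightarrow> continuous_on S F"
| "C1 (Suc k) S F \<longleftrightarrow> (\<exists>F'. (\<forall>x\<in>S. (F has_real_derivative F' x) (at x)) \<and> C1 k S F')"

lemma C1_continuous: "C1 k S F \<Longrightarrow> continuous_on S F"
  by (cases k) (use DERIV_isCont in \<open>auto intro!: continuous_at_imp_continuous_on\<close>)

lemma C1_SucD: "C1 (Suc k) S F \<Longrightarrow> C1 k S F"
proof (induction k arbitrary: F)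
  case 0 then show ?case using C1_continuous[OF 0] by simp
next
  case (Suc k)
  from Suc.prems obtain F' where "\<And>x. x \<in> S \<Longrightarrow> (F has_real_derivative F' x) (at x)" "C1 (Suc k) S F'"
    by (subst (asm) C1.simps(2)) blast
  then show ?case using Suc.IH by (subst C1.simps(2)) blast
qed

text \<open>For the bounded class, the derivatives of \<open>F\<close> along \<open>\<phi>\<close>
  are bounded by continuity on the compact set \<open>T\<close>. This is why powers are later
  applied only to functions with values in \<open>{\<epsilon>..1}\<close> for some
  \<open>\<epsilon> > 0\<close>.\<close>

lemma Ck_compose:
  assumes "Ck b d k \<phi>" "C1 k S F" "\<phi> ` Rd d \<subseteq> T" "T \<subseteq> S" "b \<Longrightarrow> compact T"
  shows "Ck b d k (\<lambda>x. F (\<phi> x))"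
  using assms
proof (induction k arbitrary: F)
  case (0 F)
  have "continuous_on (Rd d) (\<lambda>x. F (\<phi> x))"
    by (rule continuous_on_compose2[of S F "Rd d" \<phi>]) (use 0 in auto)
  moreover have "bounded ((\<lambda>x. F (\<phi> x)) ` Rd d)" if b
  proof (rule bounded_subset)
    show "bounded (F ` T)"
      by (intro compact_imp_bounded compact_continuous_image continuous_on_subset[of S F T]) (use 0 that in auto)
  qed (use 0 in auto)
  ultimately show ?case by simp
next
  case (Suc k)
  from Ck_Suc_cases[OF Suc.prems(1)] obtain D where
    D: "\<And>i x. i < d \<Longrightarrow> x \<in> Rd d \<Longrightarrow> ((\<lambda>t. \<phi> (x(i := t))) has_real_derivative D i x) (at (x i))"
      "\<And>i. i < d \<Longrightarrow> Ck b d k (D i)" by blast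
  from Suc.prems(2) obtain F' where F': "\<And>y. y \<in> S \<Longrightarrow> (F has_real_derivative F' y) (at y)" "C1 k S F'" by auto
  have IH: "Ck b d k (\<lambda>x. F' (\<phi> x))" "Ck b d k (\<lambda>x. F (\<phi> x))"
    using Suc.IH[OF Ck_SucD[OF Suc.prems(1)]] F'(2) C1_SucD[OF Suc.prems(2)] Suc.prems(3-) by blast+
  have der: "((\<lambda>t. F (\<phi> (x(i := t)))) has_real_derivative F' (\<phi> x) * D i x) (at (x i))" if "i < d" "x \<in> Rd d" for i x
    using DERIV_chain2[of F "F' (\<phi> x)" "\<lambda>t. \<phi> (x(i := t))" "x i" "D i x" UNIV] F'(1)[of "\<phi> x"] D(1)[OF that]
      Suc.prems(3,4) that(2) by auto
  show ?case
    by (rule Ck_SucI[OF Ck_continuous[OF IH(2)] _ der Ck_mult[OF IH(1) D(2)]]) (use Ck_bounded IH(2) in auto)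
qed

lemma C1_powr: "C1 k {0<..} (\<lambda>x. c * x powr a)"
proof (induction k arbitrary: c a)
  case 0 show ?case by (auto intro!: continuous_intros)
next
  case (Suc k)
  have "((\<lambda>x. c * x powr a) has_real_derivative (c * a) * x powr (a - 1)) (at x)" if "x > 0" for x
    using that by (auto intro!: derivative_eq_intros)
  then show ?case using Suc[of "c * a" "a - 1"] by (subst C1.simps(2)) (auto intro!: exI[of _ "\<lambda>x. c * a * x powr (a - 1)"])
qed

text \<open>One family for three purposes: dilated cutoffs, translated and scaled bumps, and the
  argument of the Mehler formula, which is affine in the space variable and also in the Gaussian
  variable.\<close>

definition aff :: "nat \<Rightarrow> real \<Rightarrow> (nat \<Rightarrow> real) \<Rightarrow> (nat \<Rightarrow> real) \<Rightarrow> nat \<Rightarrow> real" where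
  "aff d c w x = (\<lambda>i\<in>{..<d}. c * x i + w i)"

lemma aff_in_Rd: "aff d c w x \<in> Rd d"
  by (auto simp: aff_def Rd_def)

lemma aff_update: "i < d \<Longrightarrow> aff d c w (x(i := t)) = (aff d c w x)(i := c * t + w i)"
  by (auto simp: aff_def)

lemma continuous_on_aff: "continuous_on A (aff d c w)"
  unfolding aff_def
proof (rule continuous_on_coordinatewise_then_product)
  fix i show "continuous_on A (\<lambda>x. (\<lambda>i\<in>{..<d}. c * x i + w i) i)"
    by (cases "i < d") (auto intro!: continuous_intros continuous_on_product_coordinates[THEN continuous_on_subset])
qed

lemma aff_deriv:
  assumes "i < d" "((\<lambda>t. \<phi> ((aff d c w x)(i := t))) has_real_derivative D) (at (aff d c w x i))"
  shows "((\<lambda>t. \<phi> (aff d c w (x(i := t)))) has_real_derivative c * D) (at (x i))"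
proof -
  have "((\<lambda>t. c * t + w i) has_real_derivative c) (at (x i))"
    by (auto intro!: derivative_eq_intros)
  from DERIV_chain2[OF _ this, of "\<lambda>t. \<phi> ((aff d c w x)(i := t))" D] assms show ?thesis
    by (simp add: aff_update[OF assms(1)] mult.commute) (simp add: aff_def assms(1))
qed

lemma Ck_aff: "Ck b d k \<phi> \<Longrightarrow> Ck b d k (\<lambda>x. \<phi> (aff d c w x))"
proof (induction k arbitrary: \<phi>)
  case 0
  then show ?case
    using continuous_on_compose2[OF _ continuous_on_aff, where g=\<phi> and s="Rd d" and t="Rd d" and d1=d and c1=c and w1=w] aff_in_Rd[of d c w]
    by (auto simp: image_subset_iff elim!: bounded_subset)
next
  case (Suc k)
  from Ck_Suc_cases[OF Suc.prems(1)] obtain D where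
    D: "\<And>i x. i < d \<Longrightarrow> x \<in> Rd d \<Longrightarrow> ((\<lambda>t. \<phi> (x(i := t))) has_real_derivative D i x) (at (x i))"
      "\<And>i. i < d \<Longrightarrow> Ck b d k (D i)" by blast
  have IH: "Ck b d k (\<lambda>x. \<phi> (aff d c w x))" using Suc.IH[OF Ck_SucD[OF Suc.prems]] .
  have der: "((\<lambda>t. \<phi> (aff d c w (x(i := t)))) has_real_derivative c * D i (aff d c w x)) (at (x i))"
    if "i < d" "x \<in> Rd d" for i x
    using aff_deriv[OF that(1) D(1)[OF that(1) aff_in_Rd]] .
  show ?case
    by (rule Ck_SucI[OF Ck_continuous[OF IH] _ der Ck_mult[OF Ck_const Suc.IH[OF D(2)]]])
      (use IH Ck_bounded in auto)
qed

section \<open>Squared norm, compact balls and supports\<close>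

definition sq :: "nat \<Rightarrow> (nat \<Rightarrow> real) \<Rightarrow> real" where "sq d x = (\<Sum>i<d. (x i)\<^sup>2)"

lemma Ck_sq: "Ck False d k (sq d)"
  unfolding sq_def power2_eq_square
  by (intro Ck_sum Ck_mult Ck_coord) auto

lemma continuous_on_sq: "continuous_on A (sq d)"
  unfolding sq_def by (auto intro!: continuous_intros continuous_on_product_coordinates[THEN continuous_on_subset])

text \<open>The ball is a closed part of a product of compact sets, namely intervals in the first
  \<open>d\<close> coordinates and the singleton \<open>{undefined}\<close> in all others, so
  Tychonoff's theorem in the full product space applies.\<close>

lemma compact_sq_ball: "compact {x \<in> Rd d. sq d x \<le> r}"
proof -
  let ?B = "PiE UNIV (\<lambda>i. if i < d then {-sqrt r..sqrt r} else {undefined})"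
  have "compactin (product_topology (\<lambda>_::nat. euclideanreal) UNIV) ?B"
    by (subst compactin_PiE) auto
  then have "compact ?B" by (simp add: euclidean_product_topology)
  moreover have "closed {x. sq d x \<le> r}"
    by (intro closed_Collect_le continuous_on_sq continuous_intros)
  ultimately have "compact (?B \<inter> {x. sq d x \<le> r})" by (rule compact_Int_closed)
  moreover have "?B \<inter> {x. sq d x \<le> r} = {x \<in> Rd d. sq d x \<le> r}"
  proof -
    have "\<bar>x i\<bar> \<le> sqrt r" if "sq d x \<le> r" "i < d" for x i
    proof (rule real_le_rsqrt)
      have "(x i)\<^sup>2 \<le> sq d x" unfolding sq_def using that(2) by (intro member_le_sum) auto
      then show "\<bar>x i\<bar>\<^sup>2 \<le> r" using that(1) by simp
    qed
    then show ?thesis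
      by (auto simp: Rd_def PiE_iff extensional_def abs_le_iff split: if_splits)
        (metis (mono_tags) lessThan_iff minus_le_iff)+
  qed
  ultimately show ?thesis by simp
qed

text \<open>Updating one coordinate is continuous, so for \<open>t\<close> near \<open>x i\<close>
  the point stays in \<open>O'\<close>, where \<open>\<phi>\<close> is constant. This gives the
  supports of derivatives that are known only as witnesses.\<close>

lemma partial_zero:
  assumes der: "((\<lambda>t. \<phi> (x(i := t))) has_real_derivative D) (at (x i))"
    and "x \<in> Rd d" "i < d" and O: "open O'" "x \<in> O'" and "\<And>y. y \<in> Rd d \<inter> O' \<Longrightarrow> \<phi> y = c"
  shows "D = 0"
proof -
  have "open ((\<lambda>t. x(i := t)) -` O')" 
    using continuous_on_update O(1) by (simp add: continuous_on_open_vimage)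
  moreover have "x i \<in> (\<lambda>t. x(i := t)) -` O'" using O(2) by simp
  ultimately have "eventually (\<lambda>t. t \<in> (\<lambda>t. x(i := t)) -` O') (nhds (x i))" by (rule eventually_nhds_in_open)
  then have "eventually (\<lambda>t. \<phi> (x(i := t)) = c) (nhds (x i))"
    by eventually_elim (use assms Rd_update in auto)
  then have "((\<lambda>t. c) has_real_derivative D) (at (x i))"
    using der by (subst (asm) DERIV_cong_ev[OF refl _ refl])
  then show ?thesis using DERIV_unique DERIV_const by blast
qed

lemma open_sq_gt: "open {x. r < sq d x}" and open_sq_less: "open {x. sq d x < r}"
  by (intro open_Collect_less continuous_on_sq continuous_intros)+

text \<open>Outside the ball the function is locally zero, so its derivatives vanish there as well;
  on the ball they are bounded by compactness.\<close>

lemma Ck_compact_support: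
  assumes "Ck False d k \<phi>" "\<And>x. x \<in> Rd d \<Longrightarrow> sq d x > r \<Longrightarrow> \<phi> x = 0"
  shows "Ck True d k \<phi>"
  using assms
proof (induction k arbitrary: \<phi>)
  have bd: "bounded (\<phi> ` Rd d)" if "continuous_on (Rd d) \<phi>" 
    "\<And>x. x \<in> Rd d \<Longrightarrow> sq d x > r \<Longrightarrow> \<phi> x = 0" for \<phi>
  proof -
    have "compact (\<phi> ` {x \<in> Rd d. sq d x \<le> r})"
      by (intro compact_continuous_image compact_sq_ball continuous_on_subset[OF that(1)]) auto
    then have "bounded (insert 0 (\<phi> ` {x \<in> Rd d. sq d x \<le> r}))" by (simp add: compact_imp_bounded)
    then show ?thesis by (rule bounded_subset) (use that(2) in force)
  qed
  {
    case 0 then show ?case using bd[OF _ 0(2)] by simp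
  next
    case (Suc k)
    from Ck_Suc_cases[OF Suc.prems(1)] obtain D where
      D: "\<And>i x. i < d \<Longrightarrow> x \<in> Rd d \<Longrightarrow> ((\<lambda>t. \<phi> (x(i := t))) has_real_derivative D i x) (at (x i))"
      "\<And>i. i < d \<Longrightarrow> Ck False d k (D i)" by blast
    have "D i x = 0" if "i < d" "x \<in> Rd d" "sq d x > r" for i x
      by (rule partial_zero[OF D(1)[OF that(1,2)] that(2,1) open_sq_gt, of r d 0]) (use that Suc.prems(2) in auto)
    then have "Ck True d k (D i)" if "i < d" for i using Suc.IH D(2) that by blast
    then show ?case using D(1) bd[OF Ck_continuous[OF Suc.prems(1)] Suc.prems(2)] Suc.prems(1) by auto
  }
qed

section \<open>A smooth radial cutoff\<close>

definition flat_exp :: "real \<Rightarrow> real" where "flat_exp x = (if x > 0 then exp (- (1/x)) else 0)"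

lemma C1_flat_exp: "C1 k UNIV flat_exp"
proof -
  \<comment> \<open>The functions \<open>p (1/x) exp (-1/x)\<close>, extended by zero, are closed
    under differentiation: in the variable \<open>y = 1/x\<close> the derivative replaces
    \<open>p\<close> by \<open>y\<^sup>2 (p - p')\<close>. Induction over the whole family then
    gives all orders.\<close>
  define E where "E p x = (if x > 0 then poly p (1/x) * exp (-(1/x)) else 0)" for p and x :: real
  have pE: "E (p + q) x = E p x + E q x" "E (p * q) x = (if x > 0 then poly p (1/x) else 0) * E q x" for p q x
    by (auto simp: E_def algebra_simps)
  have lim: "((\<lambda>y. poly p y * exp (- y)) \<longlongrightarrow> 0) at_top" for p :: "real poly"
  proof -
    have "((\<lambda>y. \<Sum>i\<le>degree p. coeff p i * (y ^ i / exp y)) \<longlongrightarrow> (\<Sum>i\<le>degree p. coeff p i * 0)) at_top"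
      by (intro tendsto_sum tendsto_mult tendsto_const tendsto_power_div_exp_0)
    then show ?thesis
      by (simp add: poly_altdef sum_distrib_right exp_minus divide_inverse mult.assoc)
  qed
  have der: "(E p has_real_derivative E ([:0,0,1:] * (p - pderiv p)) x) (at x)" for p x
  proof -
    consider "x > 0" | "x < 0" | "x = 0" by linarith
    then show ?thesis
    proof cases
      case 1
      have "((\<lambda>x. poly p (1/x) * exp (-(1/x))) has_real_derivative E ([:0,0,1:] * (p - pderiv p)) x) (at x)"
        using 1 by (auto intro!: derivative_eq_intros poly_DERIV[THEN DERIV_chain2] simp: E_def field_simps power2_eq_square)
      moreover have "eventually (\<lambda>y. poly p (1/y) * exp (-(1/y)) = E p y) (nhds x)"
        using eventually_nhds_in_open[of "{0<..}" x] 1 by (auto elim!: eventually_mono simp: E_def)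
      ultimately show ?thesis by (subst (asm) DERIV_cong_ev[OF refl _ refl])
    next
      case 2
      have "((\<lambda>x. 0) has_real_derivative E ([:0,0,1:] * (p - pderiv p)) x) (at x)"
        using 2 by (auto simp: E_def)
      moreover have "eventually (\<lambda>y. 0 = E p y) (nhds x)"
        using eventually_nhds_in_open[of "{..<0}" x] 2 by (auto elim!: eventually_mono simp: E_def)
      ultimately show ?thesis by (subst (asm) DERIV_cong_ev[OF refl _ refl])
    next
      case 3
      \<comment> \<open>Dividing by \<open>h\<close> only multiplies \<open>p\<close> by the
        monomial \<open>1/h\<close>, so the difference quotient at 0 is again covered by
        \<open>lim\<close>.\<close>
      have "((\<lambda>h. E p h / h) \<longlongrightarrow> 0) (at_right 0)"
      proof (rule Lim_transform_eventually)
        show "((\<lambda>h::real. poly ([:0,1:] * p) (inverse h) * exp (- inverse h)) \<longlongrightarrow> 0) (at_right 0)"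
          by (rule filterlim_compose[OF lim filterlim_inverse_at_top_right])
        show "\<forall>\<^sub>F h in at_right 0. poly ([:0,1:] * p) (inverse h) * exp (- inverse h) = E p h / h"
          by (auto simp: E_def eventually_at_right_less divide_inverse eventually_at_filter intro!: always_eventually)
      qed
      moreover have "((\<lambda>h. E p h / h) \<longlongrightarrow> 0) (at_left 0)"
        by (rule tendsto_eventually) (auto simp: E_def eventually_at_filter)
      ultimately have "((\<lambda>h. E p h / h) \<longlongrightarrow> 0) (at 0)" by (rule filterlim_split_at[rotated])
      then show ?thesis unfolding 3 DERIV_def by (simp add: E_def)
    qed
  qed
  have "C1 k UNIV (E p)" for p
    by (induction k arbitrary: p) (use der in \<open>auto intro!: DERIV_isCont continuous_at_imp_continuous_on\<close>)
  moreover have "E 1 = flat_exp" by (auto simp: E_def flat_exp_def)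
  ultimately show ?thesis by metis
qed

text \<open>The usual quotient \<open>a / (a + b)\<close>, equal to 1 for
  \<open>sq d x \<le> 1\<close> and to 0 for \<open>sq d x \<ge> 2\<close>. The reciprocal is
  written as a power so that its smoothness is an instance of \<open>C1_powr\<close>, and the
  squared norm is used because it is smooth at the origin.\<close>

definition cutoff :: "nat \<Rightarrow> (nat \<Rightarrow> real) \<Rightarrow> real" where
  "cutoff d x = flat_exp (2 - sq d x) * (flat_exp (2 - sq d x) + flat_exp (sq d x - 1)) powr (-1)"

lemma flat_exp_pos: "x > 0 \<Longrightarrow> flat_exp x > 0" and flat_exp_nonneg: "flat_exp x \<ge> 0" and flat_exp_zero: "x \<le> 0 \<Longrightarrow> flat_exp x = 0"
  by (auto simp: flat_exp_def)

lemma cutoff_range: "0 \<le> cutoff d x" "cutoff d x \<le> 1"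
  using flat_exp_nonneg[of "2 - sq d x"] flat_exp_nonneg[of "sq d x - 1"]
  by (auto simp: cutoff_def powr_minus_divide divide_le_eq_1 split: if_splits)

lemma cutoff_1: "sq d x \<le> 1 \<Longrightarrow> cutoff d x = 1"
  using flat_exp_pos[of "2 - sq d x"] flat_exp_zero[of "sq d x - 1"] by (simp add: cutoff_def powr_minus_divide)

lemma cutoff_0: "sq d x \<ge> 2 \<Longrightarrow> cutoff d x = 0"
  by (simp add: cutoff_def flat_exp_zero)

lemma Ck_cutoff: "Ck True d k (cutoff d)"
proof (rule Ck_compact_support)
  have 1: "Ck False d k (\<lambda>x. flat_exp (2 - sq d x))"
    using Ck_compose[OF Ck_add[OF Ck_const[of _ _ _ 2] Ck_mult[OF Ck_const[of _ _ _ "-1"] Ck_sq]] C1_flat_exp, where T=UNIV] by simp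
  have 2: "Ck False d k (\<lambda>x. flat_exp (sq d x - 1))"
    using Ck_compose[OF Ck_add[OF Ck_const[of _ _ _ "-1"] Ck_sq] C1_flat_exp, where T=UNIV] by simp
  have "flat_exp (2 - sq d x) + flat_exp (sq d x - 1) > 0" for x
    using flat_exp_nonneg[of "2 - sq d x"] flat_exp_nonneg[of "sq d x - 1"] flat_exp_pos[of "2 - sq d x"] flat_exp_pos[of "sq d x - 1"]
    by (cases "sq d x < 2") auto
  then have "(\<lambda>x. flat_exp (2 - sq d x) + flat_exp (sq d x - 1)) ` Rd d \<subseteq> {0<..}" by auto
  from Ck_compose[OF Ck_add[OF 1 2] C1_powr[of k 1 "-1"] this]
  have "Ck False d k (\<lambda>x. (flat_exp (2 - sq d x) + flat_exp (sq d x - 1)) powr (-1))" by simp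
  from Ck_mult[OF 1 this] show "Ck False d k (cutoff d)" by (simp add: cutoff_def[abs_def])
  show "cutoff d x = 0" if "sq d x > 2" for x using cutoff_0 that by simp
qed

section \<open>Differentiation under the integral and Gaussian integration by parts\<close>

text \<open>The mean value bound turns the domination of \<open>F'\<close> into a domination of the
  difference quotients that is uniform in the step; dominated convergence along sequences does the
  rest.\<close>

lemma has_real_derivative_integral:
  fixes F F' :: "real \<Rightarrow> 'a \<Rightarrow> real"
  assumes t0: "a < t0" "t0 < b"
    and int: "\<And>t. a < t \<Longrightarrow> t < b \<Longrightarrow> integrable M (F t)"
    and der: "\<And>t x. a < t \<Longrightarrow> t < b \<Longrightarrow> x \<in> space M \<Longrightarrow> ((\<lambda>t. F t x) has_real_derivative F' t x) (at t)"
    and bound: "\<And>t x. a < t \<Longrightarrow> t < b \<Longrightarrow> x \<in> space M \<Longrightarrow> \<bar>F' t x\<bar> \<le> w x"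
    and w: "integrable M w"
  shows "((\<lambda>t. \<integral>x. F t x \<partial>M) has_real_derivative (\<integral>x. F' t0 x \<partial>M)) (at t0)"
  unfolding has_field_derivative_iff tendsto_at_iff_sequentially
proof (intro allI impI)
  fix X :: "nat \<Rightarrow> real" assume X: "\<forall>i. X i \<in> UNIV - {t0}" "X \<longlonglongrightarrow> t0"
  have "eventually (\<lambda>n. X n \<in> {a<..<b}) sequentially"
    using X(2) t0 by (intro topological_tendstoD) auto
  then obtain N where N: "\<And>n. n \<ge> N \<Longrightarrow> X n \<in> {a<..<b}" by (auto simp: eventually_sequentially)
  define Y where "Y n = X (n + N)" for n
  have Y: "Y n \<in> {a<..<b}" "Y n \<noteq> t0" for n using N X(1) by (auto simp: Y_def)
  have Yl: "Y \<longlonglongrightarrow> t0" unfolding Y_def using X(2) by (rule LIMSEQ_ignore_initial_segment)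
  have lip: "\<bar>F y x - F t0 x\<bar> \<le> w x * \<bar>y - t0\<bar>" if "y \<in> {a<..<b}" "x \<in> space M" for x y
    using field_differentiable_bound[of "{a<..<b}" "\<lambda>t. F t x" "\<lambda>t. F' t x" "w x" y t0] that t0 der bound
    by (auto intro: has_field_derivative_at_within)
  have lim: "(\<lambda>n. (F (Y n) x - F t0 x) / (Y n - t0)) \<longlonglongrightarrow> F' t0 x" if "x \<in> space M" for x
    using der[OF t0 that] Yl Y unfolding has_field_derivative_iff tendsto_at_iff_sequentially comp_def by auto
  have meas: "(\<lambda>x. (F (Y n) x - F t0 x) / (Y n - t0)) \<in> borel_measurable M" for n
    using int[of "Y n"] int[OF t0] Y[of n] by (intro borel_measurable_divide borel_measurable_diff) auto
  have "(\<lambda>n. \<integral>x. (F (Y n) x - F t0 x) / (Y n - t0) \<partial>M) \<longlonglongrightarrow> (\<integral>x. F' t0 x \<partial>M)"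
  proof (rule integral_dominated_convergence[where w=w])
    show "F' t0 \<in> borel_measurable M" by (rule borel_measurable_LIMSEQ_real[OF lim meas])
    show "AE x in M. norm ((F (Y n) x - F t0 x) / (Y n - t0)) \<le> w x" for n
      using lip[OF Y(1)] Y(2)[of n] by (intro AE_I2) (simp add: divide_le_eq)
  qed (use meas lim w in auto)
  moreover have "(\<integral>x. (F (Y n) x - F t0 x) / (Y n - t0) \<partial>M) = ((\<integral>x. F (Y n) x \<partial>M) - (\<integral>x. F t0 x \<partial>M)) / (Y n - t0)" for n
    using int[of "Y n"] int[OF t0] Y[of n] by simp
  ultimately have "(\<lambda>n. ((\<integral>x. F (Y n) x \<partial>M) - (\<integral>x. F t0 x \<partial>M)) / (Y n - t0)) \<longlonglongrightarrow> (\<integral>x. F' t0 x \<partial>M)" by (simp only:)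
  then show "((\<lambda>y. ((\<integral>x. F y x \<partial>M) - (\<integral>x. F t0 x \<partial>M)) / (y - t0)) \<circ> X) \<longlonglongrightarrow> (\<integral>x. F' t0 x \<partial>M)"
    unfolding Y_def comp_def by (rule LIMSEQ_offset)
qed

section \<open>Chain rule along curves\<close>

lemma tendsto_fun_iff:
  fixes f :: "'a \<Rightarrow> 'i \<Rightarrow> 'b::topological_space"
  shows "(f \<longlongrightarrow> l) F \<longleftrightarrow> (\<forall>i. ((\<lambda>x. f x i) \<longlongrightarrow> l i) F)"
  using limitin_componentwise[of "\<lambda>_. euclidean" UNIV f l F]
  by (simp add: euclidean_product_topology)

text \<open>Only partial derivatives are at hand, so the point is moved from \<open>c t0\<close> to
  \<open>c t\<close> one coordinate at a time: in \<open>m n t\<close> the first \<open>n\<close>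
  coordinates have moved. Each single move is handled by the mean value theorem, and continuity of
  \<open>D\<close> removes the intermediate point \<open>\<xi>\<close> in the limit.\<close>

lemma chain_rule_Rd:
  assumes der: "\<And>i x. i < d \<Longrightarrow> x \<in> Rd d \<Longrightarrow> ((\<lambda>t. g (x(i := t))) has_real_derivative D i x) (at (x i))"
    and cont: "\<And>i. i < d \<Longrightarrow> continuous_on (Rd d) (D i)"
    and c: "\<And>t. c t \<in> Rd d"
    and c': "\<And>i. i < d \<Longrightarrow> ((\<lambda>t. c t i) has_real_derivative c' i) (at t0)"
  shows "((\<lambda>t. g (c t)) has_real_derivative (\<Sum>i<d. D i (c t0) * c' i)) (at t0)"
proof -
  define m where "m n t = (\<lambda>j. if j < n then c t j else c t0 j)" for n t
  have m_Rd: "m n t \<in> Rd d" if "n \<le> d" for n t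
    using c[of t] c[of t0] that by (auto simp: m_def Rd_def PiE_def extensional_def)
  have *: "((\<lambda>t. g (m n t)) has_real_derivative (\<Sum>i<n. D i (c t0) * c' i)) (at t0)" if "n \<le> d" for n
    using that
  proof (induction n)
    case 0 then show ?case by (simp add: m_def)
  next
    case (Suc n)
    have n: "n < d" using Suc by simp
    have mS: "m (Suc n) t = (m n t)(n := c t n)" "m n t = (m n t)(n := c t0 n)" for t
      by (auto simp: m_def less_Suc_eq)
    have "\<exists>\<xi>. \<bar>\<xi> - c t0 n\<bar> \<le> \<bar>c t n - c t0 n\<bar> \<and>
       g (m (Suc n) t) - g (m n t) = D n ((m n t)(n := \<xi>)) * (c t n - c t0 n)" for t
    proof -
      define h where "h s = g ((m n t)(n := s))" for s
      have h: "(h has_real_derivative D n ((m n t)(n := s))) (at s)" for s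
        using der[OF n Rd_update[OF m_Rd n], of n t s] Suc.prems by (simp add: h_def[abs_def])
      have "g (m (Suc n) t) - g (m n t) = h (c t n) - h (c t0 n)"
        using mS[of t] unfolding h_def by simp
      moreover have "\<exists>\<xi>. \<bar>\<xi> - c t0 n\<bar> \<le> \<bar>c t n - c t0 n\<bar> \<and> h (c t n) - h (c t0 n) = D n ((m n t)(n := \<xi>)) * (c t n - c t0 n)"
      proof (cases "c t n" "c t0 n" rule: linorder_cases)
        case less
        from MVT2[OF less h] obtain z where "c t n < z" "z < c t0 n" "h (c t0 n) - h (c t n) = (c t0 n - c t n) * D n ((m n t)(n := z))" by blast
        then show ?thesis by (intro exI[of _ z]) (auto simp: algebra_simps)
      next
        case greater
        from MVT2[OF greater h] obtain z where "c t0 n < z" "z < c t n" "h (c t n) - h (c t0 n) = (c t n - c t0 n) * D n ((m n t)(n := z))" by blast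
        then show ?thesis by (intro exI[of _ z]) (auto simp: algebra_simps)
      qed auto
      ultimately show ?thesis by metis
    qed
    then obtain \<xi> where \<xi>: "\<And>t. \<bar>\<xi> t - c t0 n\<bar> \<le> \<bar>c t n - c t0 n\<bar>"
       "\<And>t. g (m (Suc n) t) - g (m n t) = D n ((m n t)(n := \<xi> t)) * (c t n - c t0 n)" by metis
    have cl: "((\<lambda>t. c t i) \<longlongrightarrow> c t0 i) (at t0)" for i
    proof (cases "i < d")
      case True
      then show ?thesis using DERIV_isCont[OF c'[OF True]] by (simp add: isCont_def)
    next
      case False
      then have eq: "(\<lambda>t. c t i) = (\<lambda>_. c t0 i)"
        using c by (auto simp: Rd_def PiE_def extensional_def)
      show ?thesis unfolding eq by (rule tendsto_const)
    qed
    have \<xi>l: "(\<xi> \<longlongrightarrow> c t0 n) (at t0)"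
    proof -
      have "((\<lambda>t. \<xi> t - c t0 n) \<longlongrightarrow> 0) (at t0)"
      proof (rule Lim_null_comparison)
        show "\<forall>\<^sub>F t in at t0. norm (\<xi> t - c t0 n) \<le> \<bar>c t n - c t0 n\<bar>" using \<xi>(1) by simp
        show "((\<lambda>t. \<bar>c t n - c t0 n\<bar>) \<longlongrightarrow> 0) (at t0)"
          using tendsto_rabs[OF tendsto_diff[OF cl[of n] tendsto_const[of "c t0 n"]]] by simp
      qed
      then show ?thesis by (simp add: LIM_zero_iff)
    qed
    have "((\<lambda>t. (m n t)(n := \<xi> t)) \<longlongrightarrow> c t0) (at t0)"
      unfolding tendsto_fun_iff
    proof
      fix i show "((\<lambda>t. ((m n t)(n := \<xi> t)) i) \<longlongrightarrow> c t0 i) (at t0)"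
        by (cases "i = n"; cases "i < n") (use cl \<xi>l in \<open>auto simp: m_def\<close>)
    qed
    then have "((\<lambda>t. D n ((m n t)(n := \<xi> t))) \<longlongrightarrow> D n (c t0)) (at t0)"
      by (rule continuous_on_tendsto_compose[OF cont[OF n] _ c])
        (use Rd_update[OF m_Rd n] Suc.prems in \<open>auto intro!: always_eventually\<close>)
    moreover have "((\<lambda>t. (c t n - c t0 n) / (t - t0)) \<longlongrightarrow> c' n) (at t0)"
      using c'[OF n] unfolding has_field_derivative_iff .
    ultimately have "((\<lambda>t. D n ((m n t)(n := \<xi> t)) * ((c t n - c t0 n) / (t - t0))) \<longlongrightarrow> D n (c t0) * c' n) (at t0)"
      by (rule tendsto_mult)
    moreover have "g (m (Suc n) t0) - g (m n t0) = 0" by (simp add: \<xi>(2))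
    ultimately have "((\<lambda>t. g (m (Suc n) t) - g (m n t)) has_real_derivative D n (c t0) * c' n) (at t0)"
      unfolding has_field_derivative_iff by (simp add: \<xi>(2))
    from DERIV_add[OF this Suc.IH] Suc.prems show ?case by (simp add: add.commute)
  qed
  have "m d t = c t" for t
    using c[of t] c[of t0] by (auto simp: m_def Rd_def PiE_def extensional_def)
  then show ?thesis using *[of d] by simp
qed

section \<open>The Gaussian measure as a product of one-dimensional ones\<close>

definition gauss1 :: "real measure" where "gauss1 = density lborel std_normal_density"

lemma sets_gauss1[measurable_cong]: "sets gauss1 = sets borel" by (simp add: gauss1_def)

lemma prob_space_gauss1: "prob_space gauss1"
  unfolding gauss1_def by (rule prob_space_normal_density) simp

interpretation gauss1: prob_space gauss1 by (rule prob_space_gauss1)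
interpretation gauss1_prod: product_sigma_finite "\<lambda>_::nat. gauss1" 
  by (rule product_sigma_finite.intro) (rule gauss1.sigma_finite_measure_axioms)

text \<open>The normalising constant and the exponential both factor over the coordinates. From here
  on, Gaussian integrals are reduced to one variable by Fubini.\<close>

lemma std_gaussian_eq: "std_gaussian d = Pi\<^sub>M {..<d} (\<lambda>_. gauss1)"
proof (rule gauss1_prod.PiM_eqI)
  show "sets (std_gaussian d) = sets (Pi\<^sub>M {..<d} (\<lambda>_. gauss1))"
    by (simp add: std_gaussian_def gauss1_def cong: sets_PiM_cong)
  fix A :: "nat \<Rightarrow> real set" assume "\<And>i. i \<in> {..<d} \<Longrightarrow> A i \<in> sets gauss1"
  then have A: "\<And>i. i < d \<Longrightarrow> A i \<in> sets borel" by (simp add: sets_gauss1)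
  interpret lb: product_sigma_finite "\<lambda>_::nat. lborel::real measure" by standard
  have dens: "ennreal ((2 * pi) powr (- real d / 2) * exp (- (L2_set x {..<d})\<^sup>2 / 2)) = (\<Prod>i<d. ennreal (std_normal_density (x i)))" for x
  proof -
    have "(\<Prod>i<d. std_normal_density (x i)) = (1 / sqrt (2*pi)) ^ d * exp (\<Sum>i<d. - (x i)\<^sup>2 / 2)"
      unfolding std_normal_density_def prod.distrib by (simp add: exp_sum)
    also have "(\<Sum>i<d. - (x i)\<^sup>2 / 2) = - (L2_set x {..<d})\<^sup>2 / 2"
      by (simp add: L2_set_def sum_nonneg sum_divide_distrib[symmetric] sum_negf)
    also have "(1 / sqrt (2*pi)) ^ d = (2 * pi) powr (- real d / 2)"
    proof -
      have "(2 * pi) powr (- real d / 2) = ((2*pi) powr (-1/2)) powr d"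
        by (simp add: powr_powr)
      also have "\<dots> = ((2*pi) powr (-1/2)) ^ d" by (simp add: powr_realpow)
      also have "(2*pi) powr (-1/2) = 1 / sqrt (2*pi)"
        using powr_minus_divide[of "2*pi" "1/2"] by (simp add: powr_half_sqrt)
      finally show ?thesis by simp
    qed
    finally show ?thesis by (simp add: prod_ennreal)
  qed
  have "emeasure (std_gaussian d) (Pi\<^sub>E {..<d} A) =
    (\<integral>\<^sup>+x. (\<Prod>i<d. ennreal (std_normal_density (x i))) * indicator (Pi\<^sub>E {..<d} A) x \<partial>Pi\<^sub>M {..<d} (\<lambda>_. lborel))"
    unfolding std_gaussian_def dens
    by (rule emeasure_density) (use A in \<open>auto intro!: sets_PiM_I_finite\<close>)
  also have "\<dots> = (\<integral>\<^sup>+x. (\<Prod>i<d. ennreal (std_normal_density (x i)) * indicator (A i) (x i)) \<partial>Pi\<^sub>M {..<d} (\<lambda>_. lborel))"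
  proof (rule nn_integral_cong)
    fix x assume "x \<in> space (Pi\<^sub>M {..<d} (\<lambda>_. lborel :: real measure))"
    then have "indicator (Pi\<^sub>E {..<d} A) x = (\<Prod>i<d. indicator (A i) (x i) :: ennreal)"
      by (auto simp: space_PiM indicator_def PiE_iff Pi_iff split: if_splits)
    then show "(\<Prod>i<d. ennreal (std_normal_density (x i))) * indicator (Pi\<^sub>E {..<d} A) x = (\<Prod>i<d. ennreal (std_normal_density (x i)) * indicator (A i) (x i))"
      by (simp add: prod.distrib)
  qed
  also have "\<dots> = (\<Prod>i<d. \<integral>\<^sup>+x. ennreal (std_normal_density x) * indicator (A i) x \<partial>lborel)"
    by (rule lb.product_nn_integral_prod) (use A in auto)
  also have "\<dots> = (\<Prod>i\<in>{..<d}. emeasure gauss1 (A i))"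
    using A by (intro prod.cong refl) (auto simp: gauss1_def emeasure_density)
  finally show "emeasure (std_gaussian d) (Pi\<^sub>E {..<d} A) = (\<Prod>i\<in>{..<d}. emeasure gauss1 (A i))" .
qed simp

lemma prob_space_std_gaussian: "prob_space (std_gaussian d)"
  unfolding std_gaussian_eq by (rule prob_space_PiM) (rule prob_space_gauss1)

lemma sets_std_gaussian[measurable_cong]: "sets (std_gaussian d) = sets (Pi\<^sub>M {..<d} (\<lambda>_. borel))"
  by (simp add: std_gaussian_def cong: sets_PiM_cong)

lemma space_std_gaussian: "space (std_gaussian d) = Rd d"
  by (simp add: std_gaussian_def space_PiM Rd_def)

text \<open>The link between the topology of \<open>nat \<Rightarrow> real\<close>, which decides
  continuity, and the product sigma-algebra over \<open>{..<d}\<close>: coordinates from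
  \<open>d\<close> on are constant on the space and hence measurable.\<close>

lemma measurable_embed_Rd: "(\<lambda>x. x) \<in> measurable (Pi\<^sub>M {..<d} (\<lambda>_. borel)) (borel :: (nat \<Rightarrow> real) measure)"
proof -
  have "(\<lambda>x i. x i) \<in> measurable (Pi\<^sub>M {..<d} (\<lambda>_. borel)) (Pi\<^sub>M UNIV (\<lambda>_. borel) :: (nat \<Rightarrow> real) measure)"
  proof (rule measurable_PiM_single')
    fix i :: nat
    show "(\<lambda>x. x i) \<in> borel_measurable (Pi\<^sub>M {..<d} (\<lambda>_. borel :: real measure))"
    proof (cases "i < d")
      case False
      have "(\<lambda>x. undefined) \<in> borel_measurable (Pi\<^sub>M {..<d} (\<lambda>_. borel :: real measure))" by simp
      then show ?thesis
        by (rule measurable_cong[THEN iffD1, rotated]) (use False in \<open>auto simp: space_PiM PiE_def extensional_def\<close>)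
    qed simp
  qed auto
  then show ?thesis by (simp add: measurable_def sets_PiM_equal_borel space_PiM)
qed

lemma borel_measurable_continuous_on_Rd:
  fixes \<phi> :: "(nat \<Rightarrow> real) \<Rightarrow> real"
  assumes "continuous_on (Rd d) \<phi>"
  shows "\<phi> \<in> borel_measurable (Pi\<^sub>M {..<d} (\<lambda>_. borel))"
proof -
  have "\<phi> \<in> borel_measurable (restrict_space borel (Rd d))"
    by (rule borel_measurable_continuous_on_restrict[OF assms])
  moreover have "(\<lambda>x. x) \<in> measurable (Pi\<^sub>M {..<d} (\<lambda>_. borel)) (restrict_space borel (Rd d))"
    by (rule measurable_restrict_space2[OF _ measurable_embed_Rd]) (simp add: space_PiM Rd_def)
  ultimately show ?thesis by (rule measurable_compose[rotated])
qed

lemma gauss1_integral: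
  assumes [measurable]: "f \<in> borel_measurable borel"
  shows "(\<integral>x. f x \<partial>gauss1) = (\<integral>x. std_normal_density x * f x \<partial>lborel)"
    "integrable gauss1 f \<longleftrightarrow> integrable lborel (\<lambda>x. std_normal_density x * f x)"
  unfolding gauss1_def by (simp_all add: integral_density integrable_density)

lemma integrable_gauss1_id: "integrable gauss1 (\<lambda>x. x)"
  using integrable_std_normal_moment[of 1] by (simp add: gauss1_integral)

lemma gauss1_exp_moment:
  "integrable gauss1 (\<lambda>x. exp (a * x))" "(\<integral>x. exp (a * x) \<partial>gauss1) = exp (a\<^sup>2 / 2)"
proof -
  have *: "std_normal_density x * exp (a * x) = exp (a\<^sup>2 / 2) * normal_density a 1 x" for x
    by (simp add: normal_density_def exp_add[symmetric] power2_eq_square field_simps)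
  show "integrable gauss1 (\<lambda>x. exp (a * x))" "(\<integral>x. exp (a * x) \<partial>gauss1) = exp (a\<^sup>2 / 2)"
    by (simp_all add: gauss1_integral *)
qed

text \<open>The fundamental theorem of calculus for \<open>p F\<close>, where the Gaussian density
  satisfies \<open>p' = - x p\<close>; since \<open>F\<close> is bounded, \<open>p F\<close>
  vanishes at both infinities.\<close>

lemma gauss1_ibp:
  fixes F F' :: "real \<Rightarrow> real"
  assumes der: "\<And>x. (F has_real_derivative F' x) (at x)" and cont: "continuous_on UNIV F'"
    and bF: "\<And>x. \<bar>F x\<bar> \<le> A" and bF': "\<And>x. \<bar>F' x\<bar> \<le> B"
  shows "(\<integral>x. x * F x \<partial>gauss1) = (\<integral>x. F' x \<partial>gauss1)"
proof -
  let ?p = std_normal_density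
  have [measurable]: "F' \<in> borel_measurable borel" using cont by (rule borel_measurable_continuous_onI)
  have contF: "continuous_on UNIV F" by (meson DERIV_isCont continuous_at_imp_continuous_on der)
  then have [measurable]: "F \<in> borel_measurable borel" by (rule borel_measurable_continuous_onI)
  have i1: "integrable gauss1 F'" by (rule gauss1.integrable_const_bound[of _ B]) (use bF' in auto)
  have i2: "integrable gauss1 (\<lambda>x. x * F x)"
  proof (rule Bochner_Integration.integrable_bound[OF integrable_mult_right[OF integrable_gauss1_id, of A]])
    have "\<bar>x\<bar> * \<bar>F x\<bar> \<le> \<bar>x\<bar> * \<bar>A\<bar>" for x
      using bF[of x] by (intro mult_left_mono) linarith+
    then show "AE x in gauss1. norm (x * F x) \<le> norm (A * x)" by (simp add: abs_mult mult.commute)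
  qed measurable
  have "((\<lambda>x. c * exp (- x\<^sup>2 / 2)) has_real_derivative - x * (c * exp (- x\<^sup>2 / 2))) (at x)" for c x :: real
    by (auto intro!: derivative_eq_intros)
  then have dp: "(?p has_real_derivative - x * ?p x) (at x)" for x
    unfolding std_normal_density_def[abs_def] .
  have "(LBINT x=-\<infinity>..\<infinity>. ?p x * (F' x - x * F x)) = 0 - 0"
  proof (rule interval_integral_FTC_integrable)
    fix x
    show "((\<lambda>x. ?p x * F x) has_vector_derivative ?p x * (F' x - x * F x)) (at x)"
      unfolding has_real_derivative_iff_has_vector_derivative[symmetric]
      using DERIV_mult[OF dp der, of x] by (simp add: algebra_simps)
    show "isCont (\<lambda>x. ?p x * (F' x - x * F x)) x"
      using cont contF by (intro continuous_intros DERIV_isCont[OF dp]) (auto simp: continuous_on_eq_continuous_at)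
  next
    show "set_integrable lborel (einterval (-\<infinity>) \<infinity>) (\<lambda>x. ?p x * (F' x - x * F x))"
      using Bochner_Integration.integrable_diff[OF i1 i2] by (simp add: set_integrable_def gauss1_integral)
  next
    have b: "norm (?p x * F x) \<le> A * ?p x" for x
      using bF[of x] by (auto simp: abs_mult mult.commute intro!: mult_right_mono)
    have nt: "((\<lambda>x. ?p x * F x) \<longlongrightarrow> 0) G" if "((\<lambda>x. A * ?p x) \<longlongrightarrow> 0) G" for G
      by (rule Lim_null_comparison[OF _ that]) (intro always_eventually allI b)
    have "(?p \<longlongrightarrow> 0) at_top" "(?p \<longlongrightarrow> 0) at_bot"
      unfolding std_normal_density_def[abs_def] by real_asymp+
    then have "((\<lambda>x. A * ?p x) \<longlongrightarrow> 0) at_top" "((\<lambda>x. A * ?p x) \<longlongrightarrow> 0) at_bot"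
      by (auto intro: tendsto_mult_right_zero)
    then have "((\<lambda>x. ?p x * F x) \<longlongrightarrow> 0) at_top" "((\<lambda>x. ?p x * F x) \<longlongrightarrow> 0) at_bot"
      by (auto intro: nt)
    then show "(((\<lambda>x. ?p x * F x) \<circ> real_of_ereal) \<longlongrightarrow> 0) (at_right (-\<infinity>))"
      "(((\<lambda>x. ?p x * F x) \<circ> real_of_ereal) \<longlongrightarrow> 0) (at_left \<infinity>)"
      by (simp_all only: ereal_tendsto_simps)
  qed simp
  then have "(\<integral>x. ?p x * (F' x - x * F x) \<partial>lborel) = 0"
    by (simp add: interval_lebesgue_integral_def set_lebesgue_integral_def)
  then have "(\<integral>x. F' x - x * F x \<partial>gauss1) = 0" by (simp add: gauss1_integral)
  then show ?thesis using i1 i2 by simp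
qed

section \<open>The Mehler semigroup\<close>

lemma integrable_std_gaussian_coord:
  assumes "i < d"
  shows "integrable (std_gaussian d) (\<lambda>z. z i)"
proof -
  have "integrable gauss1 (\<lambda>y. if j = i then y else 1)" for j
    by (cases "j = i") (simp_all add: integrable_gauss1_id)
  then have "integrable (Pi\<^sub>M {..<d} (\<lambda>_. gauss1)) (\<lambda>z. \<Prod>j<d. (if j = i then z j else 1))"
    by (intro gauss1_prod.product_integrable_prod[where f="\<lambda>j y. if j = i then y else 1"]) simp_all
  then show ?thesis using assms by (simp add: std_gaussian_eq prod.If_cases)
qed

lemma std_gaussian_exp_moment:
  "integrable (std_gaussian d) (\<lambda>z. exp (\<Sum>i<d. w i * z i))"
  "(\<integral>z. exp (\<Sum>i<d. w i * z i) \<partial>std_gaussian d) = exp ((\<Sum>i<d. (w i)\<^sup>2) / 2)"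
  using gauss1_prod.product_integrable_prod[of "{..<d}" "\<lambda>i y. exp (w i * y)"]
    gauss1_prod.product_integral_prod[of "{..<d}" "\<lambda>i y. exp (w i * y)"]
  by (simp_all add: std_gaussian_eq exp_sum gauss1_exp_moment sum_divide_distrib)

lemma std_gaussian_ibp:
  fixes F D :: "(nat \<Rightarrow> real) \<Rightarrow> real"
  assumes i: "i < d"
    and der: "\<And>z. z \<in> Rd d \<Longrightarrow> ((\<lambda>t. F (z(i := t))) has_real_derivative D z) (at (z i))"
    and cF: "continuous_on (Rd d) F" and cD: "continuous_on (Rd d) D"
    and bF: "\<And>z. z \<in> Rd d \<Longrightarrow> \<bar>F z\<bar> \<le> A" and bD: "\<And>z. z \<in> Rd d \<Longrightarrow> \<bar>D z\<bar> \<le> B"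
  shows "integrable (std_gaussian d) (\<lambda>z. z i * F z)"
    "(\<integral>z. z i * F z \<partial>std_gaussian d) = (\<integral>z. D z \<partial>std_gaussian d)"
proof -
  interpret G: prob_space "std_gaussian d" by (rule prob_space_std_gaussian)
  let ?I = "{..<d} - {i}"
  have ins: "{..<d} = insert i ?I" using i by auto
  have [measurable]: "F \<in> borel_measurable (std_gaussian d)" "D \<in> borel_measurable (std_gaussian d)"
    using borel_measurable_continuous_on_Rd[OF cF] borel_measurable_continuous_on_Rd[OF cD] by measurable
  have [measurable]: "(\<lambda>z. z i) \<in> borel_measurable (std_gaussian d)"
    using integrable_std_gaussian_coord[OF i] by (rule borel_measurable_integrable)
  show iF: "integrable (std_gaussian d) (\<lambda>z. z i * F z)"
  proof (rule Bochner_Integration.integrable_bound[OF integrable_mult_right[OF integrable_std_gaussian_coord[OF i], of A]])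
    have "\<bar>z i\<bar> * \<bar>F z\<bar> \<le> \<bar>z i\<bar> * \<bar>A\<bar>" if "z \<in> Rd d" for z
      using bF[OF that] by (intro mult_left_mono) linarith+
    then show "AE z in std_gaussian d. norm (z i * F z) \<le> norm (A * z i)"
      by (intro AE_I2) (auto simp: abs_mult mult.commute space_std_gaussian)
  qed measurable
  have iD: "integrable (std_gaussian d) D"
    by (rule G.integrable_const_bound[of _ B]) (use bD in \<open>auto simp: space_std_gaussian\<close>)
  have "(\<integral>z. z i * F z \<partial>std_gaussian d) = (\<integral>z. z i * F z \<partial>Pi\<^sub>M (insert i ?I) (\<lambda>_. gauss1))"
    by (simp only: std_gaussian_eq ins[symmetric])
  also have "\<dots> = (\<integral>x. (\<integral>y. (x(i := y)) i * F (x(i := y)) \<partial>gauss1) \<partial>Pi\<^sub>M ?I (\<lambda>_. gauss1))"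
    by (rule gauss1_prod.product_integral_insert) (use iF ins in \<open>auto simp: std_gaussian_eq\<close>)
  also have "\<dots> = (\<integral>x. (\<integral>y. D (x(i := y)) \<partial>gauss1) \<partial>Pi\<^sub>M ?I (\<lambda>_. gauss1))"
  proof (rule Bochner_Integration.integral_cong[OF refl])
    fix x assume "x \<in> space (Pi\<^sub>M ?I (\<lambda>_. gauss1))"
    then have x: "x(i := y) \<in> Rd d" for y
      using i by (auto simp: space_PiM Rd_def PiE_def extensional_def)
    have c: "continuous_on UNIV (\<lambda>y. D (x(i := y)))"
      by (rule continuous_on_compose2[OF cD continuous_on_update]) (use x in auto)
    have "(\<integral>y. y * F (x(i := y)) \<partial>gauss1) = (\<integral>y. D (x(i := y)) \<partial>gauss1)"
      by (rule gauss1_ibp[OF _ c]) (use der[OF x] bF[OF x] bD[OF x] in auto)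
    then show "(\<integral>y. (x(i := y)) i * F (x(i := y)) \<partial>gauss1) = (\<integral>y. D (x(i := y)) \<partial>gauss1)" by simp
  qed
  also have "\<dots> = (\<integral>z. D z \<partial>Pi\<^sub>M (insert i ?I) (\<lambda>_. gauss1))"
    by (rule gauss1_prod.product_integral_insert[symmetric]) (use iD ins in \<open>auto simp: std_gaussian_eq\<close>)
  finally show "(\<integral>z. z i * F z \<partial>std_gaussian d) = (\<integral>z. D z \<partial>std_gaussian d)"
    by (simp only: std_gaussian_eq ins[symmetric])
qed

text \<open>
  The time \<open>t\<close> of the Ornstein-Uhlenbeck semigroup is written \<open>t = - ln (cos \<theta>)\<close>: then \<open>\<theta>\<close> runs over the
  compact interval from \<open>0\<close> (the identity) to \<open>pi / 2\<close> (the Gaussian mean), and the singular factor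
  \<open>cot \<theta>\<close> of the gradient estimate cancels against \<open>dt = tan \<theta> d\<theta>\<close>.
\<close>

definition mix :: "nat \<Rightarrow> real \<Rightarrow> (nat \<Rightarrow> real) \<Rightarrow> (nat \<Rightarrow> real) \<Rightarrow> nat \<Rightarrow> real" where
  "mix d \<theta> x z = aff d (cos \<theta>) (\<lambda>i. sin \<theta> * z i) x"

definition mehler :: "nat \<Rightarrow> real \<Rightarrow> ((nat \<Rightarrow> real) \<Rightarrow> real) \<Rightarrow> (nat \<Rightarrow> real) \<Rightarrow> real" where
  "mehler d \<theta> g x = (\<integral>z. g (mix d \<theta> x z) \<partial>std_gaussian d)"

lemma mix_in_Rd: "mix d \<theta> x z \<in> Rd d"
  by (simp add: mix_def aff_in_Rd)

lemma mix_apply: "i < d \<Longrightarrow> mix d \<theta> x z i = cos \<theta> * x i + sin \<theta> * z i"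
  by (simp add: mix_def aff_def)

lemma mix_swap: "mix d \<theta> x z = aff d (sin \<theta>) (\<lambda>i. cos \<theta> * x i) z"
  by (auto simp: mix_def aff_def)

lemma mix_0: "x \<in> Rd d \<Longrightarrow> mix d 0 x z = x"
  by (auto simp: mix_def aff_def Rd_def PiE_def extensional_def)

lemma mix_pi_half: "z \<in> Rd d \<Longrightarrow> mix d (pi/2) x z = z"
  by (auto simp: mix_def aff_def Rd_def PiE_def extensional_def)

lemma mehler_0: "x \<in> Rd d \<Longrightarrow> mehler d 0 g x = g x"
  using prob_space.prob_space[OF prob_space_std_gaussian] by (simp add: mehler_def mix_0)

lemma mehler_pi_half: "mehler d (pi/2) g x = (\<integral>z. g z \<partial>std_gaussian d)"
  unfolding mehler_def by (intro Bochner_Integration.integral_cong refl) (auto simp: mix_pi_half space_std_gaussian)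

lemma measurable_mix:
  fixes g :: "(nat \<Rightarrow> real) \<Rightarrow> real"
  assumes "continuous_on (Rd d) g"
  shows "(\<lambda>z. g (mix d \<theta> x z)) \<in> borel_measurable (std_gaussian d)"
proof -
  have "continuous_on (Rd d) (\<lambda>z. g (mix d \<theta> x z))"
    unfolding mix_swap by (rule continuous_on_compose2[OF assms continuous_on_aff]) (auto simp: aff_in_Rd)
  from borel_measurable_continuous_on_Rd[OF this] show ?thesis by measurable
qed

lemma bounded_RdE:
  fixes g :: "(nat \<Rightarrow> real) \<Rightarrow> real"
  assumes "bounded (g ` Rd d)"
  obtains B where "\<And>x. x \<in> Rd d \<Longrightarrow> \<bar>g x\<bar> \<le> B"
  using assms unfolding bounded_iff by auto

lemma integrable_mix:
  fixes g :: "(nat \<Rightarrow> real) \<Rightarrow> real"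
  assumes "continuous_on (Rd d) g" "bounded (g ` Rd d)"
  shows "integrable (std_gaussian d) (\<lambda>z. g (mix d \<theta> x z))"
proof -
  interpret G: prob_space "std_gaussian d" by (rule prob_space_std_gaussian)
  from assms(2) obtain B where "\<And>x. x \<in> Rd d \<Longrightarrow> \<bar>g x\<bar> \<le> B" by (rule bounded_RdE) blast
  then show ?thesis
    by (intro G.integrable_const_bound[of _ B] measurable_mix assms) (auto simp: mix_in_Rd)
qed

lemma integrable_mix_coord:
  fixes g :: "(nat \<Rightarrow> real) \<Rightarrow> real"
  assumes g: "continuous_on (Rd d) g" "bounded (g ` Rd d)" and i: "i < d"
  shows "integrable (std_gaussian d) (\<lambda>z. z i * g (mix d \<theta> x z))"
proof -
  from g(2) obtain B where B: "\<And>x. x \<in> Rd d \<Longrightarrow> \<bar>g x\<bar> \<le> B" by (rule bounded_RdE) blast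
  have [measurable]: "(\<lambda>z. z i) \<in> borel_measurable (std_gaussian d)"
    using integrable_std_gaussian_coord[OF i] by (rule borel_measurable_integrable)
  note measurable_mix[OF g(1), measurable]
  show ?thesis
  proof (rule Bochner_Integration.integrable_bound[OF integrable_mult_right[OF integrable_std_gaussian_coord[OF i], of B]])
    have "\<bar>z i\<bar> * \<bar>g (mix d \<theta> x z)\<bar> \<le> \<bar>z i\<bar> * \<bar>B\<bar>" for z
      using B[OF mix_in_Rd, of \<theta> x z] by (intro mult_left_mono) linarith+
    then show "AE z in std_gaussian d. norm (z i * g (mix d \<theta> x z)) \<le> norm (B * z i)"
      by (intro AE_I2) (auto simp: abs_mult mult.commute)
  qed measurable
qed

section \<open>Regularity and derivatives of Mehler averages\<close>

lemma continuous_on_mehler: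
  assumes "continuous_on (Rd d) g" "bounded (g ` Rd d)"
  shows "continuous_on (Rd d) (mehler d \<theta> g)"
proof (rule continuous_on_sequentiallyI)
  fix X a assume *: "\<forall>n. X n \<in> Rd d" "a \<in> Rd d" "X \<longlonglongrightarrow> a"
  interpret G: prob_space "std_gaussian d" by (rule prob_space_std_gaussian)
  from assms(2) obtain B where B: "\<And>x. x \<in> Rd d \<Longrightarrow> \<bar>g x\<bar> \<le> B" by (rule bounded_RdE) blast
  have "(\<lambda>n. g (mix d \<theta> (X n) z)) \<longlonglongrightarrow> g (mix d \<theta> a z)" for z
  proof (rule continuous_on_tendsto_compose[OF assms(1)])
    show "(\<lambda>n. mix d \<theta> (X n) z) \<longlonglongrightarrow> mix d \<theta> a z"
      unfolding mix_def by (rule continuous_on_tendsto_compose[OF continuous_on_aff[of UNIV]]) (use * in auto)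
  qed (auto simp: mix_in_Rd)
  then show "(\<lambda>n. mehler d \<theta> g (X n)) \<longlonglongrightarrow> mehler d \<theta> g a"
    unfolding mehler_def
    by (intro integral_dominated_convergence[where w="\<lambda>_. B"] measurable_mix assms) (auto simp: mix_in_Rd B)
qed

lemma mehler_bound:
  assumes "\<And>x. x \<in> Rd d \<Longrightarrow> l \<le> g x" "\<And>x. x \<in> Rd d \<Longrightarrow> g x \<le> u" "continuous_on (Rd d) g"
  shows "l \<le> mehler d \<theta> g x" "mehler d \<theta> g x \<le> u"
proof -
  interpret G: prob_space "std_gaussian d" by (rule prob_space_std_gaussian)
  have "bounded (g ` Rd d)"
    unfolding bounded_iff using assms(1,2) by (intro exI[of _ "max \<bar>l\<bar> \<bar>u\<bar>"]) (fastforce simp: abs_le_iff)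
  note i = integrable_mix[OF assms(3) this]
  show "l \<le> mehler d \<theta> g x" unfolding mehler_def by (intro G.integral_ge_const i AE_I2 assms mix_in_Rd)
  show "mehler d \<theta> g x \<le> u" unfolding mehler_def by (intro G.integral_le_const i AE_I2 assms mix_in_Rd)
qed

text \<open>The commutation of gradient and semigroup; \<open>cos \<theta>\<close> is the
  contraction factor \<open>exp (- t)\<close>.\<close>

lemma mehler_partial:
  assumes i: "i < d" "x \<in> Rd d"
    and der: "\<And>x. x \<in> Rd d \<Longrightarrow> ((\<lambda>t. g (x(i := t))) has_real_derivative D x) (at (x i))"
    and g: "continuous_on (Rd d) g" "bounded (g ` Rd d)"
    and D: "bounded (D ` Rd d)"
  shows "((\<lambda>t. mehler d \<theta> g (x(i := t))) has_real_derivative cos \<theta> * mehler d \<theta> D x) (at (x i))"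
proof -
  interpret G: prob_space "std_gaussian d" by (rule prob_space_std_gaussian)
  from D obtain B where B: "\<And>x. x \<in> Rd d \<Longrightarrow> \<bar>D x\<bar> \<le> B" by (rule bounded_RdE) blast
  have "((\<lambda>t. \<integral>z. g (mix d \<theta> (x(i := t)) z) \<partial>std_gaussian d) has_real_derivative
     (\<integral>z. cos \<theta> * D (mix d \<theta> (x(i := x i)) z) \<partial>std_gaussian d)) (at (x i))"
  proof (rule has_real_derivative_integral[where a="x i - 1" and b="x i + 1" and w="\<lambda>_. B"])
    fix t z
    show "((\<lambda>t. g (mix d \<theta> (x(i := t)) z)) has_real_derivative cos \<theta> * D (mix d \<theta> (x(i := t)) z)) (at t)"
      using aff_deriv[where \<phi>=g and x="x(i:=t)", OF i(1) der[OF aff_in_Rd]] unfolding mix_def by simp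
    show "\<bar>cos \<theta> * D (mix d \<theta> (x(i := t)) z)\<bar> \<le> B"
      using B[OF mix_in_Rd] mult_mono[of "\<bar>cos \<theta>\<bar>" 1 "\<bar>D (mix d \<theta> (x(i := t)) z)\<bar>" B] by (simp add: abs_mult)
  qed (auto intro!: integrable_mix g)
  then show ?thesis by (simp add: mehler_def)
qed

lemma Ck_mehler: "Ck True d k g \<Longrightarrow> Ck True d k (mehler d \<theta> g)"
proof (induction k arbitrary: g)
  have bd: "bounded (mehler d \<theta> g ` Rd d)" if "Ck True d k g" for k g
  proof -
    from Ck_bounded[OF that] obtain B where B: "\<And>x. x \<in> Rd d \<Longrightarrow> \<bar>g x\<bar> \<le> B" by (rule bounded_RdE) blast
    then have "- B \<le> g x" "g x \<le> B" if "x \<in> Rd d" for x using that by (force simp: abs_le_iff)+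
    then have "- B \<le> mehler d \<theta> g x" "mehler d \<theta> g x \<le> B" for x
      using mehler_bound Ck_continuous[OF that] by blast+
    then show ?thesis unfolding bounded_iff by (auto simp: abs_le_iff intro!: exI[of _ B]) (metis minus_le_iff)
  qed
  {
    case 0
    then show ?case using bd[OF 0] continuous_on_mehler by simp
  next
    case (Suc k)
    from Ck_Suc_cases[OF Suc.prems] obtain D where
      D: "\<And>i x. i < d \<Longrightarrow> x \<in> Rd d \<Longrightarrow> ((\<lambda>t. g (x(i := t))) has_real_derivative D i x) (at (x i))"
        "\<And>i. i < d \<Longrightarrow> Ck True d k (D i)" by blast
    note g = Ck_continuous[OF Suc.prems] Ck_bounded[OF Suc.prems]
    show ?case
      by (rule Ck_SucI[OF continuous_on_mehler[OF g] bd[OF Suc.prems] mehler_partial[OF _ _ D(1) g Ck_bounded[OF D(2)]]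
            Ck_mult[OF Ck_const Suc.IH[OF D(2)]]])
  }
qed

text \<open>Differentiating \<open>g (mix d \<theta> x z)\<close> in \<open>z i\<close> produces
  \<open>sin \<theta>\<close> where differentiating in \<open>x i\<close> produces
  \<open>cos \<theta>\<close>. The weighted average is therefore \<open>tan \<theta>\<close> times a
  partial derivative of the Mehler average, expressed through values of \<open>g\<close> alone; this
  is the source of gradient bounds that ignore how rough \<open>g\<close> is.\<close>

lemma mehler_ibp:
  assumes i: "i < d"
    and der: "\<And>x. x \<in> Rd d \<Longrightarrow> ((\<lambda>t. g (x(i := t))) has_real_derivative D x) (at (x i))"
    and g: "continuous_on (Rd d) g" "bounded (g ` Rd d)"
    and D: "continuous_on (Rd d) D" "bounded (D ` Rd d)"
  shows "(\<integral>z. z i * g (mix d \<theta> x z) \<partial>std_gaussian d) = sin \<theta> * mehler d \<theta> D x"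
proof -
  from g(2) obtain A where A: "\<And>x. x \<in> Rd d \<Longrightarrow> \<bar>g x\<bar> \<le> A" by (rule bounded_RdE) blast
  from D(2) obtain B where B: "\<And>x. x \<in> Rd d \<Longrightarrow> \<bar>D x\<bar> \<le> B" by (rule bounded_RdE) blast
  have "(\<integral>z. z i * g (mix d \<theta> x z) \<partial>std_gaussian d) = (\<integral>z. sin \<theta> * D (mix d \<theta> x z) \<partial>std_gaussian d)"
  proof (rule std_gaussian_ibp(2)[OF i])
    show "((\<lambda>t. g (mix d \<theta> x (z(i := t)))) has_real_derivative sin \<theta> * D (mix d \<theta> x z)) (at (z i))" for z
      unfolding mix_swap by (rule aff_deriv[OF i der[OF aff_in_Rd]])
    show "continuous_on (Rd d) (\<lambda>z. g (mix d \<theta> x z))" "continuous_on (Rd d) (\<lambda>z. sin \<theta> * D (mix d \<theta> x z))"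
      unfolding mix_swap by (auto intro!: continuous_intros continuous_on_compose2[OF g(1) continuous_on_aff] 
          continuous_on_compose2[OF D(1) continuous_on_aff] simp: aff_in_Rd)
    show "\<bar>g (mix d \<theta> x z)\<bar> \<le> A" for z by (rule A[OF mix_in_Rd])
    show "\<bar>sin \<theta> * D (mix d \<theta> x z)\<bar> \<le> B" for z
      using B[OF mix_in_Rd] mult_mono[of "\<bar>sin \<theta>\<bar>" 1 "\<bar>D (mix d \<theta> x z)\<bar>" B] by (simp add: abs_mult)
  qed
  then show ?thesis by (simp add: mehler_def)
qed

lemma mehler_deriv_angle:
  assumes der: "\<And>i x. i < d \<Longrightarrow> x \<in> Rd d \<Longrightarrow> ((\<lambda>t. g (x(i := t))) has_real_derivative D i x) (at (x i))"
    and g: "continuous_on (Rd d) g" "bounded (g ` Rd d)"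
    and D: "\<And>i. i < d \<Longrightarrow> continuous_on (Rd d) (D i)" "\<And>i. i < d \<Longrightarrow> bounded (D i ` Rd d)"
  shows "((\<lambda>\<theta>. mehler d \<theta> g x) has_real_derivative
     (\<integral>z. (\<Sum>i<d. D i (mix d \<theta> x z) * (cos \<theta> * z i - sin \<theta> * x i)) \<partial>std_gaussian d)) (at \<theta>)"
proof -
  interpret G: prob_space "std_gaussian d" by (rule prob_space_std_gaussian)
  have "\<forall>i. \<exists>B. i < d \<longrightarrow> (\<forall>x\<in>Rd d. \<bar>D i x\<bar> \<le> B)"
    using bounded_RdE[OF D(2)] by metis
  from choice[OF this] obtain B where B: "\<And>i x. i < d \<Longrightarrow> x \<in> Rd d \<Longrightarrow> \<bar>D i x\<bar> \<le> B i" by blast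
  show ?thesis
    unfolding mehler_def
  \<comment> \<open>Sine and cosine are at most 1, so the dominating function is independent of the
    angle, and it is integrable because coordinates have first moments.\<close>
  proof (rule has_real_derivative_integral[where a="\<theta> - 1" and b="\<theta> + 1" and w="\<lambda>z. \<Sum>i<d. B i * (\<bar>z i\<bar> + \<bar>x i\<bar>)"])
    fix t z
    show "((\<lambda>t. g (mix d t x z)) has_real_derivative (\<Sum>i<d. D i (mix d t x z) * (cos t * z i - sin t * x i))) (at t)"
    proof (rule chain_rule_Rd[OF der D(1) mix_in_Rd])
      fix i assume "i < d"
      then show "((\<lambda>t. mix d t x z i) has_real_derivative cos t * z i - sin t * x i) (at t)"
        by (auto simp: mix_apply intro!: derivative_eq_intros)
    qed
    show "\<bar>\<Sum>i<d. D i (mix d t x z) * (cos t * z i - sin t * x i)\<bar> \<le> (\<Sum>i<d. B i * (\<bar>z i\<bar> + \<bar>x i\<bar>))"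
    proof (rule order_trans[OF sum_abs], rule sum_mono)
      fix i assume "i \<in> {..<d}"
      then have b: "\<bar>D i (mix d t x z)\<bar> \<le> B i" by (auto intro: B mix_in_Rd)
      have "\<bar>cos t * z i - sin t * x i\<bar> \<le> \<bar>cos t\<bar> * \<bar>z i\<bar> + \<bar>sin t\<bar> * \<bar>x i\<bar>"
        by (simp add: abs_mult[symmetric])
      also have "\<dots> \<le> 1 * \<bar>z i\<bar> + 1 * \<bar>x i\<bar>" by (intro add_mono mult_right_mono) auto
      finally show "\<bar>D i (mix d t x z) * (cos t * z i - sin t * x i)\<bar> \<le> B i * (\<bar>z i\<bar> + \<bar>x i\<bar>)"
        unfolding abs_mult by (intro mult_mono b) (use b in auto)
    qed
  next
    show "integrable (std_gaussian d) (\<lambda>z. \<Sum>i<d. B i * (\<bar>z i\<bar> + \<bar>x i\<bar>))"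
      by (intro Bochner_Integration.integrable_sum integrable_mult_right Bochner_Integration.integrable_add
          integrable_abs integrable_std_gaussian_coord) auto
  qed (auto intro!: integrable_mix g)
qed

text \<open>The derivatives are parameters so that products, averages and powers come with explicit
  formulas. Of the second derivatives only the pure ones are named, because the generator contains
  no mixed ones.\<close>

locale bounded_smooth =
  fixes d :: nat and g :: "(nat \<Rightarrow> real) \<Rightarrow> real" and D E :: "nat \<Rightarrow> (nat \<Rightarrow> real) \<Rightarrow> real"
  assumes Ck_g: "\<And>k. Ck True d k g"
    and g_deriv: "\<And>i x. i < d \<Longrightarrow> x \<in> Rd d \<Longrightarrow> ((\<lambda>t. g (x(i := t))) has_real_derivative D i x) (at (x i))"
    and D_deriv: "\<And>i x. i < d \<Longrightarrow> x \<in> Rd d \<Longrightarrow> ((\<lambda>t. D i (x(i := t))) has_real_derivative E i x) (at (x i))"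
begin

lemma Ck_D: "i < d \<Longrightarrow> Ck True d k (D i)"
  by (rule Ck_partial[OF Ck_g _ g_deriv])

lemma Ck_E: "i < d \<Longrightarrow> Ck True d k (E i)"
  by (rule Ck_partial[OF Ck_D _ D_deriv])

lemmas g_cb = Ck_continuous[OF Ck_g] Ck_bounded[OF Ck_g]
lemmas D_cb = Ck_continuous[OF Ck_D] Ck_bounded[OF Ck_D]
lemmas E_cb = Ck_continuous[OF Ck_E] Ck_bounded[OF Ck_E]

text \<open>The Ornstein-Uhlenbeck generator applied to \<open>g\<close>: the Laplacian together
  with the part \<open>- x\<close> of the drift.\<close>

definition Lg :: "(nat \<Rightarrow> real) \<Rightarrow> real" where
  "Lg x = (\<Sum>i<d. E i x - x i * D i x)"

lemma integrable_ED_mix: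
  assumes "i < d"
  shows "integrable (std_gaussian d) (\<lambda>z. E i (mix d \<theta> x z))" "integrable (std_gaussian d) (\<lambda>z. D i (mix d \<theta> x z))"
    "integrable (std_gaussian d) (\<lambda>z. z i * D i (mix d \<theta> x z))"
  using assms by (auto intro!: integrable_mix integrable_mix_coord D_cb E_cb)

lemma mehler_ibp_g: "i < d \<Longrightarrow> (\<integral>z. z i * g (mix d \<theta> x z) \<partial>std_gaussian d) = sin \<theta> * mehler d \<theta> (D i) x"
  by (rule mehler_ibp[OF _ g_deriv g_cb D_cb])

lemma mehler_ibp_D: "i < d \<Longrightarrow> (\<integral>z. z i * D i (mix d \<theta> x z) \<partial>std_gaussian d) = sin \<theta> * mehler d \<theta> (E i) x"
  by (rule mehler_ibp[OF _ D_deriv D_cb E_cb])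

text \<open>The right-hand side is the generator applied to \<open>mehler d \<theta> g\<close>, so
  generator and semigroup commute. The drift at the mixed point contributes
  \<open>z i * D i\<close>, which integration by parts turns into
  \<open>(sin \<theta>)\<^sup>2\<close> times a second derivative; subtracting it leaves
  \<open>(cos \<theta>)\<^sup>2\<close>.\<close>

lemma mehler_Lg:
  "mehler d \<theta> Lg x = (\<Sum>i<d. (cos \<theta>)\<^sup>2 * mehler d \<theta> (E i) x - x i * (cos \<theta> * mehler d \<theta> (D i) x))"
proof -
  have "mehler d \<theta> Lg x = (\<integral>z. (\<Sum>i<d. E i (mix d \<theta> x z) - cos \<theta> * x i * D i (mix d \<theta> x z) - sin \<theta> * (z i * D i (mix d \<theta> x z))) \<partial>std_gaussian d)"
    unfolding mehler_def Lg_def by (intro Bochner_Integration.integral_cong sum.cong refl) (auto simp: mix_apply algebra_simps)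
  also have "\<dots> = (\<Sum>i<d. mehler d \<theta> (E i) x - cos \<theta> * x i * mehler d \<theta> (D i) x - sin \<theta> * (sin \<theta> * mehler d \<theta> (E i) x))"
    by (subst Bochner_Integration.integral_sum)
      (auto intro!: sum.cong simp: mehler_def[of d \<theta> "E _"] mehler_def[of d \<theta> "D _"] integrable_ED_mix mehler_ibp_D[unfolded mehler_def])
  also have "\<dots> = (\<Sum>i<d. (cos \<theta>)\<^sup>2 * mehler d \<theta> (E i) x - x i * (cos \<theta> * mehler d \<theta> (D i) x))"
    unfolding cos_squared_eq by (intro sum.cong refl) (simp add: algebra_simps power2_eq_square)
  finally show ?thesis .
qed

text \<open>The evolution equation of the semigroup in the angular parameter:
  \<open>tan \<theta>\<close> is \<open>dt / d\<theta>\<close> for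
  \<open>t = - ln (cos \<theta>)\<close>.\<close>

lemma mehler_angle:
  assumes "cos \<theta> \<noteq> 0"
  shows "((\<lambda>\<theta>. mehler d \<theta> g x) has_real_derivative tan \<theta> * mehler d \<theta> Lg x) (at \<theta>)"
proof -
  have "(\<integral>z. (\<Sum>i<d. D i (mix d \<theta> x z) * (cos \<theta> * z i - sin \<theta> * x i)) \<partial>std_gaussian d) =
    (\<integral>z. (\<Sum>i<d. cos \<theta> * (z i * D i (mix d \<theta> x z)) - sin \<theta> * x i * D i (mix d \<theta> x z)) \<partial>std_gaussian d)"
    by (intro Bochner_Integration.integral_cong sum.cong refl) (auto simp: algebra_simps)
  also have "\<dots> = (\<Sum>i<d. cos \<theta> * (sin \<theta> * mehler d \<theta> (E i) x) - sin \<theta> * x i * mehler d \<theta> (D i) x)"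
    by (subst Bochner_Integration.integral_sum)
      (auto intro!: sum.cong simp: mehler_def[of d \<theta> "E _"] mehler_def[of d \<theta> "D _"] integrable_ED_mix mehler_ibp_D[unfolded mehler_def])
  also have "\<dots> = tan \<theta> * mehler d \<theta> Lg x"
    unfolding mehler_Lg sum_distrib_left
    using assms by (intro sum.cong refl) (simp add: tan_def field_simps power2_eq_square)
  finally show ?thesis
    using mehler_deriv_angle[OF g_deriv g_cb D_cb, of x \<theta>] by simp
qed

end

text \<open>
  The integral of \<open>q (z) \<langle>w, z\<rangle>\<close> is, up to the factor \<open>cot \<theta>\<close>, a directional derivative of a Mehler average \<open>h\<close>,
  so this is the dimension-free gradient estimate. Exponentiating, with \<open>e\<^sup>s \<ge> 1 + s\<close>, gives
  \<open>a / 2 + ln (1 / h) / a\<close> times \<open>h\<close> for every \<open>a > 0\<close>; the choice \<open>a = 1 / sqrt \<kappa>\<close> produces the power of \<open>h\<close>.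
\<close>

lemma gaussian_weighted_linear_bound:
  fixes q :: "(nat \<Rightarrow> real) \<Rightarrow> real"
  assumes q [measurable]: "q \<in> borel_measurable (std_gaussian d)" and q01: "\<And>z. 0 \<le> q z" "\<And>z. q z \<le> 1"
    and h: "h = (\<integral>z. q z \<partial>std_gaussian d)" "h > 0" and \<kappa>: "\<kappa> > 0"
  shows "(\<integral>z. q z * (\<Sum>i<d. w i * z i) \<partial>std_gaussian d) \<le> L2_set w {..<d} * (h powr (1 - \<kappa>) / sqrt \<kappa>)"
proof (cases "L2_set w {..<d} = 0")
  case True
  then have "\<And>i. i < d \<Longrightarrow> w i = 0" by (simp add: L2_set_eq_0_iff)
  then show ?thesis using True by simp
next
  case False
  interpret G: prob_space "std_gaussian d" by (rule prob_space_std_gaussian)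
  define W where "W = L2_set w {..<d}"
  have W: "W > 0" using False L2_set_nonneg[of w "{..<d}"] unfolding W_def by linarith
  have W2: "W\<^sup>2 = (\<Sum>i<d. (w i)\<^sup>2)" by (simp add: W_def L2_set_def sum_nonneg)
  define a where "a = 1 / (sqrt \<kappa> * W)"
  have a: "a > 0" using W \<kappa> by (simp add: a_def)
  \<comment> \<open>This \<open>c\<close> minimises
    \<open>(c - 1) * h + exp (- c) * exp (1 / (2 * \<kappa>))\<close>. At the minimum the second
    term equals \<open>h\<close> and the bound collapses to \<open>c * h\<close>.\<close>
  define c where "c = 1 / (2 * \<kappa>) - ln h"
  let ?S = "\<lambda>z. \<Sum>i<d. w i * z i"
  have [measurable]: "?S \<in> borel_measurable (std_gaussian d)" by measurable
  have iS: "integrable (std_gaussian d) ?S"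
    by (auto intro!: Bochner_Integration.integrable_sum integrable_mult_right integrable_std_gaussian_coord)
  have iq: "integrable (std_gaussian d) q" by (rule G.integrable_const_bound[of _ 1]) (use q01 in auto)
  have iqS: "integrable (std_gaussian d) (\<lambda>z. q z * ?S z)"
    by (rule Bochner_Integration.integrable_bound[OF iS]) (use q01 in \<open>auto simp: abs_mult intro!: AE_I2 mult_left_le_one_le\<close>)
  have e: "(\<Sum>i<d. (a * w i) * z i) = a * ?S z" for z by (simp add: sum_distrib_left mult.assoc)
  have iexp: "integrable (std_gaussian d) (\<lambda>z. exp (a * ?S z))" "(\<integral>z. exp (a * ?S z) \<partial>std_gaussian d) = exp (1 / (2 * \<kappa>))"
  proof -
    have "(\<Sum>i<d. (a * w i)\<^sup>2) = a\<^sup>2 * W\<^sup>2" by (simp add: W2 power_mult_distrib sum_distrib_left)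
    also have "\<dots> = 1 / \<kappa>" using W \<kappa> by (simp add: a_def power_divide power_mult_distrib)
    finally have "(\<Sum>i<d. (a * w i)\<^sup>2) / 2 = 1 / (2 * \<kappa>)" by simp
    then show "integrable (std_gaussian d) (\<lambda>z. exp (a * ?S z))" "(\<integral>z. exp (a * ?S z) \<partial>std_gaussian d) = exp (1 / (2 * \<kappa>))"
      using std_gaussian_exp_moment[of d "\<lambda>i. a * w i"] by (simp_all only: e)
  qed
  have "a * (\<integral>z. q z * ?S z \<partial>std_gaussian d) = (\<integral>z. a * (q z * ?S z) \<partial>std_gaussian d)" by simp
  also have "\<dots> \<le> (\<integral>z. (c - 1) * q z + exp (- c) * exp (a * ?S z) \<partial>std_gaussian d)"
  proof (rule integral_mono)
    fix z
    have "a * ?S z \<le> c - 1 + exp (- c) * exp (a * ?S z)"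
      using exp_ge_add_one_self[of "a * ?S z - c"] by (simp add: exp_diff exp_minus field_simps)
    from mult_left_mono[OF this q01(1)[of z]]
    have "a * (q z * ?S z) \<le> (c - 1) * q z + q z * (exp (- c) * exp (a * ?S z))" by (simp add: algebra_simps)
    also have "q z * (exp (- c) * exp (a * ?S z)) \<le> exp (- c) * exp (a * ?S z)"
      using q01 by (intro mult_left_le_one_le) auto
    finally show "a * (q z * ?S z) \<le> (c - 1) * q z + exp (- c) * exp (a * ?S z)" by simp
  qed (use iqS iq iexp in auto)
  also have "\<dots> = (c - 1) * h + exp (- c) * exp (1 / (2 * \<kappa>))" using iq iexp by (simp add: h(1))
  also have "exp (- c) * exp (1 / (2 * \<kappa>)) = h" using h(2) by (simp add: c_def exp_add[symmetric])
  also have "(c - 1) * h + h = c * h" by (simp add: algebra_simps)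
  finally have 1: "a * (\<integral>z. q z * ?S z \<partial>std_gaussian d) \<le> c * h" .
  \<comment> \<open>The inequality \<open>ln y \<le> y - 1\<close> at
    \<open>y = h powr (- \<kappa>)\<close> trades the logarithm for a small power. The term
    \<open>- 1 / \<kappa>\<close> that it yields absorbs the constant
    \<open>1 / (2 * \<kappa>)\<close> in \<open>c\<close>.\<close>
  have "- \<kappa> * ln h \<le> h powr (- \<kappa>) - 1"
    using ln_le_minus_one[of "h powr (- \<kappa>)"] h(2) by (simp add: ln_powr)
  then have "(- \<kappa> * ln h) / \<kappa> \<le> (h powr (- \<kappa>) - 1) / \<kappa>" using \<kappa> by (intro divide_right_mono) auto
  then have "- ln h \<le> h powr (- \<kappa>) / \<kappa> - 1 / \<kappa>" using \<kappa> by (simp add: diff_divide_distrib)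
  moreover have "1 / (2 * \<kappa>) \<le> 1 / \<kappa>" using \<kappa> by (simp add: field_simps)
  ultimately have "c \<le> h powr (- \<kappa>) / \<kappa>" by (simp add: c_def)
  then have "c * h \<le> h powr (- \<kappa>) / \<kappa> * h" using h(2) by (intro mult_right_mono) auto
  also have "\<dots> = h powr (1 - \<kappa>) / \<kappa>" using h(2) by (simp add: powr_diff powr_minus field_simps)
  finally have "a * (\<integral>z. q z * ?S z \<partial>std_gaussian d) \<le> h powr (1 - \<kappa>) / \<kappa>" using 1 by simp
  then have "(\<integral>z. q z * ?S z \<partial>std_gaussian d) \<le> h powr (1 - \<kappa>) / \<kappa> / a" by (subst pos_le_divide_eq[OF a], subst mult.commute)
  also have "\<dots> = W * (h powr (1 - \<kappa>) / (\<kappa> / sqrt \<kappa>))" using W \<kappa> by (simp add: a_def)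
  also have "\<kappa> / sqrt \<kappa> = sqrt \<kappa>" using \<kappa> by (simp add: real_div_sqrt)
  finally show ?thesis by (simp add: W_def)
qed

section \<open>The stationary equation for bounded test functions\<close>

lemma bounded_smooth_exists:
  assumes "\<And>k. Ck True d k g"
  obtains D E where "bounded_smooth d g D E"
proof -
  from Ck_Suc_cases[OF assms[of "Suc 0"]] obtain D where
    D: "\<And>i x. i < d \<Longrightarrow> x \<in> Rd d \<Longrightarrow> ((\<lambda>t. g (x(i := t))) has_real_derivative D i x) (at (x i))"
      "\<And>i. i < d \<Longrightarrow> Ck True d 0 (D i)" by blast
  have CD: "Ck True d k (D i)" if "i < d" for i k by (rule Ck_partial[OF assms that D(1)[OF that]])
  have "\<forall>i. \<exists>e. i < d \<longrightarrow> (\<forall>x\<in>Rd d. ((\<lambda>t. D i (x(i := t))) has_real_derivative e x) (at (x i)))"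
  proof
    fix i
    show "\<exists>e. i < d \<longrightarrow> (\<forall>x\<in>Rd d. ((\<lambda>t. D i (x(i := t))) has_real_derivative e x) (at (x i)))"
    proof (cases "i < d")
      case True
      from Ck_Suc_cases[OF CD[OF this, of "Suc 0"]] obtain E where
        E: "\<And>j x. j < d \<Longrightarrow> x \<in> Rd d \<Longrightarrow> ((\<lambda>t. D i (x(j := t))) has_real_derivative E j x) (at (x j))"
          "\<And>j. j < d \<Longrightarrow> Ck True d 0 (E j)" by blast
      from E(1) have "\<forall>x\<in>Rd d. ((\<lambda>t. D i (x(i := t))) has_real_derivative E i x) (at (x i))" using True by simp
      then show ?thesis by (intro exI[of _ "E i"] impI)
    qed simp
  qed
  from choice[OF this] obtain E where
    "\<And>i x. i < d \<Longrightarrow> x \<in> Rd d \<Longrightarrow> ((\<lambda>t. D i (x(i := t))) has_real_derivative E i x) (at (x i))" by blast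
  note E = this
  have "bounded_smooth d g D E"
    by (rule bounded_smooth.intro) (fact assms, fact D(1), fact E)
  then show ?thesis by (rule that)
qed

lemma partial_deriv_eqI:
  "((\<lambda>t. \<phi> (x(i := t))) has_real_derivative D) (at (x i)) \<Longrightarrow> partial_deriv i \<phi> x = D"
  unfolding partial_deriv_def by (rule DERIV_imp_deriv)

lemma partial_deriv_cong:
  assumes "\<And>x. x \<in> Rd d \<Longrightarrow> \<phi> x = \<psi> x" "i < d" "x \<in> Rd d"
  shows "partial_deriv i \<phi> x = partial_deriv i \<psi> x"
  using assms(1)[OF Rd_update[OF assms(3,2)]] by (simp add: partial_deriv_def)

lemma sq_aff_0: "sq d (aff d c (\<lambda>_. 0) x) = c\<^sup>2 * sq d x"
  by (simp add: sq_def aff_def power_mult_distrib sum_distrib_left)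

lemma coord_sq_le: "i < d \<Longrightarrow> (x i)\<^sup>2 \<le> sq d x"
  unfolding sq_def by (intro member_le_sum) auto

context bounded_smooth
begin

lemma laplacian_eq: "x \<in> Rd d \<Longrightarrow> laplacian d g x = (\<Sum>i<d. E i x)"
  and grad_eq: "x \<in> Rd d \<Longrightarrow> i < d \<Longrightarrow> grad g x i = D i x"
proof -
  have p: "partial_deriv i g x = D i x" if "i < d" "x \<in> Rd d" for i x
    by (rule partial_deriv_eqI[OF g_deriv[OF that]])
  show "x \<in> Rd d \<Longrightarrow> i < d \<Longrightarrow> grad g x i = D i x" by (simp add: grad_def p)
  show "laplacian d g x = (\<Sum>i<d. E i x)" if x: "x \<in> Rd d"
    unfolding laplacian_def
  proof (rule sum.cong[OF refl])
    fix i assume "i \<in> {..<d}"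
    then have i: "i < d" by simp
    have "partial_deriv i (partial_deriv i g) x = partial_deriv i (D i) x"
      by (rule partial_deriv_cong[OF p[OF i] i x])
    also have "\<dots> = E i x" by (rule partial_deriv_eqI[OF D_deriv[OF i x]])
    finally show "partial_deriv i (partial_deriv i g) x = E i x" .
  qed
qed

lemma continuous_Lg: "continuous_on (Rd d) Lg"
  unfolding Lg_def
  by (auto intro!: continuous_intros D_cb E_cb continuous_on_subset[OF continuous_on_product_coordinates])

end

section \<open>Products, substitutions, averages and powers of test functions\<close>

lemma bounded_smooth_mult:
  assumes "bounded_smooth d g D E" "bounded_smooth d h D' E'"
  shows "bounded_smooth d (\<lambda>x. g x * h x) (\<lambda>i x. D i x * h x + D' i x * g x)
    (\<lambda>i x. (E i x * h x + D' i x * D i x) + (E' i x * g x + D i x * D' i x))"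
proof -
  interpret A: bounded_smooth d g D E by fact
  interpret B: bounded_smooth d h D' E' by fact
  show ?thesis
  proof
    fix i x assume *: "i < d" "x \<in> Rd d"
    note d = A.g_deriv[OF *] B.g_deriv[OF *] A.D_deriv[OF *] B.D_deriv[OF *]
    show "((\<lambda>t. g (x(i := t)) * h (x(i := t))) has_real_derivative D i x * h x + D' i x * g x) (at (x i))"
      using DERIV_mult[OF d(1,2)] by simp
    show "((\<lambda>t. D i (x(i := t)) * h (x(i := t)) + D' i (x(i := t)) * g (x(i := t))) has_real_derivative
       (E i x * h x + D' i x * D i x) + (E' i x * g x + D i x * D' i x)) (at (x i))"
      using DERIV_add[OF DERIV_mult[OF d(3,2)] DERIV_mult[OF d(4,1)]] by simp
  qed (rule Ck_mult[OF A.Ck_g B.Ck_g])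
qed

lemma bounded_smooth_aff:
  assumes "bounded_smooth d g D E"
  shows "bounded_smooth d (\<lambda>x. g (aff d c w x)) (\<lambda>i x. c * D i (aff d c w x)) (\<lambda>i x. c * (c * E i (aff d c w x)))"
proof -
  interpret A: bounded_smooth d g D E by fact
  show ?thesis
  proof
    fix i x assume *: "i < d" "x \<in> Rd d"
    show "((\<lambda>t. g (aff d c w (x(i := t)))) has_real_derivative c * D i (aff d c w x)) (at (x i))"
      by (rule aff_deriv[OF *(1) A.g_deriv[OF *(1) aff_in_Rd]])
    show "((\<lambda>t. c * D i (aff d c w (x(i := t)))) has_real_derivative c * (c * E i (aff d c w x))) (at (x i))"
      by (rule DERIV_cmult[OF aff_deriv[OF *(1) A.D_deriv[OF *(1) aff_in_Rd]]])
  qed (rule Ck_aff[OF A.Ck_g])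
qed

lemma bounded_smooth_mehler:
  assumes "bounded_smooth d g D E"
  shows "bounded_smooth d (mehler d \<theta> g) (\<lambda>i x. cos \<theta> * mehler d \<theta> (D i) x) (\<lambda>i x. cos \<theta> * (cos \<theta> * mehler d \<theta> (E i) x))"
proof -
  interpret A: bounded_smooth d g D E by fact
  show ?thesis
  proof
    fix i x assume *: "i < d" "x \<in> Rd d"
    show "((\<lambda>t. mehler d \<theta> g (x(i := t))) has_real_derivative cos \<theta> * mehler d \<theta> (D i) x) (at (x i))"
      by (rule mehler_partial[OF * A.g_deriv[OF *(1)] A.g_cb A.D_cb(2)[OF *(1)]])
    show "((\<lambda>t. cos \<theta> * mehler d \<theta> (D i) (x(i := t))) has_real_derivative cos \<theta> * (cos \<theta> * mehler d \<theta> (E i) x)) (at (x i))"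
      by (rule DERIV_cmult[OF mehler_partial[OF * A.D_deriv[OF *(1)] A.D_cb[OF *(1)] A.E_cb(2)[OF *(1)]]])
  qed (rule Ck_mehler[OF A.Ck_g])
qed

text \<open>The floor \<open>\<epsilon>\<close> keeps the values in a compact part of
  \<open>{0<..}\<close>, where powers have bounded derivatives of every order. It is sent to zero
  only when the inequality no longer contains derivatives.\<close>

lemma bounded_smooth_powr:
  assumes "bounded_smooth d g D E" and \<epsilon>: "\<epsilon> > 0" "\<And>x. x \<in> Rd d \<Longrightarrow> \<epsilon> \<le> g x" "\<And>x. x \<in> Rd d \<Longrightarrow> g x \<le> 1"
  shows "bounded_smooth d (\<lambda>x. g x powr \<kappa>) (\<lambda>i x. \<kappa> * g x powr (\<kappa> - 1) * D i x)
    (\<lambda>i x. \<kappa> * g x powr (\<kappa> - 1) * E i x + \<kappa> * (\<kappa> - 1) * g x powr (\<kappa> - 2) * (D i x)\<^sup>2)"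
proof -
  interpret A: bounded_smooth d g D E by fact
  have pow: "((\<lambda>t. c * g (x(i := t)) powr a) has_real_derivative c * a * g x powr (a - 1) * D i x) (at (x i))"
    if *: "i < d" "x \<in> Rd d" for i x c a
  proof -
    have "g x > 0" using \<epsilon>(1) \<epsilon>(2)[OF *(2)] by linarith
    then have "((\<lambda>y. c * y powr a) has_real_derivative c * a * g x powr (a - 1)) (at (g x))"
      by (auto intro!: derivative_eq_intros)
    from DERIV_chain2[OF _ A.g_deriv[OF *], of "\<lambda>y. c * y powr a"] this show ?thesis by simp
  qed
  show ?thesis
  proof
    fix k
    have "g ` Rd d \<subseteq> {\<epsilon>..1}" "{\<epsilon>..1} \<subseteq> {0<..}" using \<epsilon> by auto
    from Ck_compose[OF A.Ck_g C1_powr[of k 1 \<kappa>] this] show "Ck True d k (\<lambda>x. g x powr \<kappa>)" by simp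
  next
    fix i x assume *: "i < d" "x \<in> Rd d"
    show "((\<lambda>t. g (x(i := t)) powr \<kappa>) has_real_derivative \<kappa> * g x powr (\<kappa> - 1) * D i x) (at (x i))"
      using pow[OF *, of 1 \<kappa>] by simp
    show "((\<lambda>t. \<kappa> * g (x(i := t)) powr (\<kappa> - 1) * D i (x(i := t))) has_real_derivative
      \<kappa> * g x powr (\<kappa> - 1) * E i x + \<kappa> * (\<kappa> - 1) * g x powr (\<kappa> - 2) * (D i x)\<^sup>2) (at (x i))"
      using DERIV_mult[OF pow[OF *, of \<kappa> "\<kappa> - 1"] A.D_deriv[OF *]]
      by (simp add: power2_eq_square algebra_simps)
  qed
qed

section \<open>The solution measure and test functions without compact support\<close>

locale stationary_solution = prob_space \<mu> for d :: nat and v and \<mu> :: "(nat \<Rightarrow> real) measure" +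
  assumes sets_\<mu>: "sets \<mu> = sets (Pi\<^sub>M {..<d} (\<lambda>_. borel))"
    and v_meas: "v \<in> measurable (Pi\<^sub>M {..<d} (\<lambda>_. borel)) (Pi\<^sub>M {..<d} (\<lambda>_. borel :: real measure))"
    and v_int: "integrable \<mu> (\<lambda>x. L2_set (v x) {..<d})"
    and FPK: "stationary_FPK d (\<lambda>x i. - x i + v x i) \<mu>"
begin

lemma space_\<mu>: "space \<mu> = Rd d"
  using sets_eq_imp_space_eq[OF sets_\<mu>] by (simp add: space_PiM Rd_def)

lemma measurable_cont: "continuous_on (Rd d) \<phi> \<Longrightarrow> \<phi> \<in> borel_measurable \<mu>" for \<phi> :: "(nat \<Rightarrow> real) \<Rightarrow> real"
  using borel_measurable_continuous_on_Rd[of d \<phi>] measurable_cong_sets[OF sets_\<mu> refl] by blast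

lemma integrable_cb:
  assumes "continuous_on (Rd d) \<phi>" "bounded (\<phi> ` Rd d)"
  shows "integrable \<mu> (\<phi> :: _ \<Rightarrow> real)"
proof -
  from assms(2) obtain B where "\<And>x. x \<in> Rd d \<Longrightarrow> \<bar>\<phi> x\<bar> \<le> B" by (rule bounded_RdE) blast
  then show ?thesis by (intro integrable_const_bound[of _ B] measurable_cont assms) (auto simp: space_\<mu>)
qed

lemma v_coord_meas: "i < d \<Longrightarrow> (\<lambda>x. v x i) \<in> borel_measurable \<mu>"
  using measurable_compose[OF v_meas measurable_component_singleton[of i "{..<d}" "\<lambda>_. borel"]]
    measurable_cong_sets[OF sets_\<mu> refl] by auto

lemma v_coord_le: "i < d \<Longrightarrow> \<bar>v x i\<bar> \<le> L2_set (v x) {..<d}"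
  using member_le_L2_set[of "{..<d}" i "\<lambda>i. \<bar>v x i\<bar>"] by (simp add: L2_set_def)

lemma integrable_v_coord: "i < d \<Longrightarrow> integrable \<mu> (\<lambda>x. \<bar>v x i\<bar>)"
  by (rule Bochner_Integration.integrable_bound[OF v_int])
    (use v_coord_meas v_coord_le in \<open>auto intro!: AE_I2 order_trans[OF _ abs_ge_self]\<close>)

lemma integrable_v_mult:
  assumes "i < d" "continuous_on (Rd d) \<phi>" "bounded (\<phi> ` Rd d)"
  shows "integrable \<mu> (\<lambda>x. v x i * \<phi> x)"
proof -
  from assms(3) obtain B where B: "\<And>x. x \<in> Rd d \<Longrightarrow> \<bar>\<phi> x\<bar> \<le> B" by (rule bounded_RdE) blast
  note measurable_cont[OF assms(2), measurable] v_coord_meas[OF assms(1), measurable]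
  show ?thesis
  proof (rule Bochner_Integration.integrable_bound[OF integrable_mult_right[OF integrable_v_coord[OF assms(1)], of B]])
    show "AE x in \<mu>. norm (v x i * \<phi> x) \<le> norm (B * \<bar>v x i\<bar>)"
    proof (rule AE_I2)
      fix x assume "x \<in> space \<mu>"
      then have "\<bar>\<phi> x\<bar> \<le> \<bar>B\<bar>" using B space_\<mu> by fastforce
      from mult_right_mono[OF this, of "\<bar>v x i\<bar>"] show "norm (v x i * \<phi> x) \<le> norm (B * \<bar>v x i\<bar>)"
        by (simp add: abs_mult mult.commute)
    qed
  qed measurable
qed

text \<open>The equation is given for compactly supported functions, so \<open>\<phi>\<close> is
  multiplied by dilated cutoffs and the dilation is sent to infinity. The delicate term is the drift
  \<open>- x\<close> against the gradient of the cutoff, since no moment of \<open>\<mu>\<close> is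
  known: the dilation factor turns \<open>x\<close> into the rescaled point \<open>y\<close>, and
  \<open>y i * C i y\<close> is bounded because \<open>C\<close> vanishes for
  \<open>sq d y > 2\<close>. The analogous product of \<open>x\<close> with the gradient of
  \<open>\<phi>\<close> is controlled by the hypothesis \<open>bL\<close>.\<close>

lemma FPK_bounded:
  assumes "bounded_smooth d \<phi> D E" and bL: "bounded (bounded_smooth.Lg d D E ` Rd d)"
  shows "(\<integral>x. bounded_smooth.Lg d D E x + (\<Sum>i<d. v x i * D i x) \<partial>\<mu>) = 0"
proof -
  interpret \<phi>: bounded_smooth d \<phi> D E by fact
  obtain C CC where "bounded_smooth d (cutoff d) C CC" using bounded_smooth_exists[OF Ck_cutoff] .
  then interpret \<chi>: bounded_smooth d "cutoff d" C CC .
  define y where "y n = aff d (1 / real (Suc n)) (\<lambda>_. 0)" for n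
  have y_Rd: "y n x \<in> Rd d" for n x by (simp add: y_def aff_in_Rd)
  have y_i: "y n x i = x i / real (Suc n)" if "i < d" for n x i using that by (simp add: y_def aff_def)
  have sq_y: "sq d (y n x) = (1 / real (Suc n))\<^sup>2 * sq d x" for n x by (simp add: y_def sq_aff_0)
  have C0: "C i x = 0" if "i < d" "x \<in> Rd d" "sq d x < 1" for i x
    by (rule partial_zero[OF \<chi>.g_deriv[OF that(1,2)] that(2,1) open_sq_less, of d 1 1]) (use that cutoff_1 in auto)
  have C0': "C i x = 0" if "i < d" "x \<in> Rd d" "sq d x > 2" for i x
    by (rule partial_zero[OF \<chi>.g_deriv[OF that(1,2)] that(2,1) open_sq_gt, of 2 d 0]) (use that cutoff_0 in auto)
  have CC0: "CC i x = 0" if "i < d" "x \<in> Rd d" "sq d x < 1" for i x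
    by (rule partial_zero[OF \<chi>.D_deriv[OF that(1,2)] that(2,1) open_sq_less, of d 1 0]) (use that C0 in auto)
  \<comment> \<open>The integrand of the equation for the truncated function, sorted into the
    truncated main term and the terms that contain a derivative of the cutoff. At a fixed
    \<open>x\<close> the latter vanish as soon as \<open>sq d (y n x) < 1\<close>.\<close>
  define e where "e n x = cutoff d (y n x) * (\<phi>.Lg x + (\<Sum>i<d. v x i * D i x)) +
     (\<Sum>i<d. 2 * (1 / real (Suc n) * C i (y n x) * D i x) + 1 / real (Suc n) * (1 / real (Suc n) * CC i (y n x)) * \<phi> x
        - y n x i * C i (y n x) * \<phi> x + v x i * (1 / real (Suc n) * C i (y n x) * \<phi> x))" for n x
  have "(\<integral>x. e n x \<partial>\<mu>) = 0" for n
  proof -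
    let ?c = "1 / real (Suc n)"
    let ?F = "\<lambda>x. cutoff d (y n x) * \<phi> x"
    interpret F: bounded_smooth d ?F "\<lambda>i x. ?c * C i (y n x) * \<phi> x + D i x * cutoff d (y n x)"
      "\<lambda>i x. (?c * (?c * CC i (y n x)) * \<phi> x + D i x * (?c * C i (y n x))) + (E i x * cutoff d (y n x) + ?c * C i (y n x) * D i x)"
      unfolding y_def by (rule bounded_smooth_mult[OF bounded_smooth_aff[OF \<chi>.bounded_smooth_axioms] \<phi>.bounded_smooth_axioms])
    have "compact (closure {x \<in> Rd d. ?F x \<noteq> 0})"
    proof -
      let ?K = "{x \<in> Rd d. sq d x \<le> 2 * (real (Suc n))\<^sup>2}"
      have "{x \<in> Rd d. ?F x \<noteq> 0} \<subseteq> ?K"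
      proof safe
        fix x assume "cutoff d (y n x) * \<phi> x \<noteq> 0"
        then have "sq d (y n x) < 2" using cutoff_0[of d "y n x"] by fastforce
        then show "sq d x \<le> 2 * (real (Suc n))\<^sup>2" by (simp add: sq_y field_simps power_divide)
      qed
      then have "closure {x \<in> Rd d. ?F x \<noteq> 0} \<subseteq> ?K"
        by (rule closure_minimal[OF _ compact_imp_closed[OF compact_sq_ball]])
      then have eq: "closure {x \<in> Rd d. ?F x \<noteq> 0} = ?K \<inter> closure {x \<in> Rd d. ?F x \<noteq> 0}" by blast
      show ?thesis by (subst eq) (rule compact_Int_closed[OF compact_sq_ball closed_closure])
    qed
    then have "?F \<in> test_functions d"
      unfolding test_functions_def using smooth_RdI[OF F.Ck_g] by simp
    with FPK have "(\<integral>x. laplacian d ?F x + inner_Rd d (\<lambda>i. - x i + v x i) (grad ?F x) \<partial>\<mu>) = 0"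
      unfolding stationary_FPK_def by blast
    moreover have "laplacian d ?F x + inner_Rd d (\<lambda>i. - x i + v x i) (grad ?F x) = e n x" if "x \<in> Rd d" for x
    proof -
      have ieq: "inner_Rd d (\<lambda>i. - x i + v x i) (grad ?F x) = (\<Sum>i<d. (- x i + v x i) * (?c * C i (y n x) * \<phi> x + D i x * cutoff d (y n x)))"
        unfolding inner_Rd_def by (intro sum.cong refl) (simp add: F.grad_eq[OF that] del: of_nat_Suc)
      show ?thesis
        unfolding ieq F.laplacian_eq[OF that] e_def \<phi>.Lg_def sum_distrib_left sum.distrib[symmetric]
        by (intro sum.cong refl) (simp add: y_i algebra_simps diff_divide_distrib del: of_nat_Suc)
    qed
    then have "(\<integral>x. laplacian d ?F x + inner_Rd d (\<lambda>i. - x i + v x i) (grad ?F x) \<partial>\<mu>) = (\<integral>x. e n x \<partial>\<mu>)"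
      by (intro Bochner_Integration.integral_cong refl) (simp add: space_\<mu>)
    ultimately show ?thesis by simp
  qed
  moreover have "(\<lambda>n. \<integral>x. e n x \<partial>\<mu>) \<longlonglongrightarrow> (\<integral>x. \<phi>.Lg x + (\<Sum>i<d. v x i * D i x) \<partial>\<mu>)"
  proof -
    from bL obtain M where M: "\<And>x. x \<in> Rd d \<Longrightarrow> \<bar>\<phi>.Lg x\<bar> \<le> M" by (rule bounded_RdE) blast
    from \<phi>.g_cb(2) obtain A where A: "\<And>x. x \<in> Rd d \<Longrightarrow> \<bar>\<phi> x\<bar> \<le> A" by (rule bounded_RdE) blast
    have bnd: "\<exists>B. \<forall>i. i < d \<longrightarrow> (\<forall>x\<in>Rd d. \<bar>f i x\<bar> \<le> B i)" if "\<And>i. i < d \<Longrightarrow> bounded (f i ` Rd d)" for f :: "nat \<Rightarrow> _ \<Rightarrow> real"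
    proof -
      have "\<forall>i. \<exists>B. i < d \<longrightarrow> (\<forall>x\<in>Rd d. \<bar>f i x\<bar> \<le> B)" using bounded_RdE[OF that] by metis
      from choice[OF this] show ?thesis .
    qed
    obtain B where B: "\<And>i x. i < d \<Longrightarrow> x \<in> Rd d \<Longrightarrow> \<bar>D i x\<bar> \<le> B i" using bnd[of D, OF \<phi>.D_cb(2)] by blast
    obtain K where K: "\<And>i x. i < d \<Longrightarrow> x \<in> Rd d \<Longrightarrow> \<bar>C i x\<bar> \<le> K i" using bnd[of C, OF \<chi>.D_cb(2)] by blast
    obtain L where L: "\<And>i x. i < d \<Longrightarrow> x \<in> Rd d \<Longrightarrow> \<bar>CC i x\<bar> \<le> L i" using bnd[of CC, OF \<chi>.E_cb(2)] by blast
    define w where "w x = (M + (\<Sum>i<d. B i * \<bar>v x i\<bar>)) + (\<Sum>i<d. 2 * (K i * B i) + L i * A + (2 * K i) * A + (K i * A) * \<bar>v x i\<bar>)" for x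
    show ?thesis
    proof (rule integral_dominated_convergence[where w=w])
      show "integrable \<mu> w"
        unfolding w_def by (auto intro!: Bochner_Integration.integrable_add Bochner_Integration.integrable_sum integrable_v_coord)
      have cont: "continuous_on (Rd d) (\<lambda>x. f (y n x))" if "continuous_on (Rd d) f" for f :: "_ \<Rightarrow> real" and n
        unfolding y_def by (rule continuous_on_compose2[OF that continuous_on_aff]) (auto simp: aff_in_Rd)
      have coord: "continuous_on (Rd d) (\<lambda>x. x i)" for i
        by (rule continuous_on_subset[OF continuous_on_product_coordinates]) simp
      note [measurable] = v_coord_meas
      show "(\<lambda>x. \<phi>.Lg x + (\<Sum>i<d. v x i * D i x)) \<in> borel_measurable \<mu>"
        by (auto intro!: borel_measurable_add borel_measurable_sum borel_measurable_times measurable_cont[OF \<phi>.continuous_Lg]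
            measurable_cont[OF \<phi>.D_cb(1)] v_coord_meas)
      then show "e n \<in> borel_measurable \<mu>" for n
        unfolding e_def
        by (intro borel_measurable_add borel_measurable_diff borel_measurable_sum borel_measurable_times borel_measurable_const
            measurable_cont[OF cont[OF \<chi>.g_cb(1)]] measurable_cont[OF \<phi>.D_cb(1)]
            measurable_cont[OF cont[OF \<chi>.D_cb(1)]] measurable_cont[OF cont[OF \<chi>.E_cb(1)]] 
            measurable_cont[OF \<phi>.g_cb(1)] measurable_cont[OF cont[OF coord]] measurable_cont[OF \<phi>.continuous_Lg]
            v_coord_meas) auto
      show "AE x in \<mu>. (\<lambda>n. e n x) \<longlonglongrightarrow> \<phi>.Lg x + (\<Sum>i<d. v x i * D i x)"
      proof (rule AE_I2, rule tendsto_eventually)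
        fix x
        have "(\<lambda>n. (1 / real (Suc n))\<^sup>2 * sq d x) \<longlonglongrightarrow> 0\<^sup>2 * sq d x"
          using LIMSEQ_inverse_real_of_nat by (intro tendsto_mult tendsto_power tendsto_const) (simp add: divide_inverse)
        then have "\<forall>\<^sub>F n in sequentially. sq d (y n x) < 1"
          unfolding sq_y by (rule order_tendstoD(2)) simp
        then show "\<forall>\<^sub>F n in sequentially. e n x = \<phi>.Lg x + (\<Sum>i<d. v x i * D i x)"
          by eventually_elim (simp add: e_def cutoff_1 C0 CC0 y_Rd)
      qed
      show "AE x in \<mu>. norm (e n x) \<le> w x" for n
      proof (rule AE_I2)
        fix x assume "x \<in> space \<mu>"
        then have x: "x \<in> Rd d" by (simp add: space_\<mu>)
        let ?c = "1 / real (Suc n)"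
        have c: "\<bar>?c\<bar> \<le> 1" by simp
        have yn: "y n x \<in> Rd d" by (rule y_Rd)
        have A0: "A \<ge> 0" using A[OF x] by linarith
        have b1: "\<bar>cutoff d (y n x) * (\<phi>.Lg x + (\<Sum>i<d. v x i * D i x))\<bar> \<le> 1 * (M + (\<Sum>i<d. B i * \<bar>v x i\<bar>))"
          unfolding abs_mult
        proof (rule mult_mono)
          show "\<bar>cutoff d (y n x)\<bar> \<le> 1" using cutoff_range[of d "y n x"] by simp
          have "\<bar>\<Sum>i<d. v x i * D i x\<bar> \<le> (\<Sum>i<d. B i * \<bar>v x i\<bar>)"
            by (rule order_trans[OF sum_abs], rule sum_mono) (use B x in \<open>auto simp: abs_mult mult.commute intro!: mult_right_mono\<close>)
          then show "\<bar>\<phi>.Lg x + (\<Sum>i<d. v x i * D i x)\<bar> \<le> M + (\<Sum>i<d. B i * \<bar>v x i\<bar>)" using M[OF x] by linarith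
        qed auto
        have b2: "\<bar>\<Sum>i<d. 2 * (?c * C i (y n x) * D i x) + ?c * (?c * CC i (y n x)) * \<phi> x
          - y n x i * C i (y n x) * \<phi> x + v x i * (?c * C i (y n x) * \<phi> x)\<bar> \<le> (\<Sum>i<d. 2 * (K i * B i) + L i * A + (2 * K i) * A + (K i * A) * \<bar>v x i\<bar>)"
        proof (rule order_trans[OF sum_abs], rule sum_mono)
          fix i assume "i \<in> {..<d}"
          then have i: "i < d" by simp
          have K0: "K i \<ge> 0" using K[OF i x] by linarith
          have B0: "B i \<ge> 0" using B[OF i x] by linarith
          have L0: "L i \<ge> 0" using L[OF i x] by linarith
          have cC: "\<bar>?c * C i (y n x)\<bar> \<le> K i"
            using mult_mono[OF c K[OF i yn]] K0 by (simp add: abs_mult del: of_nat_Suc)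
          have "\<bar>?c * C i (y n x) * D i x\<bar> \<le> K i * B i"
            unfolding abs_mult[of _ "D i x"] by (rule mult_mono[OF cC B[OF i x] K0]) simp
          moreover have "\<bar>?c * (?c * CC i (y n x)) * \<phi> x\<bar> \<le> L i * A"
          proof -
            have cCC: "\<bar>?c * CC i (y n x)\<bar> \<le> L i"
              using mult_mono[OF c L[OF i yn]] L0 by (simp add: abs_mult del: of_nat_Suc)
            have "\<bar>?c * (?c * CC i (y n x))\<bar> \<le> L i"
              using mult_mono[OF c cCC] L0 by (simp add: abs_mult del: of_nat_Suc)
            from mult_mono[OF this A[OF x] L0] show ?thesis by (simp add: abs_mult del: of_nat_Suc)
          qed
          moreover have "\<bar>y n x i * C i (y n x) * \<phi> x\<bar> \<le> (2 * K i) * A"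
          proof -
            have "\<bar>y n x i * C i (y n x)\<bar> \<le> 2 * K i"
            proof (cases "sq d (y n x) > 2")
              case True then show ?thesis using C0'[OF i yn] K0 by simp
            next
              case False
              then have "(y n x i)\<^sup>2 \<le> 2\<^sup>2" using coord_sq_le[OF i, of "y n x"] by simp
              then have "\<bar>y n x i\<bar> \<le> 2" using abs_le_square_iff[of "y n x i" 2] by simp
              from mult_mono[OF this K[OF i yn]] K0 show ?thesis by (simp add: abs_mult)
            qed
            from mult_mono[OF this A[OF x]] K0 show ?thesis by (simp add: abs_mult)
          qed
          moreover have "\<bar>v x i * (?c * C i (y n x) * \<phi> x)\<bar> \<le> (K i * A) * \<bar>v x i\<bar>"
          proof -
            have "\<bar>?c * C i (y n x) * \<phi> x\<bar> \<le> K i * A"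
              unfolding abs_mult[of _ "\<phi> x"] by (rule mult_mono[OF cC A[OF x] K0]) simp
            from mult_right_mono[OF this, of "\<bar>v x i\<bar>"] show ?thesis by (simp add: abs_mult mult.commute del: of_nat_Suc)
          qed
          ultimately show "\<bar>2 * (?c * C i (y n x) * D i x) + ?c * (?c * CC i (y n x)) * \<phi> x
          - y n x i * C i (y n x) * \<phi> x + v x i * (?c * C i (y n x) * \<phi> x)\<bar> \<le> 2 * (K i * B i) + L i * A + (2 * K i) * A + (K i * A) * \<bar>v x i\<bar>"
            by linarith
        qed
        show "norm (e n x) \<le> w x"
          using order_trans[OF abs_triangle_ineq add_mono[OF b1 b2]] unfolding e_def w_def real_norm_def mult_1 .
      qed
    qed
  qed
  ultimately show ?thesis by (simp add: LIMSEQ_const_iff)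
qed

end

section \<open>Monotonicity along the Mehler semigroup\<close>

context stationary_solution
begin

abbreviation V :: real where "V \<equiv> L1_norm d \<mu> v"

lemma V_nonneg: "0 \<le> V"
  unfolding L1_norm_def by (intro Bochner_Integration.integral_nonneg) (rule L2_set_nonneg)

text \<open>The derivative is \<open>tan \<theta>\<close> times the integral of \<open>A\<close>,
  where \<open>A\<close> is \<open>\<kappa> h powr (\<kappa> - 1)\<close> times the generator on
  \<open>h\<close>. The equation for the test function \<open>h powr \<kappa>\<close> expresses the
  integral of \<open>A\<close> as that of the remainder \<open>R\<close> minus that of the drift
  term. The first has a favourable sign, and only the second has to be estimated.\<close>

lemma mehler_powr_integral_deriv:
  assumes "bounded_smooth d g D E" and bL: "\<And>x. x \<in> Rd d \<Longrightarrow> \<bar>bounded_smooth.Lg d D E x\<bar> \<le> M"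
    and \<epsilon>: "\<epsilon> > 0" "\<And>x. x \<in> Rd d \<Longrightarrow> \<epsilon> \<le> g x" "\<And>x. x \<in> Rd d \<Longrightarrow> g x \<le> 1"
    and \<kappa>: "0 < \<kappa>" "\<kappa> \<le> 1" and \<theta>: "0 < \<theta>" "\<theta> < pi / 2"
  shows "\<exists>u'. ((\<lambda>\<theta>. \<integral>x. mehler d \<theta> g x powr \<kappa> \<partial>\<mu>) has_real_derivative u') (at \<theta>) \<and> - (sqrt \<kappa> * V) \<le> u'"
proof -
  interpret g: bounded_smooth d g D E by fact
  have h_range: "\<epsilon> \<le> mehler d t g x" "mehler d t g x \<le> 1" for t x
    using mehler_bound[OF \<epsilon>(2,3) g.g_cb(1)] by blast+
  then have h_pos: "mehler d t g x > 0" for t x using \<epsilon>(1) by (metis less_le_trans)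
  have Lh_bound: "\<bar>mehler d t g.Lg x\<bar> \<le> M" for t x
  proof -
    have "- M \<le> g.Lg x" "g.Lg x \<le> M" if "x \<in> Rd d" for x using bL[OF that] by (auto simp: abs_le_iff)
    from mehler_bound[OF this g.continuous_Lg] show ?thesis by (auto simp: abs_le_iff minus_le_iff)
  qed
  let ?h = "mehler d \<theta> g"
  let ?D = "\<lambda>i x. cos \<theta> * mehler d \<theta> (D i) x"
  let ?E = "\<lambda>i x. cos \<theta> * (cos \<theta> * mehler d \<theta> (E i) x)"
  interpret h: bounded_smooth d ?h ?D ?E by (rule bounded_smooth_mehler) fact
  let ?D\<phi> = "\<lambda>i x. \<kappa> * ?h x powr (\<kappa> - 1) * ?D i x"
  let ?E\<phi> = "\<lambda>i x. \<kappa> * ?h x powr (\<kappa> - 1) * ?E i x + \<kappa> * (\<kappa> - 1) * ?h x powr (\<kappa> - 2) * (?D i x)\<^sup>2"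
  interpret \<phi>: bounded_smooth d "\<lambda>x. ?h x powr \<kappa>" ?D\<phi> ?E\<phi>
    by (rule bounded_smooth_powr[OF h.bounded_smooth_axioms \<epsilon>(1)]) (use h_range in auto)
  have cos: "cos \<theta> > 0" using \<theta> by (intro cos_gt_zero_pi) auto
  have sin: "sin \<theta> > 0" using \<theta> by (intro sin_gt_zero) auto
  have tan: "tan \<theta> > 0" using \<theta> by (intro tan_gt_zero)
  define LH where "LH = mehler d \<theta> g.Lg"
  \<comment> \<open>Commutation transfers the bound on \<open>g.Lg\<close> to the generator on
    \<open>h\<close>, in spite of the unbounded factors \<open>x i\<close> in it. This makes
    \<open>h powr \<kappa>\<close> admissible in \<open>FPK_bounded\<close>.\<close>
  have LH: "h.Lg x = LH x" for x
    unfolding h.Lg_def LH_def g.mehler_Lg by (intro sum.cong refl) (simp add: power2_eq_square)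
  have Ck_pow: "Ck True d 0 (\<lambda>x. ?h x powr a)" for a
  proof -
    have "?h ` Rd d \<subseteq> {\<epsilon>..1}" "{\<epsilon>..1} \<subseteq> {0<..}" using h_range \<epsilon>(1) by auto
    from Ck_compose[OF h.Ck_g C1_powr[of 0 1 a] this] show ?thesis by simp
  qed
  have Ck_LH: "Ck True d 0 LH"
  proof -
    have "bounded (LH ` Rd d)" unfolding bounded_iff LH_def using Lh_bound by auto
    moreover have "continuous_on (Rd d) LH" using h.continuous_Lg by (rule continuous_on_cong[THEN iffD1, rotated 2]) (auto simp: LH)
    ultimately show ?thesis by simp
  qed
  define A where "A x = \<kappa> * (?h x powr (\<kappa> - 1) * LH x)" for x
  \<comment> \<open>concavity of \<open>y \<mapsto> y\<^sup>\<kappa>\<close> makes the second-order remainder \<open>R\<close> nonnegative\<close>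
  define R where "R x = \<kappa> * (1 - \<kappa>) * (?h x powr (\<kappa> - 2) * (\<Sum>i<d. ?D i x * ?D i x))" for x
  have L\<phi>: "\<phi>.Lg x = A x - R x" for x
    unfolding \<phi>.Lg_def A_def R_def LH[symmetric] h.Lg_def sum_distrib_left sum_subtractf[symmetric]
    by (intro sum.cong refl) (simp add: algebra_simps power2_eq_square)
  have Ck_A: "Ck True d 0 A" unfolding A_def by (intro Ck_mult Ck_const Ck_pow Ck_LH)
  have Ck_R: "Ck True d 0 R" unfolding R_def by (intro Ck_mult Ck_const Ck_pow Ck_sum h.Ck_D) auto
  have Ck_L\<phi>: "Ck True d 0 (\<lambda>x. A x + (-1) * R x)" by (intro Ck_add Ck_mult Ck_A Ck_R Ck_const)
  have R0: "R x \<ge> 0" for x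
  proof -
    have "0 \<le> (\<Sum>i<d. ?D i x * ?D i x)" by (rule sum_nonneg) (rule zero_le_square)
    then show ?thesis unfolding R_def using \<kappa> by (intro mult_nonneg_nonneg) auto
  qed
  have iA: "integrable \<mu> A" by (rule integrable_cb[OF Ck_continuous[OF Ck_A] Ck_bounded[OF Ck_A]])
  have iR: "integrable \<mu> R" by (rule integrable_cb[OF Ck_continuous[OF Ck_R] Ck_bounded[OF Ck_R]])
  have iv: "integrable \<mu> (\<lambda>x. \<Sum>i<d. v x i * ?D\<phi> i x)"
    by (intro Bochner_Integration.integrable_sum integrable_v_mult \<phi>.D_cb) auto
  have "(\<integral>x. \<phi>.Lg x + (\<Sum>i<d. v x i * ?D\<phi> i x) \<partial>\<mu>) = 0"
  proof (rule FPK_bounded[OF \<phi>.bounded_smooth_axioms])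
    show "bounded (\<phi>.Lg ` Rd d)" using Ck_bounded[OF Ck_L\<phi>] unfolding L\<phi> by simp
  qed
  then have eq0: "(\<integral>x. A x \<partial>\<mu>) - (\<integral>x. R x \<partial>\<mu>) + (\<integral>x. (\<Sum>i<d. v x i * ?D\<phi> i x) \<partial>\<mu>) = 0"
    unfolding L\<phi> using iA iR iv by simp
  have R_int: "(\<integral>x. R x \<partial>\<mu>) \<ge> 0" using R0 by (intro Bochner_Integration.integral_nonneg)
  have grad_bound: "tan \<theta> * (\<Sum>i<d. v x i * ?D\<phi> i x) \<le> sqrt \<kappa> * L2_set (v x) {..<d}" for x
  proof -
    have q: "(\<lambda>z. g (mix d \<theta> x z)) \<in> borel_measurable (std_gaussian d)" by (rule measurable_mix[OF g.g_cb(1)])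
    have "(\<integral>z. g (mix d \<theta> x z) * (\<Sum>i<d. v x i * z i) \<partial>std_gaussian d) =
      (\<integral>z. (\<Sum>i<d. v x i * (z i * g (mix d \<theta> x z))) \<partial>std_gaussian d)"
      by (simp add: sum_distrib_left algebra_simps)
    also have "\<dots> = (\<Sum>i<d. v x i * (sin \<theta> * mehler d \<theta> (D i) x))"
      by (subst Bochner_Integration.integral_sum) (auto intro!: sum.cong integrable_mult_right integrable_mix_coord g.g_cb simp: g.mehler_ibp_g)
    finally have *: "(\<Sum>i<d. v x i * (sin \<theta> * mehler d \<theta> (D i) x)) \<le> L2_set (v x) {..<d} * (?h x powr (1 - \<kappa>) / sqrt \<kappa>)"
      using gaussian_weighted_linear_bound[OF q _ _ mehler_def h_pos \<kappa>(1), of "v x"] \<epsilon> mix_in_Rd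
      by (simp add: less_imp_le[OF less_le_trans])
    \<comment> \<open>Since \<open>tan \<theta> * cos \<theta> = sin \<theta>\<close>, the time
      change supplies exactly the factor of the Gaussian integration by parts, and the bound no
      longer depends on the angle.\<close>
    have "tan \<theta> * (\<Sum>i<d. v x i * ?D\<phi> i x) = \<kappa> * ?h x powr (\<kappa> - 1) * (\<Sum>i<d. v x i * (sin \<theta> * mehler d \<theta> (D i) x))"
      unfolding sum_distrib_left using cos by (intro sum.cong refl) (simp add: tan_def field_simps)
    also have "\<dots> \<le> \<kappa> * ?h x powr (\<kappa> - 1) * (L2_set (v x) {..<d} * (?h x powr (1 - \<kappa>) / sqrt \<kappa>))"
      using \<kappa> by (intro mult_left_mono *) auto
    also have "\<dots> = (\<kappa> / sqrt \<kappa>) * (?h x powr (\<kappa> - 1) * ?h x powr (1 - \<kappa>)) * L2_set (v x) {..<d}" by simp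
    also have "?h x powr (\<kappa> - 1) * ?h x powr (1 - \<kappa>) = 1" using h_pos[of \<theta> x] by (simp add: powr_add[symmetric])
    also have "\<kappa> / sqrt \<kappa> = sqrt \<kappa>" using \<kappa> by (simp add: real_div_sqrt)
    finally show ?thesis by simp
  qed
  have "tan \<theta> * (\<integral>x. (\<Sum>i<d. v x i * ?D\<phi> i x) \<partial>\<mu>) \<le> sqrt \<kappa> * V"
  proof -
    have "(\<integral>x. tan \<theta> * (\<Sum>i<d. v x i * ?D\<phi> i x) \<partial>\<mu>) \<le> (\<integral>x. sqrt \<kappa> * L2_set (v x) {..<d} \<partial>\<mu>)"
      by (intro integral_mono grad_bound integrable_mult_right iv v_int)
    then show ?thesis by (simp add: L1_norm_def)
  qed
  moreover have "tan \<theta> * (\<integral>x. A x \<partial>\<mu>) \<ge> - (tan \<theta> * (\<integral>x. (\<Sum>i<d. v x i * ?D\<phi> i x) \<partial>\<mu>))"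
  proof -
    have "(\<integral>x. A x \<partial>\<mu>) \<ge> - (\<integral>x. (\<Sum>i<d. v x i * ?D\<phi> i x) \<partial>\<mu>)" using eq0 R_int by linarith
    from mult_left_mono[OF this, of "tan \<theta>"] tan show ?thesis by simp
  qed
  ultimately have low: "- (sqrt \<kappa> * V) \<le> tan \<theta> * (\<integral>x. A x \<partial>\<mu>)" by linarith
  \<comment> \<open>Stopping short of \<open>pi / 2\<close> keeps the tangent bounded on the
    interval where domination is required.\<close>
  obtain b where b: "\<theta> < b" "b < pi / 2" using \<theta>(2) dense by blast
  have cos_pos: "cos t > 0" if "0 < t" "t < b" for t using that b by (intro cos_gt_zero_pi) auto
  have "((\<lambda>\<theta>. \<integral>x. mehler d \<theta> g x powr \<kappa> \<partial>\<mu>) has_real_derivative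
      (\<integral>x. \<kappa> * mehler d \<theta> g x powr (\<kappa> - 1) * (tan \<theta> * mehler d \<theta> g.Lg x) \<partial>\<mu>)) (at \<theta>)"
  proof (rule has_real_derivative_integral[OF \<theta>(1) b(1), where w="\<lambda>_. \<kappa> * \<epsilon> powr (\<kappa> - 1) * (tan b * M)"])
    fix t assume t: "0 < t" "t < b"
    have "Ck True d 0 (\<lambda>x. mehler d t g x powr \<kappa>)"
    proof -
      have "mehler d t g ` Rd d \<subseteq> {\<epsilon>..1}" "{\<epsilon>..1} \<subseteq> {0<..}" using h_range \<epsilon>(1) by auto
      from Ck_compose[OF Ck_mehler[OF g.Ck_g] C1_powr[of 0 1 \<kappa>] this] show ?thesis by simp
    qed
    then show "integrable \<mu> (\<lambda>x. mehler d t g x powr \<kappa>)" using integrable_cb by simp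
    fix x assume x: "x \<in> space \<mu>"
    have "((\<lambda>y. y powr \<kappa>) has_real_derivative \<kappa> * mehler d t g x powr (\<kappa> - 1)) (at (mehler d t g x))"
      using h_pos[of t x] by (auto intro!: derivative_eq_intros)
    from DERIV_chain2[OF this g.mehler_angle] cos_pos[OF t]
    show "((\<lambda>t. mehler d t g x powr \<kappa>) has_real_derivative \<kappa> * mehler d t g x powr (\<kappa> - 1) * (tan t * mehler d t g.Lg x)) (at t)" by simp
    have "tan t \<le> tan b" "0 \<le> tan t"
      using t b by (auto intro!: tan_monotone' less_imp_le[OF tan_monotone] less_imp_le[OF tan_gt_zero])
    then have "\<bar>tan t * mehler d t g.Lg x\<bar> \<le> tan b * M"
      unfolding abs_mult using Lh_bound by (intro mult_mono) auto
    moreover have "\<bar>\<kappa> * mehler d t g x powr (\<kappa> - 1)\<bar> \<le> \<kappa> * \<epsilon> powr (\<kappa> - 1)"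
      using \<kappa> h_range[of t x] \<epsilon>(1) by (auto simp: abs_mult intro!: mult_left_mono powr_mono2')
    ultimately show "\<bar>\<kappa> * mehler d t g x powr (\<kappa> - 1) * (tan t * mehler d t g.Lg x)\<bar> \<le> \<kappa> * \<epsilon> powr (\<kappa> - 1) * (tan b * M)"
      unfolding abs_mult[of "\<kappa> * mehler d t g x powr (\<kappa> - 1)"] using \<kappa> by (intro mult_mono) auto
  qed simp
  also have "(\<lambda>x. \<kappa> * mehler d \<theta> g x powr (\<kappa> - 1) * (tan \<theta> * mehler d \<theta> g.Lg x)) = (\<lambda>x. tan \<theta> * A x)"
    by (auto simp: A_def LH_def)
  finally show ?thesis using low by auto
qed

text \<open>The function \<open>u \<theta> + sqrt \<kappa> * V * \<theta>\<close> is nondecreasing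
  and its end values are the two sides. The tangent blows up at \<open>pi / 2\<close>, so
  derivatives are taken in the open interval and the ends are reached by continuity. At
  \<open>pi / 2\<close> the average is constant in \<open>x\<close>, which is why the power stands
  outside the Gaussian integral.\<close>

lemma smooth_powr_inequality:
  assumes "bounded_smooth d g D E" and bL: "\<And>x. x \<in> Rd d \<Longrightarrow> \<bar>bounded_smooth.Lg d D E x\<bar> \<le> M"
    and \<epsilon>: "\<epsilon> > 0" "\<And>x. x \<in> Rd d \<Longrightarrow> \<epsilon> \<le> g x" "\<And>x. x \<in> Rd d \<Longrightarrow> g x \<le> 1"
    and \<kappa>: "0 < \<kappa>" "\<kappa> \<le> 1"
  shows "(\<integral>x. g x powr \<kappa> \<partial>\<mu>) \<le> (\<integral>z. g z \<partial>std_gaussian d) powr \<kappa> + sqrt \<kappa> * V * (pi / 2)"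
proof -
  interpret g: bounded_smooth d g D E by fact
  have h_range: "\<epsilon> \<le> mehler d t g x" "mehler d t g x \<le> 1" for t x
    using mehler_bound[OF \<epsilon>(2,3) g.g_cb(1)] by blast+
  then have h_pos: "mehler d t g x > 0" for t x using \<epsilon>(1) by (metis less_le_trans)
  define u where "u \<theta> = (\<integral>x. mehler d \<theta> g x powr \<kappa> \<partial>\<mu>)" for \<theta>
  have "continuous_on UNIV u"
  proof (rule continuous_on_sequentiallyI)
    fix X a assume X: "X \<longlonglongrightarrow> (a::real)"
    have meas: "(\<lambda>x. mehler d t g x powr \<kappa>) \<in> borel_measurable \<mu>" for t
      using measurable_cont[OF continuous_on_mehler[OF g.g_cb]] by measurable
    show "(\<lambda>n. u (X n)) \<longlonglongrightarrow> u a"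
      unfolding u_def
    proof (rule integral_dominated_convergence[where w="\<lambda>_. 1"])
      show "AE x in \<mu>. (\<lambda>n. mehler d (X n) g x powr \<kappa>) \<longlonglongrightarrow> mehler d a g x powr \<kappa>"
      proof (rule AE_I2)
        fix x
        have "isCont (\<lambda>t. mehler d t g x) a"
          by (rule DERIV_isCont[OF mehler_deriv_angle[OF g.g_deriv g.g_cb g.D_cb]])
        from isCont_tendsto_compose[OF this X] h_pos[of a x]
        show "(\<lambda>n. mehler d (X n) g x powr \<kappa>) \<longlonglongrightarrow> mehler d a g x powr \<kappa>"
          by (intro tendsto_powr tendsto_const) auto
      qed
      show "AE x in \<mu>. norm (mehler d (X n) g x powr \<kappa>) \<le> 1" for n
        using h_range h_pos \<kappa> by (intro AE_I2) (simp add: powr_le1 less_imp_le)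
    qed (use meas in auto)
  qed
  then have cont: "continuous_on {0..pi/2} (\<lambda>\<theta>. u \<theta> + sqrt \<kappa> * V * \<theta>)"
    by (auto intro!: continuous_intros elim: continuous_on_subset)
  have "u 0 + sqrt \<kappa> * V * 0 \<le> u (pi/2) + sqrt \<kappa> * V * (pi/2)"
  proof (rule DERIV_nonneg_imp_increasing_open[OF _ _ cont])
    fix \<theta> assume "0 < \<theta>" "\<theta> < pi / 2"
    from mehler_powr_integral_deriv[OF assms(1) bL \<epsilon> \<kappa> this]
    obtain u' where u': "(u has_real_derivative u') (at \<theta>)" "- (sqrt \<kappa> * V) \<le> u'" unfolding u_def[abs_def] by blast
    have "((\<lambda>\<theta>. u \<theta> + sqrt \<kappa> * V * \<theta>) has_real_derivative u' + sqrt \<kappa> * V) (at \<theta>)"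
      by (auto intro!: derivative_eq_intros u'(1))
    then show "\<exists>y. ((\<lambda>\<theta>. u \<theta> + sqrt \<kappa> * V * \<theta>) has_real_derivative y) (at \<theta>) \<and> 0 \<le> y"
      using u'(2) by (intro exI[of _ "u' + sqrt \<kappa> * V"]) auto
  qed simp
  moreover have "u 0 = (\<integral>x. g x powr \<kappa> \<partial>\<mu>)"
    unfolding u_def by (intro Bochner_Integration.integral_cong refl) (simp add: space_\<mu> mehler_0)
  moreover have "u (pi/2) = (\<integral>z. g z \<partial>std_gaussian d) powr \<kappa>"
    unfolding u_def mehler_pi_half using prob_space by simp
  ultimately show ?thesis by simp
qed

end

section \<open>From smooth functions to measurable sets\<close>

lemma closed_Rd: "closed (Rd d)"
proof -
  have "Rd d = (\<Inter>i\<in>{d..}. {x. x i = undefined})"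
    by (auto simp: Rd_def PiE_def extensional_def)
  also have "closed \<dots>"
    by (intro closed_INT ballI closed_Collect_eq continuous_on_const continuous_on_product_coordinates)
  finally show ?thesis .
qed

text \<open>Inner and outer regularity will be applied to Borel measures on all of
  \<open>nat \<Rightarrow> real\<close>, so measurable sets must be Borel there. \<open>A\<close> is
  its own preimage under the restriction map, cut back to the closed set
  \<open>Rd d\<close>.\<close>

lemma sets_PiM_imp_borel:
  assumes "A \<in> sets (Pi\<^sub>M {..<d} (\<lambda>_. borel :: real measure))"
  shows "A \<in> sets (borel :: (nat \<Rightarrow> real) measure)"
proof -
  have "(\<lambda>x. restrict x {..<d}) \<in> measurable (Pi\<^sub>M UNIV (\<lambda>_. borel)) (Pi\<^sub>M {..<d} (\<lambda>_. borel :: real measure))"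
    by (rule measurable_restrict_subset) simp
  from measurable_sets[OF this assms]
  have "(\<lambda>x. restrict x {..<d}) -` A \<in> sets (borel :: (nat \<Rightarrow> real) measure)"
    by (simp add: space_PiM sets_PiM_equal_borel)
  moreover have "Rd d \<in> sets borel" using closed_Rd by simp
  moreover have "A = (\<lambda>x. restrict x {..<d}) -` A \<inter> Rd d"
    using sets.sets_into_space[OF assms] by (auto simp: space_PiM Rd_def PiE_def extensional_restrict)
  ultimately show ?thesis by (metis sets.Int)
qed

text \<open>Small Euclidean balls are neighbourhoods in the product topology. If every radius
  \<open>1 / Suc n\<close> failed, points outside \<open>U\<close> would converge to
  \<open>k\<close> coordinatewise, the coordinates from \<open>d\<close> on being constantly
  \<open>undefined\<close>.\<close>

lemma open_contains_bump:
  assumes U: "open U" "k \<in> U" "k \<in> Rd d"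
  obtains r where "r > 0" "\<And>x. x \<in> Rd d \<Longrightarrow> sq d (aff d (1 / r) (\<lambda>i. - k i / r) x) < 2 \<Longrightarrow> x \<in> U"
proof (rule ccontr)
  assume "\<not> thesis"
  then have "\<forall>n. \<exists>x. x \<in> Rd d \<and> sq d (aff d (1 / (1 / real (Suc n))) (\<lambda>i. - k i / (1 / real (Suc n))) x) < 2 \<and> x \<notin> U"
    using that by (metis of_nat_0_less_iff zero_less_Suc zero_less_divide_1_iff)
  then obtain X where X: "\<And>n. X n \<in> Rd d"
    "\<And>n. sq d (aff d (1 / (1 / real (Suc n))) (\<lambda>i. - k i / (1 / real (Suc n))) (X n)) < 2" "\<And>n. X n \<notin> U"
    by metis
  have "X \<longlonglongrightarrow> k"
    unfolding tendsto_fun_iff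
  proof
    fix i
    show "(\<lambda>n. X n i) \<longlonglongrightarrow> k i"
    proof (cases "i < d")
      case True
      have "\<bar>X n i - k i\<bar> \<le> 2 * (1 / real (Suc n))" for n
      proof -
        have "(real (Suc n) * (X n i - k i))\<^sup>2 \<le> sq d (aff d (1 / (1 / real (Suc n))) (\<lambda>i. - k i / (1 / real (Suc n))) (X n))"
          using coord_sq_le[OF True, of "aff d (1 / (1 / real (Suc n))) (\<lambda>i. - k i / (1 / real (Suc n))) (X n)"] True
          by (simp add: aff_def algebra_simps)
        also have "\<dots> \<le> 2\<^sup>2" using X(2)[of n] by simp
        finally have "\<bar>real (Suc n) * (X n i - k i)\<bar> \<le> 2"
          using abs_le_square_iff[of "real (Suc n) * (X n i - k i)" 2] by simp
        then show ?thesis by (simp add: abs_mult pos_le_divide_eq mult.commute del: of_nat_Suc)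
      qed
      moreover have "(\<lambda>n. 2 * (1 / real (Suc n))) \<longlonglongrightarrow> 2 * 0"
        using LIMSEQ_inverse_real_of_nat by (intro tendsto_mult tendsto_const) (simp add: divide_inverse)
      ultimately have "(\<lambda>n. X n i - k i) \<longlonglongrightarrow> 0"
        by (intro Lim_null_comparison[of "\<lambda>n. X n i - k i" "\<lambda>n. 2 * (1 / real (Suc n))"]) auto
      then show ?thesis by (simp add: LIM_zero_iff)
    next
      case False
      then have "X n i = k i" for n using X(1)[of n] U(3) by (auto simp: Rd_def PiE_def extensional_def)
      then show ?thesis by (simp add: tendsto_eventually)
    qed
  qed
  from topological_tendstoD[OF this U(1,2)] obtain n where "X n \<in> U" by (auto simp: eventually_sequentially)
  with X(3) show False by blast
qed

text \<open>Finitely many bumps cover \<open>K\<close>. One minus the product of their complements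
  is 1 as soon as one bump is 1, vanishes where all of them do, and unlike a maximum it is smooth.
  The radius \<open>\<rho>\<close> of the support is recorded because it makes the generator on
  \<open>g\<close> bounded.\<close>

lemma smooth_urysohn:
  assumes K: "compact K" "K \<subseteq> Rd d" and U: "open U" "K \<subseteq> U"
  obtains g \<rho> where "\<And>k. Ck True d k g" "\<And>x. 0 \<le> g x" "\<And>x. g x \<le> 1" "\<And>x. x \<in> K \<Longrightarrow> g x = 1"
    "\<And>x. x \<in> Rd d - U \<Longrightarrow> g x = 0" "\<And>x. x \<in> Rd d \<Longrightarrow> sq d x > \<rho> \<Longrightarrow> g x = 0"
proof -
  have "\<forall>k\<in>K. \<exists>r>0. \<forall>x\<in>Rd d. sq d (aff d (1 / r) (\<lambda>i. - k i / r) x) < 2 \<longrightarrow> x \<in> U"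
    using open_contains_bump[OF U(1)] K(2) U(2) by (metis subsetD)
  then obtain r where r: "\<And>k. k \<in> K \<Longrightarrow> r k > 0"
    "\<And>k x. k \<in> K \<Longrightarrow> x \<in> Rd d \<Longrightarrow> sq d (aff d (1 / r k) (\<lambda>i. - k i / r k) x) < 2 \<Longrightarrow> x \<in> U" by metis
  define a where "a k = aff d (1 / r k) (\<lambda>i. - k i / r k)" for k
  have op: "open {x. sq d (a k x) < 1}" for k
    unfolding a_def
    by (intro open_Collect_less continuous_on_const continuous_on_compose2[OF continuous_on_sq continuous_on_aff]) auto
  have "k \<in> {x. sq d (a k x) < 1}" if "k \<in> K" for k
    by (simp add: a_def aff_def sq_def)
  then have "K \<subseteq> (\<Union>k\<in>K. {x. sq d (a k x) < 1})" by blast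
  then obtain T where T: "T \<subseteq> K" "finite T" "K \<subseteq> (\<Union>k\<in>T. {x. sq d (a k x) < 1})"
    using compactE_image[OF K(1), of K "\<lambda>k. {x. sq d (a k x) < 1}"] op by metis
  define g where "g x = 1 + (-1) * (\<Prod>k\<in>T. 1 + (-1) * cutoff d (a k x))" for x
  \<comment> \<open>Inside the bump at \<open>k\<close> each rescaled coordinate is at most 2 in
    absolute value, which bounds \<open>x i\<close> by
    \<open>(2 + \<bar>k i / r k\<bar>) * r k\<close>; summing over \<open>T\<close> dominates every
    single bump.\<close>
  define \<rho> where "\<rho> = (\<Sum>k\<in>T. \<Sum>i<d. ((2 + \<bar>k i / r k\<bar>) * r k)\<^sup>2)"
  have f01: "0 \<le> 1 + (-1) * cutoff d (a k x)" "1 + (-1) * cutoff d (a k x) \<le> 1" for k x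
    using cutoff_range[of d "a k x"] by auto
  have prod01: "0 \<le> (\<Prod>k\<in>T. 1 + (-1) * cutoff d (a k x))" "(\<Prod>k\<in>T. 1 + (-1) * cutoff d (a k x)) \<le> 1" for x
    using f01 by (auto intro!: prod_nonneg prod_le_1)
  show thesis
  proof (rule that)
    show "Ck True d k g" for k
      unfolding g_def a_def by (intro Ck_add Ck_mult Ck_const Ck_prod T(2) Ck_aff Ck_cutoff)
    show "0 \<le> g x" "g x \<le> 1" for x using prod01[of x] by (auto simp: g_def)
    show "g x = 1" if "x \<in> K" for x
    proof -
      from T(3) that obtain k where k: "k \<in> T" "sq d (a k x) < 1" by auto
      then have "1 + (-1) * cutoff d (a k x) = 0" by (simp add: cutoff_1)
      then have "(\<Prod>k\<in>T. 1 + (-1) * cutoff d (a k x)) = 0" using k(1) T(2) by (intro prod_zero) auto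
      then show ?thesis by (simp add: g_def)
    qed
    have zero: "g x = 0" if "\<And>k. k \<in> T \<Longrightarrow> sq d (a k x) \<ge> 2" for x
      using that by (simp add: g_def cutoff_0)
    show "g x = 0" if "x \<in> Rd d - U" for x
    proof (rule zero, rule ccontr)
      fix k assume "k \<in> T" "\<not> 2 \<le> sq d (a k x)"
      then show False using r(2)[of k x] T(1) that by (auto simp: a_def)
    qed
    show "g x = 0" if x: "x \<in> Rd d" "sq d x > \<rho>" for x
    proof (rule zero, rule ccontr)
      fix k assume k: "k \<in> T" "\<not> 2 \<le> sq d (a k x)"
      have rk: "r k > 0" using r(1) k(1) T(1) by blast
      have "(x i)\<^sup>2 \<le> ((2 + \<bar>k i / r k\<bar>) * r k)\<^sup>2" if i: "i < d" for i
      proof -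
        have "(a k x i)\<^sup>2 \<le> 2\<^sup>2" using coord_sq_le[OF i, of "a k x"] k(2) by simp
        then have "\<bar>a k x i\<bar> \<le> 2" using abs_le_square_iff[of "a k x i" 2] by simp
        moreover have "x i = (a k x i + k i / r k) * r k" using rk i by (simp add: a_def aff_def field_simps)
        ultimately have "\<bar>x i\<bar> \<le> (2 + \<bar>k i / r k\<bar>) * r k"
          using rk abs_triangle_ineq[of "a k x i" "k i / r k"] by (simp only: abs_mult abs_of_pos mult_right_mono)
        then show ?thesis by (simp add: abs_le_square_iff[symmetric])
      qed
      then have "sq d x \<le> (\<Sum>i<d. ((2 + \<bar>k i / r k\<bar>) * r k)\<^sup>2)" unfolding sq_def by (intro sum_mono) auto
      also have "\<dots> \<le> \<rho>" unfolding \<rho>_def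
        by (rule member_le_sum[OF k(1) _ T(2)]) (intro sum_nonneg zero_le_power2)
      finally show False using x(2) by simp
    qed
  qed
qed

section \<open>Transfer of the inequality to measurable sets\<close>

context stationary_solution
begin

lemma compact_open_inequality:
  assumes K: "compact K" "K \<subseteq> Rd d" and U: "open U" "K \<subseteq> U"
    and \<kappa>: "0 < \<kappa>" "\<kappa> \<le> 1" and \<epsilon>: "0 < \<epsilon>" "\<epsilon> < 1"
  shows "measure \<mu> K \<le> (\<epsilon> + measure (std_gaussian d) (U \<inter> Rd d)) powr \<kappa> + sqrt \<kappa> * V * (pi / 2)"
proof -
  interpret G: prob_space "std_gaussian d" by (rule prob_space_std_gaussian)
  obtain g0 \<rho> where g0: "\<And>k. Ck True d k g0" "\<And>x. 0 \<le> g0 x" "\<And>x. g0 x \<le> 1" "\<And>x. x \<in> K \<Longrightarrow> g0 x = 1"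
    "\<And>x. x \<in> Rd d - U \<Longrightarrow> g0 x = 0" "\<And>x. x \<in> Rd d \<Longrightarrow> sq d x > \<rho> \<Longrightarrow> g0 x = 0"
    by (rule smooth_urysohn[OF K U]) blast
  \<comment> \<open>Mixing with a constant gives the positive floor that powers require and keeps
    the value 1 on \<open>K\<close>. Outside a ball \<open>g\<close> is constant, so its derivatives
    still have bounded support.\<close>
  define g where "g x = \<epsilon> + (1 - \<epsilon>) * g0 x" for x
  have Ckg: "Ck True d k g" for k unfolding g_def by (intro Ck_add Ck_mult Ck_const g0(1))
  obtain D E where "bounded_smooth d g D E" using bounded_smooth_exists[OF Ckg] .
  then interpret g: bounded_smooth d g D E .
  have D0: "D i x = 0" if "i < d" "x \<in> Rd d" "sq d x > \<rho>" for i x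
    by (rule partial_zero[OF g.g_deriv[OF that(1,2)] that(2,1) open_sq_gt, of \<rho> d \<epsilon>]) (use that g0(6) in \<open>auto simp: g_def\<close>)
  have E0: "E i x = 0" if "i < d" "x \<in> Rd d" "sq d x > \<rho>" for i x
    by (rule partial_zero[OF g.D_deriv[OF that(1,2)] that(2,1) open_sq_gt, of \<rho> d 0]) (use that D0 in auto)
  have "Ck True d 0 g.Lg"
  proof (rule Ck_compact_support[of _ _ _ \<rho>])
    show "Ck False d 0 g.Lg" using g.continuous_Lg by simp
  qed (simp add: g.Lg_def D0 E0)
  from Ck_bounded[OF this] obtain M where M: "\<And>x. x \<in> Rd d \<Longrightarrow> \<bar>g.Lg x\<bar> \<le> M" by (rule bounded_RdE) blast
  have g_le: "g x \<le> 1" for x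
  proof -
    have "(1 - \<epsilon>) * g0 x \<le> (1 - \<epsilon>) * 1" using g0(3)[of x] \<epsilon> by (intro mult_left_mono) auto
    from this[unfolded mult_1_right] show ?thesis unfolding g_def by linarith
  qed
  have g_ge: "\<epsilon> \<le> g x" for x using g0(2)[of x] \<epsilon> by (simp add: g_def)
  have g_pos: "0 < g x" for x using g_ge[of x] \<epsilon>(1) by linarith
  have main: "(\<integral>x. g x powr \<kappa> \<partial>\<mu>) \<le> (\<integral>z. g z \<partial>std_gaussian d) powr \<kappa> + sqrt \<kappa> * V * (pi / 2)"
    by (rule smooth_powr_inequality[OF g.bounded_smooth_axioms M \<epsilon>(1) g_ge g_le \<kappa>])
  have emb: "B \<inter> Rd d \<in> sets (Pi\<^sub>M {..<d} (\<lambda>_. borel :: real measure))" if "B \<in> sets borel" for B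
    using measurable_sets[OF measurable_embed_Rd that, of d] by (simp add: space_PiM Rd_def vimage_def)
  have Km: "K \<in> sets \<mu>"
    using emb[of K] K compact_imp_closed[OF K(1)] by (simp add: sets_\<mu> Int_absorb2)
  have Um: "U \<inter> Rd d \<in> sets (std_gaussian d)"
    using emb[of U] U by (simp add: sets_std_gaussian)
  have "measure \<mu> K = (\<integral>x. indicator K x \<partial>\<mu>)" using Km by (simp add: sets.sets_into_space)
  also have "\<dots> \<le> (\<integral>x. g x powr \<kappa> \<partial>\<mu>)"
  proof (rule integral_mono)
    show "integrable \<mu> (indicator K :: _ \<Rightarrow> real)" using Km by (simp add: emeasure_eq_measure)
    have [measurable]: "g \<in> borel_measurable \<mu>" by (rule measurable_cont[OF g.g_cb(1)])
    show "integrable \<mu> (\<lambda>x. g x powr \<kappa>)"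
      by (rule integrable_const_bound[of _ 1])
        (use g_le g_pos \<kappa> in \<open>auto intro!: AE_I2 powr_le1 simp: abs_of_pos less_imp_le\<close>)
    show "indicator K x \<le> g x powr \<kappa>" for x
      using g0(4)[of x] by (auto simp: indicator_def g_def)
  qed
  also note main
  also have "(\<integral>z. g z \<partial>std_gaussian d) powr \<kappa> \<le> (\<epsilon> + measure (std_gaussian d) (U \<inter> Rd d)) powr \<kappa>"
  proof (rule powr_mono2)
    show "0 \<le> (\<integral>z. g z \<partial>std_gaussian d)"
      using g_pos by (intro Bochner_Integration.integral_nonneg less_imp_le)
    have iU: "integrable (std_gaussian d) (indicator (U \<inter> Rd d) :: _ \<Rightarrow> real)"
      using Um by (simp add: G.emeasure_eq_measure)
    have "(\<integral>z. g z \<partial>std_gaussian d) \<le> (\<integral>z. \<epsilon> + indicator (U \<inter> Rd d) z \<partial>std_gaussian d)"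
    proof (rule integral_mono)
      have "g \<in> borel_measurable (std_gaussian d)" using borel_measurable_continuous_on_Rd[OF g.g_cb(1)] by measurable
      then show "integrable (std_gaussian d) g"
        by (rule G.integrable_const_bound[of _ 1, rotated]) (use g_le g_pos in \<open>auto simp: abs_of_pos\<close>)
      show "integrable (std_gaussian d) (\<lambda>z. \<epsilon> + indicator (U \<inter> Rd d) z)" using iU by auto
      fix z assume "z \<in> space (std_gaussian d)"
      then have "z \<in> Rd d" by (simp add: space_std_gaussian)
      then show "g z \<le> \<epsilon> + indicator (U \<inter> Rd d) z"
        using g0(5)[of z] g_le[of z] \<epsilon> by (cases "z \<in> U") (auto simp: g_def)
    qed
    also have "\<dots> = \<epsilon> + measure (std_gaussian d) (U \<inter> Rd d)"
      using iU Um by (simp add: G.prob_space sets.sets_into_space)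
    finally show "(\<integral>z. g z \<partial>std_gaussian d) \<le> \<epsilon> + measure (std_gaussian d) (U \<inter> Rd d)" .
  qed (use \<kappa> in simp)
  finally show ?thesis by simp
qed

text \<open>Two limits are taken in turn: for fixed compact \<open>K\<close> the open set shrinks to
  \<open>K\<close> in Gaussian measure while the floor tends to zero, and then \<open>K\<close>
  exhausts \<open>A\<close> in \<open>\<mu>\<close>-measure. Outer regularity is used for the
  Gaussian measure and inner regularity for \<open>\<mu>\<close>.\<close>

lemma measure_inequality:
  assumes A: "A \<in> sets \<mu>" and \<kappa>: "0 < \<kappa>" "\<kappa> \<le> 1"
  shows "measure \<mu> A \<le> measure (std_gaussian d) A powr \<kappa> + sqrt \<kappa> * V * (pi / 2)"
proof -
  interpret G: prob_space "std_gaussian d" by (rule prob_space_std_gaussian)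
  let ?c = "sqrt \<kappa> * V * (pi / 2)"
  have c0: "?c \<ge> 0" using V_nonneg \<kappa> by simp
  have A': "A \<in> sets borel" using A sets_PiM_imp_borel by (simp add: sets_\<mu>)
  have A_Rd: "A \<subseteq> Rd d" using sets.sets_into_space[OF A] by (simp add: space_\<mu>)
  have mid: "(\<lambda>x. x) \<in> measurable \<mu> borel" "(\<lambda>x. x) \<in> measurable (std_gaussian d) borel"
    using measurable_embed_Rd measurable_cong_sets[OF sets_\<mu> refl] measurable_cong_sets[OF sets_std_gaussian refl] by blast+
  define N where "N = distr \<mu> borel (\<lambda>x. x)"
  define H where "H = distr (std_gaussian d) borel (\<lambda>x. x)"
  interpret N: prob_space N unfolding N_def by (rule prob_space_distr[OF mid(1)])
  interpret H: prob_space H unfolding H_def by (rule G.prob_space_distr[OF mid(2)])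
  have N: "measure N B = measure \<mu> (B \<inter> Rd d)" if "B \<in> sets borel" for B
    using measure_distr[OF mid(1) that] by (simp add: N_def space_\<mu> vimage_def)
  have H: "measure H B = measure (std_gaussian d) (B \<inter> Rd d)" if "B \<in> sets borel" for B
    using measure_distr[OF mid(2) that] by (simp add: H_def space_std_gaussian vimage_def)
  have comp: "measure N K \<le> measure (std_gaussian d) A powr \<kappa> + ?c" if K: "K \<subseteq> A" "compact K" for K
  proof -
    have Kb: "K \<in> sets borel" using compact_imp_closed[OF K(2)] by simp
    \<comment> \<open>One \<open>e\<close> is the floor of the test function, the other the excess
      of the measure of \<open>U\<close> over that of \<open>K\<close>.\<close>
    have bound: "measure N K \<le> (measure H K + 2 * e) powr \<kappa> + ?c" if e: "0 < e" "e < 1" for e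
    proof -
      have "emeasure H K = (INF U \<in> {U. K \<subseteq> U \<and> open U}. emeasure H U)"
        by (rule outer_regular[OF _ _ Kb]) (simp_all add: H_def[symmetric] H.emeasure_eq_measure, simp add: H_def)
      moreover have "emeasure H K < emeasure H K + ennreal e"
        using e by (simp add: H.emeasure_eq_measure ennreal_plus[symmetric] ennreal_less_iff del: ennreal_plus)
      ultimately have "(INF U \<in> {U. K \<subseteq> U \<and> open U}. emeasure H U) < emeasure H K + ennreal e" by simp
      then obtain U where U: "K \<subseteq> U" "open U" "emeasure H U < emeasure H K + ennreal e"
        unfolding INF_less_iff by auto
      then have HU: "measure H U < measure H K + e"
        using e by (simp add: H.emeasure_eq_measure ennreal_plus[symmetric] ennreal_less_iff del: ennreal_plus)
      have KRd: "K \<subseteq> Rd d" using K(1) A_Rd by blast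
      have "measure N K = measure \<mu> K" using N[OF Kb] KRd by (simp add: Int_absorb2)
      also have "\<dots> \<le> (e + measure (std_gaussian d) (U \<inter> Rd d)) powr \<kappa> + ?c"
        by (rule compact_open_inequality[OF K(2) KRd U(2,1) \<kappa> e])
      also have "measure (std_gaussian d) (U \<inter> Rd d) = measure H U" using H[of U] U(2) by simp
      also have "(e + measure H U) powr \<kappa> \<le> (measure H K + 2 * e) powr \<kappa>"
        by (rule powr_mono2) (use \<kappa> e HU in auto)
      finally show ?thesis by simp
    qed
    have "measure N K \<le> (measure H K + 2 * 0) powr \<kappa> + ?c"
    proof (rule tendsto_lowerbound)
      have "((\<lambda>e. measure H K + 2 * e) \<longlongrightarrow> measure H K + 2 * 0) (at_right 0)"
        by (intro tendsto_intros)
      from tendsto_powr'[OF this tendsto_const[of \<kappa>]]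
      have "((\<lambda>e. (measure H K + 2 * e) powr \<kappa>) \<longlongrightarrow> (measure H K + 2 * 0) powr \<kappa>) (at_right 0)"
        using \<kappa> by (auto simp: eventually_at_filter intro!: always_eventually add_nonneg_nonneg)
      then show "((\<lambda>e. (measure H K + 2 * e) powr \<kappa> + ?c) \<longlongrightarrow> (measure H K + 2 * 0) powr \<kappa> + ?c) (at_right 0)"
        by (intro tendsto_add tendsto_const)
      show "\<forall>\<^sub>F e in at_right 0. measure N K \<le> (measure H K + 2 * e) powr \<kappa> + ?c"
        using eventually_at_right_real[OF zero_less_one] by eventually_elim (use bound in auto)
    qed simp
    also have "measure H K = measure (std_gaussian d) K" using H[OF Kb] K(1) A_Rd by (simp add: Int_absorb2)
    also have "(measure (std_gaussian d) K + 2 * 0) powr \<kappa> \<le> measure (std_gaussian d) A powr \<kappa>"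
      using \<kappa> A K(1) by (auto intro!: powr_mono2 G.finite_measure_mono simp: sets_std_gaussian sets_\<mu>)
    finally show ?thesis by simp
  qed
  have "emeasure N A = (SUP K \<in> {K. K \<subseteq> A \<and> compact K}. emeasure N K)"
    by (rule inner_regular[OF _ _ A']) (simp_all add: N.emeasure_eq_measure, simp add: N_def)
  also have "\<dots> \<le> ennreal (measure (std_gaussian d) A powr \<kappa> + ?c)"
    by (rule SUP_least) (use comp in \<open>auto simp: N.emeasure_eq_measure intro!: ennreal_leI\<close>)
  finally have "ennreal (measure N A) \<le> ennreal (measure (std_gaussian d) A powr \<kappa> + ?c)"
    unfolding N.emeasure_eq_measure .
  then have "measure N A \<le> measure (std_gaussian d) A powr \<kappa> + ?c"
    by (subst (asm) ennreal_le_iff) (intro add_nonneg_nonneg c0 powr_ge_zero)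
  then show ?thesis using N[OF A'] A_Rd by (simp add: Int_absorb2)
qed

end

section \<open>Tails and moments of the logarithm of the density\<close>

text \<open>The threshold \<open>t0\<close> is where the tail bound reaches 1. Below it
  \<open>X powr \<alpha>\<close> is at most \<open>t0 powr \<alpha>\<close>; above it the dyadic
  levels contribute a geometric series of ratio \<open>2 powr (\<alpha> - \<beta>)\<close>.
  Measuring the levels in units of \<open>t0\<close> puts all dependence on \<open>B\<close> into
  \<open>t0 powr \<alpha> = B powr (\<alpha> / \<beta>)\<close>.\<close>

lemma (in prob_space) powr_moment_of_tail:
  fixes X :: "'a \<Rightarrow> real"
  assumes X [measurable]: "X \<in> borel_measurable M" and X0: "\<And>x. 0 \<le> X x" and B: "B \<ge> 1"
    and \<alpha>: "0 < \<alpha>" "\<alpha> < \<beta>"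
    and tail: "\<And>t. t > 0 \<Longrightarrow> measure M {x \<in> space M. t \<le> X x} \<le> B * t powr (- \<beta>)"
  defines "C \<equiv> 1 + 2 powr \<alpha> * (1 / (1 - 2 powr (\<alpha> - \<beta>)))"
  shows "integrable M (\<lambda>x. X x powr \<alpha>)" "(\<integral>x. X x powr \<alpha> \<partial>M) \<le> C * B powr (\<alpha> / \<beta>)"
proof -
  define t0 where "t0 = B powr (1 / \<beta>)"
  have \<beta>: "\<beta> > 0" using \<alpha> by simp
  have t0: "t0 > 0" using B by (simp add: t0_def)
  have t0a: "t0 powr \<alpha> = B powr (\<alpha> / \<beta>)" by (simp add: t0_def powr_powr)
  have t0b: "B * t0 powr (- \<beta>) = 1"
    using B \<beta> by (simp add: t0_def powr_powr powr_minus)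
  define q where "q = 2 powr (\<alpha> - \<beta>)"
  have q: "0 < q" "q < 1" using \<alpha> by (auto simp: q_def powr_less_one)
  define A where "A k = {x \<in> space M. 2 ^ k * t0 \<le> X x}" for k :: nat
  have A_meas [measurable]: "A k \<in> sets M" for k unfolding A_def by measurable
  have A_prob: "measure M (A k) \<le> 2 powr (- \<beta> * k)" for k
  proof -
    have "measure M (A k) \<le> B * (2 ^ k * t0) powr (- \<beta>)" unfolding A_def by (rule tail) (use t0 in simp)
    also have "\<dots> = (B * t0 powr (- \<beta>)) * (2 ^ k) powr (- \<beta>)" using t0 by (simp add: powr_mult)
    also have "(2 ^ k) powr (- \<beta>) = (2::real) powr (- \<beta> * k)"
      by (simp add: powr_realpow[symmetric] powr_powr mult.commute)
    finally show ?thesis by (simp only: t0b mult_1)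
  qed
  \<comment> \<open>On the shell that starts at level \<open>k\<close> the variable stays below the
    next level, hence \<open>Suc k\<close>.\<close>
  define a where "a k = (2 ^ Suc k * t0) powr \<alpha>" for k :: nat
  have a_eq: "a k = 2 powr \<alpha> * 2 powr (\<alpha> * k) * t0 powr \<alpha>" for k
  proof -
    have "(2 ^ Suc k * t0) powr \<alpha> = (2 powr (real (Suc k))) powr \<alpha> * t0 powr \<alpha>"
      using t0 by (simp add: powr_mult powr_realpow del: of_nat_Suc power_Suc)
    also have "(2 powr (real (Suc k))) powr \<alpha> = 2 powr \<alpha> * 2 powr (\<alpha> * k)"
      by (simp add: powr_powr powr_add[symmetric] algebra_simps)
    finally show ?thesis by (simp add: a_def)
  qed
  have pw: "ennreal (X x powr \<alpha>) \<le> ennreal (t0 powr \<alpha>) + (\<Sum>k. ennreal (a k) * indicator (A k) x)" if x: "x \<in> space M" for x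
  proof (cases "X x < t0")
    case True
    then have "ennreal (X x powr \<alpha>) \<le> ennreal (t0 powr \<alpha>)" using X0 \<alpha> by (intro ennreal_leI powr_mono2) auto
    then show ?thesis by (metis add.right_neutral add_mono zero_le)
  next
    case False
    obtain n where n: "X x / t0 < 2 ^ n" using real_arch_pow[of 2] by auto
    define m where "m = (LEAST n. X x < 2 ^ n * t0)"
    have ex: "X x < 2 ^ n * t0" using n t0 by (simp add: field_simps)
    have m: "X x < 2 ^ m * t0" unfolding m_def by (rule LeastI[of "\<lambda>n. X x < 2 ^ n * t0", OF ex])
    have "m \<noteq> 0" using m False by (intro notI) simp
    then obtain k where k: "m = Suc k" using not0_implies_Suc by blast
    have "\<not> X x < 2 ^ k * t0" using not_less_Least[of k "\<lambda>n. X x < 2 ^ n * t0"] k unfolding m_def by simp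
    then have xA: "x \<in> A k" using x by (simp add: A_def)
    have "ennreal (X x powr \<alpha>) \<le> ennreal (a k) * indicator (A k) x"
      using xA m k X0 \<alpha> by (auto simp: a_def simp del: power_Suc intro!: ennreal_leI powr_mono2)
    also have "\<dots> \<le> (\<Sum>k. ennreal (a k) * indicator (A k) x)"
    proof -
      have "b k \<le> suminf b" for b :: "nat \<Rightarrow> ennreal"
        using sum_le_suminf[of b "{k}"] by simp
      then show ?thesis .
    qed
    finally show ?thesis by (metis add.left_neutral add_mono zero_le)
  qed
  have "(\<integral>\<^sup>+x. ennreal (X x powr \<alpha>) \<partial>M) \<le> (\<integral>\<^sup>+x. ennreal (t0 powr \<alpha>) + (\<Sum>k. ennreal (a k) * indicator (A k) x) \<partial>M)"
    by (rule nn_integral_mono) (rule pw)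
  also have "\<dots> = ennreal (t0 powr \<alpha>) + (\<Sum>k. ennreal (a k) * emeasure M (A k))"
    by (subst nn_integral_add) (auto simp: nn_integral_suminf nn_integral_cmult_indicator emeasure_space_1)
  also have "\<dots> \<le> ennreal (t0 powr \<alpha>) + (\<Sum>k. ennreal (2 powr \<alpha> * t0 powr \<alpha> * q ^ k))"
  proof (intro add_left_mono suminf_le summableI)
    fix k
    have "ennreal (a k) * emeasure M (A k) = ennreal (a k * measure M (A k))"
      by (simp add: emeasure_eq_measure ennreal_mult a_def)
    also have "\<dots> \<le> ennreal (a k * 2 powr (- \<beta> * k))"
      by (intro ennreal_leI mult_left_mono A_prob) (simp add: a_def)
    also have "a k * 2 powr (- \<beta> * k) = 2 powr \<alpha> * t0 powr \<alpha> * (2 powr (\<alpha> * k) * 2 powr (- \<beta> * k))"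
      by (simp add: a_eq)
    also have "2 powr (\<alpha> * k) * 2 powr (- \<beta> * k) = q ^ k"
      using powr_realpow[of q k] q by (simp add: q_def powr_powr powr_add[symmetric] algebra_simps)
    finally show "ennreal (a k) * emeasure M (A k) \<le> ennreal (2 powr \<alpha> * t0 powr \<alpha> * q ^ k)" .
  qed
  also have "(\<Sum>k. ennreal (2 powr \<alpha> * t0 powr \<alpha> * q ^ k)) = ennreal (2 powr \<alpha> * t0 powr \<alpha> * (1 / (1 - q)))"
    using q by (intro suminf_ennreal_eq sums_mult geometric_sums) auto
  also have "ennreal (t0 powr \<alpha>) + \<dots> = ennreal (C * B powr (\<alpha> / \<beta>))"
    using q by (subst ennreal_plus[symmetric]) (auto simp: C_def q_def[symmetric] t0a algebra_simps)
  finally have fin: "(\<integral>\<^sup>+x. ennreal (X x powr \<alpha>) \<partial>M) \<le> ennreal (C * B powr (\<alpha> / \<beta>))" .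
  show int: "integrable M (\<lambda>x. X x powr \<alpha>)"
    by (rule integrableI_nonneg) (use fin in \<open>auto intro: le_less_trans\<close>)
  have "ennreal (\<integral>x. X x powr \<alpha> \<partial>M) = (\<integral>\<^sup>+x. ennreal (X x powr \<alpha>) \<partial>M)"
    by (rule nn_integral_eq_integral[symmetric, OF int]) simp
  then have "ennreal (\<integral>x. X x powr \<alpha> \<partial>M) \<le> ennreal (C * B powr (\<alpha> / \<beta>))" using fin by simp
  moreover have "0 \<le> C * B powr (\<alpha> / \<beta>)" using q by (simp add: C_def q_def[symmetric])
  ultimately show "(\<integral>x. X x powr \<alpha> \<partial>M) \<le> C * B powr (\<alpha> / \<beta>)" by (simp add: ennreal_le_iff)
qed

lemma (in stationary_solution) log_density_tail:
  assumes f [measurable]: "f \<in> borel_measurable (std_gaussian d)" and f0: "\<And>x. 0 \<le> f x"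
    and \<mu>: "\<mu> = density (std_gaussian d) (\<lambda>x. ennreal (f x))" and t: "t > 0"
  shows "measure \<mu> {x \<in> space \<mu>. t \<le> ln (f x + 1)} \<le> 2 * (1 + V) * t powr (- (1/4))"
proof (cases "t < 1")
  case True
  \<comment> \<open>The exponent \<open>\<kappa> = t powr (-1/2)\<close> is admissible only for
    \<open>t \<ge> 1\<close>; for smaller \<open>t\<close> the right-hand side is at least 1 and the
    claim is trivial.\<close>
  have "1 \<le> t powr (- (1/4))" using True t by (simp add: powr_minus one_le_inverse powr_le1)
  then have "1 * 1 \<le> 2 * (1 + V) * t powr (- (1/4))" using V_nonneg by (intro mult_mono) auto
  then show ?thesis by (intro order_trans[OF prob_le_1]) simp
next
  case False
  then have t1: "t \<ge> 1" by simp
  interpret G: prob_space "std_gaussian d" by (rule prob_space_std_gaussian)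
  have nn: "(\<integral>\<^sup>+x. ennreal (f x) \<partial>std_gaussian d) = 1"
    using emeasure_space_1 unfolding \<mu> by (simp add: emeasure_density cong: nn_integral_cong)
  have if1: "integrable (std_gaussian d) f" by (rule integrableI_nonneg) (use f0 nn in auto)
  have If1: "(\<integral>x. f x \<partial>std_gaussian d) = 1" using nn f0 by (simp add: integral_eq_nn_integral)
  let ?A = "{x \<in> space \<mu>. t \<le> ln (f x + 1)}"
  have sp: "space \<mu> = space (std_gaussian d)" by (simp add: \<mu>)
  have A: "?A = {x \<in> space (std_gaussian d). exp t \<le> f x + 1}"
    unfolding sp using f0 by (auto simp: ln_ge_iff add_nonneg_pos)
  have Am: "?A \<in> sets \<mu>" unfolding A by (simp add: \<mu>)
  \<comment> \<open>Markov's inequality for \<open>f + 1\<close>, whose Gaussian integral is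
    2.\<close>
  have "measure (std_gaussian d) {x \<in> space (std_gaussian d). exp t \<le> f x + 1} \<le> (\<integral>x. f x + 1 \<partial>std_gaussian d) / exp t"
    by (rule integral_Markov_inequality_measure[where A="{}"]) (use if1 f0 in \<open>auto intro!: AE_I2 add_nonneg_nonneg\<close>)
  also have "\<dots> = 2 / exp t" using if1 If1 by (simp add: G.prob_space)
  finally have \<gamma>A: "measure (std_gaussian d) ?A \<le> 2 / exp t" unfolding A .
  define \<kappa> where "\<kappa> = t powr (-1/2)"
  have \<kappa>: "0 < \<kappa>" "\<kappa> \<le> 1"
    using t1 powr_mono[of "-1/2" 0 t] by (auto simp: \<kappa>_def)
  have sk: "sqrt \<kappa> = t powr (- (1/4))" by (simp add: \<kappa>_def powr_half_sqrt[symmetric] powr_powr)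
  have "measure \<mu> ?A \<le> measure (std_gaussian d) ?A powr \<kappa> + sqrt \<kappa> * V * (pi / 2)"
    by (rule measure_inequality[OF Am \<kappa>])
  also have "measure (std_gaussian d) ?A powr \<kappa> \<le> (2 / exp t) powr \<kappa>"
    using \<kappa> \<gamma>A by (intro powr_mono2) auto
  also have "\<dots> = exp (\<kappa> * (ln 2 - t))" by (simp add: powr_def ln_div)
  also have "\<dots> = 2 powr \<kappa> * exp (- (\<kappa> * t))"
    by (simp add: powr_def exp_add[symmetric] algebra_simps)
  also have "\<dots> \<le> 2 * t powr (- (1/4))"
  proof (rule mult_mono)
    show "2 powr \<kappa> \<le> 2" using \<kappa> powr_mono[of \<kappa> 1 2] by simp
    have "\<kappa> * t = t powr (1/2)" using t powr_add[of t "-1/2" 1] by (simp add: \<kappa>_def)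
    moreover have "t powr (1/4) \<le> t powr (1/2)" using t1 by (intro powr_mono) auto
    moreover have "t powr (1/2) \<le> exp (t powr (1/2))" using exp_ge_add_one_self[of "t powr (1/2)"] by linarith
    ultimately have "t powr (1/4) \<le> exp (\<kappa> * t)" by simp
    then show "exp (- (\<kappa> * t)) \<le> t powr (- (1/4))"
      using t by (simp add: exp_minus powr_minus le_imp_inverse_le)
  qed auto
  also have "2 * t powr (- (1/4)) + sqrt \<kappa> * V * (pi / 2) \<le> 2 * (1 + V) * t powr (- (1/4))"
  proof -
    have "(sqrt \<kappa> * V) * (pi / 2) \<le> (sqrt \<kappa> * V) * 2"
      using V_nonneg \<kappa> pi_less_4 by (intro mult_left_mono) auto
    then show ?thesis unfolding sk by (simp add: algebra_simps)
  qed
  finally show ?thesis by simp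
qed

text \<open>For \<open>V \<le> 1\<close> the summand 1 on the right suffices; for
  \<open>V > 1\<close> the logarithm is at least \<open>ln 2\<close>. The constant is the sum of
  those of the two cases.\<close>

lemma one_plus_le_log_factor:
  fixes V \<alpha> :: real
  assumes V: "0 \<le> V" and \<alpha>: "0 < \<alpha>"
  shows "1 + V \<le> (2 + 2 / ln 2 powr \<alpha>) * (1 + V * ln (1 + V) powr \<alpha>)"
proof (cases "V \<le> 1")
  case True
  have "1 + V \<le> 2 * 1" using True by simp
  also have "\<dots> \<le> (2 + 2 / ln 2 powr \<alpha>) * (1 + V * ln (1 + V) powr \<alpha>)"
    using V by (intro mult_mono) auto
  finally show ?thesis .
next
  case False
  have "ln 2 powr \<alpha> \<le> ln (1 + V) powr \<alpha>" using False \<alpha> by (intro powr_mono2) auto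
  then have "1 \<le> ln (1 + V) powr \<alpha> / ln 2 powr \<alpha>" by (simp add: le_divide_eq)
  then have "2 * V * 1 \<le> 2 * V * (ln (1 + V) powr \<alpha> / ln 2 powr \<alpha>)" using V by (intro mult_left_mono) auto
  also have "\<dots> = 2 / ln 2 powr \<alpha> * (V * ln (1 + V) powr \<alpha>)" by simp
  also have "\<dots> \<le> (2 + 2 / ln 2 powr \<alpha>) * (1 + V * ln (1 + V) powr \<alpha>)"
    using V by (intro mult_mono) auto
  finally show ?thesis using False by simp
qed

theorem theorem2p1:
  fixes \<alpha> :: real
  assumes "0 < \<alpha>" and "\<alpha> < 1/4"
  shows "\<exists>C::real. \<forall>(d::nat) (f :: (nat \<Rightarrow> real) \<Rightarrow> real)
           (v :: (nat \<Rightarrow> real) \<Rightarrow> (nat \<Rightarrow> real)) (\<mu> :: (nat \<Rightarrow> real) measure).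
      d \<ge> 1 \<longrightarrow>
      f \<in> borel_measurable (std_gaussian d) \<longrightarrow>
      (AE x in std_gaussian d. 0 \<le> f x) \<longrightarrow>
      \<mu> = density (std_gaussian d) (\<lambda>x. ennreal (f x)) \<longrightarrow>
      prob_space \<mu> \<longrightarrow>
      v \<in> measurable (Pi\<^sub>M {..<d} (\<lambda>_. borel)) (Pi\<^sub>M {..<d} (\<lambda>_. borel)) \<longrightarrow>
      integrable \<mu> (\<lambda>x. L2_set (v x) {..<d}) \<longrightarrow>
      stationary_FPK d (\<lambda>x i. - x i + v x i) \<mu> \<longrightarrow>
      integrable (std_gaussian d) (\<lambda>x. f x * (ln (f x + 1)) powr \<alpha>) \<and>
      (\<integral>x. f x * (ln (f x + 1)) powr \<alpha> \<partial>(std_gaussian d))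
        \<le> C * (1 + L1_norm d \<mu> v * (ln (1 + L1_norm d \<mu> v)) powr \<alpha>)"
proof -
  \<comment> \<open>The constant of \<open>powr_moment_of_tail\<close> for
    \<open>\<beta> = 1/4\<close>, the decay rate in \<open>log_density_tail\<close>.\<close>
  define c where "c = 1 + 2 powr \<alpha> * (1 / (1 - 2 powr (\<alpha> - 1/4)))"
  have "2 powr (\<alpha> - 1/4) \<le> (1::real)" using assms powr_mono[of "\<alpha> - 1/4" 0 2] by simp
  then have c: "c \<ge> 0" by (simp add: c_def)
  show ?thesis
  proof (intro exI[of _ "c * (2 * (2 + 2 / ln 2 powr \<alpha>))"] allI impI)
    fix d :: nat and f :: "(nat \<Rightarrow> real) \<Rightarrow> real" and v :: "(nat \<Rightarrow> real) \<Rightarrow> nat \<Rightarrow> real" and \<mu> :: "(nat \<Rightarrow> real) measure"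
    assume f [measurable]: "f \<in> borel_measurable (std_gaussian d)" and f0: "AE x in std_gaussian d. 0 \<le> f x"
      and \<mu>: "\<mu> = density (std_gaussian d) (\<lambda>x. ennreal (f x))" and "prob_space \<mu>"
      and v: "v \<in> measurable (Pi\<^sub>M {..<d} (\<lambda>_. borel)) (Pi\<^sub>M {..<d} (\<lambda>_. borel))"
        "integrable \<mu> (\<lambda>x. L2_set (v x) {..<d})" "stationary_FPK d (\<lambda>x i. - x i + v x i) \<mu>"
    interpret prob_space \<mu> by fact
    interpret stationary_solution d v \<mu>
      by unfold_locales (use v in \<open>auto simp: \<mu> sets_std_gaussian\<close>)
    \<comment> \<open>The density is nonnegative only almost everywhere, while the tail estimate
      wants it everywhere. Since \<open>ennreal\<close> sends negative numbers to 0, the truncated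
      density defines the same measure.\<close>
    define F where "F x = max 0 (f x)" for x
    have F [measurable]: "F \<in> borel_measurable (std_gaussian d)" unfolding F_def by measurable
    have F0: "F x \<ge> 0" for x by (simp add: F_def)
    have \<mu>F: "\<mu> = density (std_gaussian d) (\<lambda>x. ennreal (F x))"
    proof -
      have "ennreal (f x) = ennreal (F x)" for x
        by (cases "0 \<le> f x") (auto simp: F_def ennreal_neg)
      then show ?thesis unfolding \<mu> by simp
    qed
    define X where "X x = ln (F x + 1)" for x
    have X [measurable]: "X \<in> borel_measurable (std_gaussian d)" unfolding X_def by measurable
    have X\<mu>: "X \<in> borel_measurable \<mu>" unfolding \<mu> by simp
    have X0: "X x \<ge> 0" for x using F0[of x] by (simp add: X_def)
    have tail: "measure \<mu> {x \<in> space \<mu>. t \<le> X x} \<le> 2 * (1 + V) * t powr (- (1/4))" if "t > 0" for t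
      unfolding X_def by (rule log_density_tail[OF F F0 \<mu>F that])
    have B: "1 \<le> 2 * (1 + V)" using V_nonneg by simp
    have mom: "integrable \<mu> (\<lambda>x. X x powr \<alpha>)"
      "(\<integral>x. X x powr \<alpha> \<partial>\<mu>) \<le> c * (2 * (1 + V)) powr (\<alpha> / (1/4))"
      unfolding c_def
      by (rule powr_moment_of_tail(1)[OF X\<mu> X0 B assms tail] powr_moment_of_tail(2)[OF X\<mu> X0 B assms tail]; assumption)+
    have ae: "AE x in std_gaussian d. f x * ln (f x + 1) powr \<alpha> = F x *\<^sub>R X x powr \<alpha>"
      using f0 by eventually_elim (simp add: F_def X_def)
    have "integrable (std_gaussian d) (\<lambda>x. F x *\<^sub>R X x powr \<alpha>)"
      using mom(1) F0 unfolding \<mu>F by (subst (asm) integrable_density) auto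
    then have 1: "integrable (std_gaussian d) (\<lambda>x. f x * ln (f x + 1) powr \<alpha>)"
      by (subst integrable_cong_AE[OF _ _ ae]) auto
    have "(\<integral>x. f x * ln (f x + 1) powr \<alpha> \<partial>std_gaussian d) = (\<integral>x. F x *\<^sub>R X x powr \<alpha> \<partial>std_gaussian d)"
      by (rule integral_cong_AE[OF _ _ ae]) auto
    also have "\<dots> = (\<integral>x. X x powr \<alpha> \<partial>\<mu>)"
      unfolding \<mu>F using F0 by (subst integral_density) auto
    also have "\<dots> \<le> c * (2 * (1 + V)) powr (\<alpha> / (1/4))" by (rule mom(2))
    \<comment> \<open>The hypothesis \<open>\<alpha> < 1/4\<close>, already used for the convergence
      of the dyadic series, enters again: the exponent \<open>4 * \<alpha>\<close> is below 1 and
      the base is at least 1.\<close>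
    also have "\<dots> \<le> c * (2 * (1 + V))"
      using powr_mono[of "\<alpha> / (1/4)" 1 "2 * (1 + V)"] B assms c by (intro mult_left_mono) auto
    also have "\<dots> \<le> c * (2 * ((2 + 2 / ln 2 powr \<alpha>) * (1 + V * ln (1 + V) powr \<alpha>)))"
      using c one_plus_le_log_factor[OF V_nonneg assms(1)] by (intro mult_left_mono) auto
    finally have 2: "(\<integral>x. f x * ln (f x + 1) powr \<alpha> \<partial>std_gaussian d)
      \<le> c * (2 * (2 + 2 / ln 2 powr \<alpha>)) * (1 + V * ln (1 + V) powr \<alpha>)" by (simp only: mult.assoc)
    show "integrable (std_gaussian d) (\<lambda>x. f x * ln (f x + 1) powr \<alpha>) \<and>
      (\<integral>x. f x * ln (f x + 1) powr \<alpha> \<partial>std_gaussian d) \<le> c * (2 * (2 + 2 / ln 2 powr \<alpha>)) * (1 + V * ln (1 + V) powr \<alpha>)"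
      using 1 2 by blast
  qed
qed

end
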